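(* Let $\mathcal{L}$ be a left bialgebroid over $B$ which is an anti-left Hopf algebroid. Then every left $\mathcal{L}$-comodule $\Gamma$ is skew regular. More precisely, for all $p\in\Gamma$, $$p_{[1]}\otimes^{B}p_{[0]}=p_{(-1)[-]}\otimes^{B}\varepsilon(p_{(-1)[+]})\,p_{(0)}\quad\text{in } \mathcal{L}\otimes^B\Gamma .$$ Moreover, for all $p\in\Gamma$, $$p_{[1]}\otimes p_{[0](-1)}\otimes p_{[0](0)}=p_{(-1)[-]}\otimes p_{(-1)[+]}\otimes p_{(0)},$$ an equality in the subspace of those elements $\sum X\otimes Y\otimes q$ of the quotient of $\mathcal{L}\otimes\mathcal{L}\otimes\Gamma$ by the relations $bX\otimes Y\otimes q=X\otimes Yb\otimes q$ and $X\otimes\bar cY\otimes q=X\otimes Y\otimes cq$ ($b,c\in B$) which satisfy $\sum Xa\otimes Y\otimes q=\sum X\otimes aY\otimes q$ and $\sum X\otimes Y\bar d\otimes q=\sum X\otimes Y\otimes qd$ for all $a,d\in B$.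
   Context: $k$ is a field, $B$ a unital $k$-algebra, $\overline B$ its opposite algebra with canonical anti-isomorphism $B\to\overline B$, $b\mapsto\bar b$, and $B^e=B\otimes\overline B$. $M\diamond_B N:=M\otimes N/\langle \bar bm\otimes n-m\otimes bn\rangle$; $M\times_BN:=\{\sum m_i\otimes n_i\in M\diamond_BN:\ \sum m_i\bar a\otimes n_i=\sum m_i\otimes n_ia\ \forall a\in B\}$; $M\otimes^BN:=M\otimes N/\langle bm\otimes n-m\otimes nb\rangle$. A left bialgebroid over $B$ is an algebra $\mathcal{L}$ with algebra maps $s:B\to\mathcal{L}$, $t:\overline B\to\mathcal{L}$ with commuting images (one writes $b,\bar b$ for $s(b),t(\bar b)$), with left $B^e$-module maps $\Delta:\mathcal{L}\to\mathcal{L}\times_B\mathcal{L}$, $\Delta(X)=X_{(1)}\otimes X_{(2)}$ (so $\Delta(b\bar cX)=bX_{(1)}\otimes\bar cX_{(2)}$) and $\varepsilon:\mathcal{L}\to B$ (so $\varepsilon(b\bar cX)=b\varepsilon(X)c$), coassociative and counital ($\varepsilon(X_{(1)})X_{(2)}=\overline{\varepsilon(X_{(2)})}X_{(1)}=X$), such that $\Delta$ is an algebra map (componentwise product on $\mathcal{L}\times_B\mathcal{L}$), $\varepsilon(1)=1$ and $\varepsilon(X\varepsilon(Y))=\varepsilon(XY)=\varepsilon(X\overline{\varepsilon(Y)})$. Standing assumption: all $B$-module and $\overline B$-module structures are faithfully flat. $\mathcal{L}$ is an anti-left Hopf algebroid if $\mu:\mathcal{L}\otimes^B\mathcal{L}\to\mathcal{L}\diamond_B\mathcal{L}$,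 $\mu(X\otimes Y)=Y_{(1)}X\otimes Y_{(2)}$, is bijective; one writes $X_{[-]}\otimes^BX_{[+]}:=\mu^{-1}(1\diamond X)$. A left $\mathcal{L}$-comodule is a $B$-bimodule $\Gamma$ with a map $\Gamma\to\mathcal{L}\times_B\Gamma\subseteq\mathcal{L}\diamond_B\Gamma$, $p\mapsto p_{(-1)}\otimes p_{(0)}$, coassociative, with $\varepsilon(p_{(-1)})p_{(0)}=p$, and such that $bpb'\mapsto bp_{(-1)}b'\otimes p_{(0)}$ for $b,b'\in B$. It is skew regular if $\phi:\mathcal{L}\otimes^B\Gamma\to\mathcal{L}\diamond_B\Gamma$, $\phi(X\otimes p)=p_{(-1)}X\otimes p_{(0)}$, is bijective; then $p_{[1]}\otimes^Bp_{[0]}:=\phi^{-1}(1\diamond p)$. *)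

theory Defs
  imports Complex_Main "HOL-Library.Poly_Mapping" "HOL-Algebra.Module"
begin

section \<open>Quotients of free abelian groups\<close>

text \<open>
  All tensor products are quotients of a free abelian group (finite formal sums, \<^typ>\<open>'a \<Rightarrow>\<^sub>0 int\<close>)
  by the subgroup generated by a set of relators; their elements are the cosets.
\<close>

inductive_set add_span :: "'a::ab_group_add set \<Rightarrow> 'a set" for R where
  zero: "0 \<in> add_span R"
| gen: "x \<in> R \<Longrightarrow> x \<in> add_span R"
| diff: "x \<in> add_span R \<Longrightarrow> y \<in> add_span R \<Longrightarrow> x - y \<in> add_span R"

definition cls :: "'a::ab_group_add set \<Rightarrow> 'a \<Rightarrow> 'a set" where
  "cls R x = {y. y - x \<in> add_span R}"

definition quot :: "'a::ab_group_add set \<Rightarrow> 'a set set" where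
  "quot R = range (cls R)"

text \<open>An arbitrary formal sum representing a class (Sweedler legs); it is only used in expressions
  whose class does not depend on the choice.\<close>

definition rep :: "'a set \<Rightarrow> 'a" where
  "rep c = (SOME x. x \<in> c)"

text \<open>The map between quotients induced by a map \<open>f\<close> of formal sums. If \<open>f\<close> respects the
  relations, all sets in the union coincide and \<open>induced R' f (cls R x) = cls R' (f x)\<close>.\<close>

definition induced :: "'b::ab_group_add set \<Rightarrow> ('a \<Rightarrow> 'b) \<Rightarrow> 'a set \<Rightarrow> 'b set" where
  "induced R' f c = (\<Union>x\<in>c. cls R' (f x))"

definition fmap :: "('a \<Rightarrow> 'b) \<Rightarrow> ('a \<Rightarrow>\<^sub>0 int) \<Rightarrow> ('b \<Rightarrow>\<^sub>0 int)" where
  "fmap f = frag_extend (\<lambda>a. frag_of (f a))"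

text \<open>The value of the formal sum of the \<open>f a\<close> in a vector space with scalar multiplication \<open>sc\<close>.\<close>

definition eval_sum ::
  "('k::field \<Rightarrow> 'v::ab_group_add \<Rightarrow> 'v) \<Rightarrow> ('a \<Rightarrow> 'v) \<Rightarrow> ('a \<Rightarrow>\<^sub>0 int) \<Rightarrow> 'v" where
  "eval_sum sc f x = (\<Sum>a\<in>Poly_Mapping.keys x. sc (of_int (Poly_Mapping.lookup x a)) (f a))"

definition biadditive_relators ::
  "'n set \<Rightarrow> ('n \<Rightarrow> 'n \<Rightarrow> 'n) \<Rightarrow> ('n \<times> 'm::ab_group_add \<Rightarrow>\<^sub>0 int) set" where
  "biadditive_relators C pl =
     {frag_of (pl n n', m) - frag_of (n, m) - frag_of (n', m) | n n' m. n \<in> C \<and> n' \<in> C}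
   \<union> {frag_of (n, m + m') - frag_of (n, m) - frag_of (n, m') | n m m'. n \<in> C}"

text \<open>The relations \<open>f a n \<otimes> m = n \<otimes> g a m\<close>.\<close>

definition balancing_relators ::
  "'n set \<Rightarrow> ('a \<Rightarrow> 'n \<Rightarrow> 'n) \<Rightarrow> ('a \<Rightarrow> 'm \<Rightarrow> 'm) \<Rightarrow> ('n \<times> 'm \<Rightarrow>\<^sub>0 int) set" where
  "balancing_relators C f g = {frag_of (f a n, m) - frag_of (n, g a m) | a n m. n \<in> C}"


section \<open>Faithful flatness over a possibly noncommutative ring\<close>

text \<open>
  The ring is a type of sort \<open>{ring, monoid_mult}\<close> (unital, zero ring allowed) whose multiplication
  \<open>mul\<close> is passed explicitly, so that the opposite ring is obtained by flipping \<open>mul\<close>. The record type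
  of library modules is reused, with the scalar action read as a right action:
  \<open>r \<odot> n\<close> stands for \<open>n \<cdot> r\<close>.
\<close>

locale right_module = abelian_group N
  for mul :: "'b::{ring,monoid_mult} \<Rightarrow> 'b \<Rightarrow> 'b" and N :: "('b, 'u) module" (structure) +
  assumes act_closed: "n \<in> carrier N \<Longrightarrow> r \<odot> n \<in> carrier N"
    and act_add_left: "n \<in> carrier N \<Longrightarrow> (r + r') \<odot> n = r \<odot> n \<oplus> r' \<odot> n"
    and act_add_right: "n \<in> carrier N \<Longrightarrow> n' \<in> carrier N \<Longrightarrow> r \<odot> (n \<oplus> n') = r \<odot> n \<oplus> r \<odot> n'"
    and act_mul: "n \<in> carrier N \<Longrightarrow> mul r r' \<odot> n = r' \<odot> (r \<odot> n)"
    and act_one: "n \<in> carrier N \<Longrightarrow> 1 \<odot> n = n"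

definition rmod_hom :: "('b, 'u) module \<Rightarrow> ('b, 'u) module \<Rightarrow> ('u \<Rightarrow> 'u) set" where
  "rmod_hom N N' = {f \<in> carrier N \<rightarrow> carrier N'.
     (\<forall>x\<in>carrier N. \<forall>y\<in>carrier N. f (x \<oplus>\<^bsub>N\<^esub> y) = f x \<oplus>\<^bsub>N'\<^esub> f y) \<and>
     (\<forall>r. \<forall>x\<in>carrier N. f (r \<odot>\<^bsub>N\<^esub> x) = r \<odot>\<^bsub>N'\<^esub> f x)}"

text \<open>The tensor product \<open>N \<otimes>\<^sub>R M\<close> of a right module \<open>N\<close> with the left module given by the whole type
  \<^typ>\<open>'m\<close> and the action \<open>act\<close>.\<close>

definition rtensor_relators ::
  "('b, 'u) module \<Rightarrow> ('b \<Rightarrow> 'm \<Rightarrow> 'm) \<Rightarrow> ('u \<times> 'm::ab_group_add \<Rightarrow>\<^sub>0 int) set" where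
  "rtensor_relators N act =
     biadditive_relators (carrier N) (add N) \<union> balancing_relators (carrier N) (smult N) act"

definition rtensor ::
  "('b, 'u) module \<Rightarrow> ('b \<Rightarrow> 'm \<Rightarrow> 'm) \<Rightarrow> ('u \<times> 'm::ab_group_add \<Rightarrow>\<^sub>0 int) set set" where
  "rtensor N act = cls (rtensor_relators N act) ` {x. Poly_Mapping.keys x \<subseteq> carrier N \<times> UNIV}"

definition rtensor_map ::
  "('b, 'u) module \<Rightarrow> ('b \<Rightarrow> 'm \<Rightarrow> 'm) \<Rightarrow> ('u \<Rightarrow> 'u)
   \<Rightarrow> ('u \<times> 'm::ab_group_add \<Rightarrow>\<^sub>0 int) set \<Rightarrow> ('u \<times> 'm \<Rightarrow>\<^sub>0 int) set" where
  "rtensor_map N' act f = induced (rtensor_relators N' act) (fmap (\<lambda>(n, m). (f n, m)))"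

text \<open>
  A sequence of right modules is exact if and only if it is exact after applying \<open>- \<otimes>\<^sub>R M\<close>.
  HOL cannot quantify over all types inside a predicate, so the test modules have their carriers in
  \<open>(nat \<Rightarrow> 'b) set\<close>. Every countably generated module is isomorphic to one of these: with generators
  \<open>g\<^sub>i\<close>, send \<open>n\<close> to the set of finitely supported \<open>c\<close> with \<open>\<Sum>\<^sub>i g\<^sub>i c\<^sub>i = n\<close>. Finitely generated
  ideals and cyclic modules already detect flatness and faithfulness, so this is the usual notion.
\<close>

definition faithfully_flat ::
  "('b::{ring,monoid_mult} \<Rightarrow> 'b \<Rightarrow> 'b) \<Rightarrow> ('b \<Rightarrow> 'm::ab_group_add \<Rightarrow> 'm) \<Rightarrow> bool" where
  "faithfully_flat mul act \<longleftrightarrow>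
     (\<forall>(N1 :: ('b, (nat \<Rightarrow> 'b) set) module) (N2 :: ('b, (nat \<Rightarrow> 'b) set) module)
       (N3 :: ('b, (nat \<Rightarrow> 'b) set) module) f g.
        right_module mul N1 \<and> right_module mul N2 \<and> right_module mul N3 \<and>
        f \<in> rmod_hom N1 N2 \<and> g \<in> rmod_hom N2 N3 \<longrightarrow>
        (f ` carrier N1 = {n \<in> carrier N2. g n = \<zero>\<^bsub>N3\<^esub>}) =
        (rtensor_map N2 act f ` rtensor N1 act =
           {v \<in> rtensor N2 act. rtensor_map N3 act g v = cls (rtensor_relators N3 act) 0}))"


section \<open>Algebras and bimodules\<close>

locale unital_algebra = vector_space scale
  for scale :: "'k::field \<Rightarrow> 'a::{ring,monoid_mult} \<Rightarrow> 'a" +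
  assumes scale_mult_left: "scale c (x * y) = scale c x * y"
    and scale_mult_right: "scale c (x * y) = x * scale c y"

record ('k, 'b, 'p) bimod =
  mscale :: "'k \<Rightarrow> 'p \<Rightarrow> 'p"
  lact :: "'b \<Rightarrow> 'p \<Rightarrow> 'p"
  ract :: "'p \<Rightarrow> 'b \<Rightarrow> 'p"

locale bimodule = vector_space "mscale M"
  for bscale :: "'k::field \<Rightarrow> 'b::{ring,monoid_mult} \<Rightarrow> 'b"
    and M :: "('k, 'b, 'p::ab_group_add, 'z) bimod_scheme" +
  assumes lact_add_left: "lact M (b + b') p = lact M b p + lact M b' p"
    and lact_add_right: "lact M b (p + p') = lact M b p + lact M b p'"
    and lact_mult: "lact M (b * b') p = lact M b (lact M b' p)"
    and lact_one: "lact M 1 p = p"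
    and ract_add_left: "ract M (p + p') b = ract M p b + ract M p' b"
    and ract_add_right: "ract M p (b + b') = ract M p b + ract M p b'"
    and ract_mult: "ract M p (b * b') = ract M (ract M p b) b'"
    and ract_one: "ract M p 1 = p"
    and lact_ract: "ract M (lact M b p) b' = lact M b (ract M p b')"
    and lact_scale: "lact M (bscale c b) p = mscale M c (lact M b p)"
      "lact M b (mscale M c p) = mscale M c (lact M b p)"
    and ract_scale: "ract M p (bscale c b) = mscale M c (ract M p b)"
      "ract M (mscale M c p) b = mscale M c (ract M p b)"


section \<open>Left bialgebroids and their comodules\<close>

text \<open>
  The opposite algebra of \<open>B\<close> is not a separate type: \<open>tgt b\<close> is the image of the element \<open>b\<close>-bar, so
  \<open>tgt\<close> is anti-multiplicative. Values of the coproduct and of coactions are classes modulo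
  \<open>diamond_relators\<close> below.
\<close>

record ('k, 'b, 'l) bialgebroid =
  bscale :: "'k \<Rightarrow> 'b \<Rightarrow> 'b"
  lscale :: "'k \<Rightarrow> 'l \<Rightarrow> 'l"
  src :: "'b \<Rightarrow> 'l"
  tgt :: "'b \<Rightarrow> 'l"
  coprod :: "'l \<Rightarrow> ('l \<times> 'l \<Rightarrow>\<^sub>0 int) set"
  counit :: "'l \<Rightarrow> 'b"

record ('k, 'b, 'p, 'l) comod = "('k, 'b, 'p) bimod" +
  coact :: "'p \<Rightarrow> ('l \<times> 'p \<Rightarrow>\<^sub>0 int) set"

text \<open>\<open>L\<close> as a \<open>B\<close>-bimodule via \<open>b X b' = s(b) X s(b')\<close>, coacting on itself by the coproduct.\<close>

definition regular ::
  "('k, 'b, 'l::{ring,monoid_mult}) bialgebroid \<Rightarrow> ('k, 'b, 'l, 'l) comod" where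
  "regular L = \<lparr>mscale = lscale L, lact = (\<lambda>b X. src L b * X), ract = (\<lambda>X b. X * src L b),
                coact = coprod L\<rparr>"

definition field_relators ::
  "('k, 'b, 'l::{ring,monoid_mult}) bialgebroid \<Rightarrow> ('k, 'b, 'p::ab_group_add, 'z) bimod_scheme
   \<Rightarrow> ('l \<times> 'p \<Rightarrow>\<^sub>0 int) set" where
  "field_relators L M =
     biadditive_relators UNIV (+) \<union> balancing_relators UNIV (lscale L) (mscale M)"

text \<open>\<open>L \<diamondop>\<^sub>B M\<close>, with relations \<open>b\<close>-bar \<open>X \<otimes> m = X \<otimes> b m\<close>.\<close>

definition diamond_relators ::
  "('k, 'b, 'l::{ring,monoid_mult}) bialgebroid \<Rightarrow> ('k, 'b, 'p::ab_group_add, 'z) bimod_scheme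
   \<Rightarrow> ('l \<times> 'p \<Rightarrow>\<^sub>0 int) set" where
  "diamond_relators L M =
     field_relators L M \<union> balancing_relators UNIV (\<lambda>b X. tgt L b * X) (lact M)"

text \<open>\<open>L \<otimes>\<^sup>B M\<close>, with relations \<open>b X \<otimes> m = X \<otimes> m b\<close>.\<close>

definition uptensor_relators ::
  "('k, 'b, 'l::{ring,monoid_mult}) bialgebroid \<Rightarrow> ('k, 'b, 'p::ab_group_add, 'z) bimod_scheme
   \<Rightarrow> ('l \<times> 'p \<Rightarrow>\<^sub>0 int) set" where
  "uptensor_relators L M =
     field_relators L M \<union> balancing_relators UNIV (\<lambda>b X. src L b * X) (\<lambda>b m. ract M m b)"

definition takeuchi ::
  "('k, 'b, 'l::{ring,monoid_mult}) bialgebroid \<Rightarrow> ('k, 'b, 'p::ab_group_add, 'z) bimod_scheme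
   \<Rightarrow> ('l \<times> 'p \<Rightarrow>\<^sub>0 int) set set" where
  "takeuchi L M = {c \<in> quot (diamond_relators L M). \<forall>a.
     induced (diamond_relators L M) (fmap (\<lambda>(X, m). (X * tgt L a, m))) c =
     induced (diamond_relators L M) (fmap (\<lambda>(X, m). (X, ract M m a))) c}"

text \<open>Threefold tensor products: \<open>S\<close> relates the first two factors, \<open>R\<close> the last two.\<close>

definition triple_relators ::
  "('l \<times> 'l \<Rightarrow>\<^sub>0 int) set \<Rightarrow> ('l \<times> 'p \<Rightarrow>\<^sub>0 int) set \<Rightarrow> ('l \<times> 'l \<times> 'p \<Rightarrow>\<^sub>0 int) set" where
  "triple_relators S R =
     {fmap (\<lambda>(X, Y). (X, Y, q)) x | x q. x \<in> S} \<union> {fmap (\<lambda>(Y, q). (X, Y, q)) x | X x. x \<in> R}"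

definition diamond3_relators ::
  "('k, 'b, 'l::{ring,monoid_mult}) bialgebroid \<Rightarrow> ('k, 'b, 'p::ab_group_add, 'z) bimod_scheme
   \<Rightarrow> ('l \<times> 'l \<times> 'p \<Rightarrow>\<^sub>0 int) set" where
  "diamond3_relators L M =
     triple_relators (diamond_relators L (regular L)) (diamond_relators L M)"

text \<open>\<open>x \<mapsto> \<Sum> X \<otimes> coact p\<close> on formal sums \<open>x = \<Sum> X \<otimes> p\<close>, and \<open>x \<mapsto> \<Sum> coprod Y \<otimes> q\<close> on \<open>x = \<Sum> Y \<otimes> q\<close>.\<close>

definition coact_right ::
  "('k, 'b, 'p, 'l) comod \<Rightarrow> ('l \<times> 'p \<Rightarrow>\<^sub>0 int) \<Rightarrow> ('l \<times> 'l \<times> 'p \<Rightarrow>\<^sub>0 int)" where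
  "coact_right G = frag_extend (\<lambda>(X, p). fmap (\<lambda>(Y, q). (X, Y, q)) (rep (coact G p)))"

definition coprod_left ::
  "('k, 'b, 'l) bialgebroid \<Rightarrow> ('l \<times> 'p \<Rightarrow>\<^sub>0 int) \<Rightarrow> ('l \<times> 'l \<times> 'p \<Rightarrow>\<^sub>0 int)" where
  "coprod_left L = frag_extend (\<lambda>(Y, q). fmap (\<lambda>(X, Z). (X, Z, q)) (rep (coprod L Y)))"

definition formal_mult ::
  "('l::{ring,monoid_mult} \<times> 'l \<Rightarrow>\<^sub>0 int) \<Rightarrow> ('l \<times> 'l \<Rightarrow>\<^sub>0 int) \<Rightarrow> ('l \<times> 'l \<Rightarrow>\<^sub>0 int)" where
  "formal_mult x y = frag_extend (\<lambda>(a, b). fmap (\<lambda>(c, d). (a * c, b * d)) y) x"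

locale left_comodule = bimodule "bscale L" G
  for L :: "('k::field, 'b::{ring,monoid_mult}, 'l::{ring,monoid_mult}) bialgebroid"
    and G :: "('k, 'b, 'p::ab_group_add, 'l) comod" +
  assumes coact_takeuchi: "coact G p \<in> takeuchi L G"
    and coact_add: "coact G (p + p') = cls (diamond_relators L G) (rep (coact G p) + rep (coact G p'))"
    and coact_bimodule: "coact G (lact G b (ract G p b')) =
      induced (diamond_relators L G) (fmap (\<lambda>(Y, q). (src L b * Y * src L b', q))) (coact G p)"
    and coassoc: "induced (diamond3_relators L G) (coprod_left L) (coact G p) =
      induced (diamond3_relators L G) (coact_right G) (coact G p)"
    and coact_counit:
      "eval_sum (mscale G) (\<lambda>(Y, q). lact G (counit L Y) q) (rep (coact G p)) = p"

locale left_bialgebroid =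
  fixes L :: "('k::field, 'b::{ring,monoid_mult}, 'l::{ring,monoid_mult}) bialgebroid"
  assumes base_algebra: "unital_algebra (bscale L)"
    and total_algebra: "unital_algebra (lscale L)"
    and src_linear: "Vector_Spaces.linear (bscale L) (lscale L) (src L)"
    and src_mult: "src L (b * c) = src L b * src L c"
    and src_one: "src L 1 = 1"
    and tgt_linear: "Vector_Spaces.linear (bscale L) (lscale L) (tgt L)"
    and tgt_mult: "tgt L (b * c) = tgt L c * tgt L b"
    and tgt_one: "tgt L 1 = 1"
    and src_tgt_commute: "src L b * tgt L c = tgt L c * src L b"
    and coprod_takeuchi: "coprod L X \<in> takeuchi L (regular L)"
    and coprod_add: "coprod L (X + Y) =
      cls (diamond_relators L (regular L)) (rep (coprod L X) + rep (coprod L Y))"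
    and coprod_bimodule: "coprod L (src L b * tgt L c * X) =
      induced (diamond_relators L (regular L))
        (fmap (\<lambda>(Y, Z). (src L b * Y, tgt L c * Z))) (coprod L X)"
    and counit_add: "counit L (X + Y) = counit L X + counit L Y"
    and counit_bimodule: "counit L (src L b * tgt L c * X) = b * counit L X * c"
    and coprod_coassoc:
      "induced (diamond3_relators L (regular L)) (coprod_left L) (coprod L X) =
       induced (diamond3_relators L (regular L)) (coact_right (regular L)) (coprod L X)"
    and counital_left:
      "eval_sum (lscale L) (\<lambda>(Y, Z). src L (counit L Y) * Z) (rep (coprod L X)) = X"
    and counital_right:
      "eval_sum (lscale L) (\<lambda>(Y, Z). tgt L (counit L Z) * Y) (rep (coprod L X)) = X"
    and coprod_one: "coprod L 1 = cls (diamond_relators L (regular L)) (frag_of (1, 1))"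
    and coprod_mult: "coprod L (X * Y) =
      cls (diamond_relators L (regular L)) (formal_mult (rep (coprod L X)) (rep (coprod L Y)))"
    and counit_one: "counit L 1 = 1"
    and counit_mult_src: "counit L (X * src L (counit L Y)) = counit L (X * Y)"
    and counit_mult_tgt: "counit L (X * tgt L (counit L Y)) = counit L (X * Y)"

text \<open>The four structures are, in this order: left \<open>B\<close>, right \<open>B\<close>, left \<open>B\<close>-bar, right \<open>B\<close>-bar. A right
  module is regarded as a left module over the opposite ring.\<close>

definition faithfully_flat_bialgebroid ::
  "('k, 'b::{ring,monoid_mult}, 'l::{ring,monoid_mult}) bialgebroid \<Rightarrow> bool" where
  "faithfully_flat_bialgebroid L \<longleftrightarrow>
     faithfully_flat (\<lambda>b c. b * c) (\<lambda>b X. src L b * X) \<and>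
     faithfully_flat (\<lambda>b c. c * b) (\<lambda>b X. X * src L b) \<and>
     faithfully_flat (\<lambda>b c. c * b) (\<lambda>b X. tgt L b * X) \<and>
     faithfully_flat (\<lambda>b c. b * c) (\<lambda>b X. X * tgt L b)"


section \<open>Skew regularity and the anti-left Hopf condition\<close>

text \<open>The map \<open>X \<otimes> p \<mapsto> p\<^sub>(\<^sub>-\<^sub>1\<^sub>) X \<otimes> p\<^sub>(\<^sub>0\<^sub>)\<close>. For \<open>G = regular L\<close> it is \<open>X \<otimes> Y \<mapsto> Y\<^sub>(\<^sub>1\<^sub>) X \<otimes> Y\<^sub>(\<^sub>2\<^sub>)\<close>.\<close>

definition canonical_map ::
  "('k, 'b, 'l::{ring,monoid_mult}) bialgebroid \<Rightarrow> ('k, 'b, 'p::ab_group_add, 'l) comod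
   \<Rightarrow> ('l \<times> 'p \<Rightarrow>\<^sub>0 int) set \<Rightarrow> ('l \<times> 'p \<Rightarrow>\<^sub>0 int) set" where
  "canonical_map L G = induced (diamond_relators L G)
     (frag_extend (\<lambda>(X, p). fmap (\<lambda>(Y, q). (Y * X, q)) (rep (coact G p))))"

definition skew_regular ::
  "('k, 'b, 'l::{ring,monoid_mult}) bialgebroid \<Rightarrow> ('k, 'b, 'p::ab_group_add, 'l) comod \<Rightarrow> bool" where
  "skew_regular L G \<longleftrightarrow>
     bij_betw (canonical_map L G) (quot (uptensor_relators L G)) (quot (diamond_relators L G))"

definition anti_left_hopf ::
  "('k, 'b, 'l::{ring,monoid_mult}) bialgebroid \<Rightarrow> bool" where
  "anti_left_hopf L \<longleftrightarrow>
     bij_betw (canonical_map L (regular L))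
       (quot (uptensor_relators L (regular L))) (quot (diamond_relators L (regular L)))"

text \<open>\<open>p\<^sub>[\<^sub>1\<^sub>] \<otimes> p\<^sub>[\<^sub>0\<^sub>]\<close>, the preimage of \<open>1 \<otimes> p\<close>. For \<open>G = regular L\<close> it is \<open>X\<^sub>[\<^sub>-\<^sub>] \<otimes> X\<^sub>[\<^sub>+\<^sub>]\<close>.\<close>

definition translation ::
  "('k, 'b, 'l::{ring,monoid_mult}) bialgebroid \<Rightarrow> ('k, 'b, 'p::ab_group_add, 'l) comod
   \<Rightarrow> 'p \<Rightarrow> ('l \<times> 'p \<Rightarrow>\<^sub>0 int) set" where
  "translation L G p =
     inv_into (quot (uptensor_relators L G)) (canonical_map L G)
       (cls (diamond_relators L G) (frag_of (1, p)))"

text \<open>\<open>L \<otimes> L \<otimes> G\<close> modulo \<open>b X \<otimes> Y \<otimes> q = X \<otimes> Y b \<otimes> q\<close> and \<open>X \<otimes> c\<close>-bar \<open>Y \<otimes> q = X \<otimes> Y \<otimes> c q\<close>.\<close>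

definition mixed_relators ::
  "('k, 'b, 'l::{ring,monoid_mult}) bialgebroid \<Rightarrow> ('k, 'b, 'p::ab_group_add, 'l) comod
   \<Rightarrow> ('l \<times> 'l \<times> 'p \<Rightarrow>\<^sub>0 int) set" where
  "mixed_relators L G =
     triple_relators (uptensor_relators L (regular L)) (diamond_relators L G)"

definition mixed_takeuchi ::
  "('k, 'b, 'l::{ring,monoid_mult}) bialgebroid \<Rightarrow> ('k, 'b, 'p::ab_group_add, 'l) comod
   \<Rightarrow> ('l \<times> 'l \<times> 'p \<Rightarrow>\<^sub>0 int) set set" where
  "mixed_takeuchi L G = {v \<in> quot (mixed_relators L G).
     (\<forall>a. induced (mixed_relators L G) (fmap (\<lambda>(X, Y, q). (X * src L a, Y, q))) v =
          induced (mixed_relators L G) (fmap (\<lambda>(X, Y, q). (X, src L a * Y, q))) v) \<and>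
     (\<forall>d. induced (mixed_relators L G) (fmap (\<lambda>(X, Y, q). (X, Y * tgt L d, q))) v =
          induced (mixed_relators L G) (fmap (\<lambda>(X, Y, q). (X, Y, ract G q d))) v)}"

text \<open>\<open>p\<^sub>[\<^sub>1\<^sub>] \<otimes> p\<^sub>[\<^sub>0\<^sub>]\<^sub>(\<^sub>-\<^sub>1\<^sub>) \<otimes> p\<^sub>[\<^sub>0\<^sub>]\<^sub>(\<^sub>0\<^sub>)\<close>\<close>

definition translation_coact ::
  "('k, 'b, 'l::{ring,monoid_mult}) bialgebroid \<Rightarrow> ('k, 'b, 'p::ab_group_add, 'l) comod
   \<Rightarrow> 'p \<Rightarrow> ('l \<times> 'l \<times> 'p \<Rightarrow>\<^sub>0 int) set" where
  "translation_coact L G p = induced (mixed_relators L G) (coact_right G) (translation L G p)"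

text \<open>\<open>p\<^sub>(\<^sub>-\<^sub>1\<^sub>)\<^sub>[\<^sub>-\<^sub>] \<otimes> p\<^sub>(\<^sub>-\<^sub>1\<^sub>)\<^sub>[\<^sub>+\<^sub>] \<otimes> p\<^sub>(\<^sub>0\<^sub>)\<close>\<close>

definition coact_translation ::
  "('k, 'b, 'l::{ring,monoid_mult}) bialgebroid \<Rightarrow> ('k, 'b, 'p::ab_group_add, 'l) comod
   \<Rightarrow> 'p \<Rightarrow> ('l \<times> 'l \<times> 'p \<Rightarrow>\<^sub>0 int) set" where
  "coact_translation L G p = induced (mixed_relators L G)
     (frag_extend (\<lambda>(Y, q). fmap (\<lambda>(X, Z). (X, Z, q)) (rep (translation L (regular L) Y))))
     (coact G p)"

text \<open>
  The passage from \<open>X \<otimes> Y \<otimes> q\<close> to \<open>X \<otimes>\<^sup>B \<epsilon>(Y) q\<close>. The map \<open>Y \<otimes> q \<mapsto> \<epsilon>(Y) q\<close> is right \<open>B\<close>-linear on the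
  Takeuchi product \<open>L \<times>\<^sub>B G\<close> but not on all of \<open>L \<diamondop>\<^sub>B G\<close>, so the passage is only defined on elements coming
  from \<open>L \<otimes>\<^sup>B (L \<times>\<^sub>B G)\<close>, which embeds into the mixed tensor product by flatness. Hence \<open>v\<close> has to be
  written as a formal sum \<open>z\<close> of terms \<open>X \<otimes> \<xi>\<close> where \<open>\<xi>\<close> represents an element of \<open>L \<times>\<^sub>B G\<close>. The union is
  over all such \<open>z\<close>: it is a single class if and only if \<open>z\<close> exists and the result does not depend on it.
\<close>

definition counit_collapse ::
  "('k, 'b, 'l::{ring,monoid_mult}) bialgebroid \<Rightarrow> ('k, 'b, 'p::ab_group_add, 'l) comod
   \<Rightarrow> ('l \<times> 'l \<times> 'p \<Rightarrow>\<^sub>0 int) set \<Rightarrow> ('l \<times> 'p \<Rightarrow>\<^sub>0 int) set" where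
  "counit_collapse L G v =
     \<Union>{cls (uptensor_relators L G)
          (frag_extend (\<lambda>(X, \<xi>). fmap (\<lambda>(Y, q). (X, lact G (counit L Y) q)) \<xi>) z)
       | z :: 'l \<times> ('l \<times> 'p \<Rightarrow>\<^sub>0 int) \<Rightarrow>\<^sub>0 int.
          (\<forall>(X, \<xi>)\<in>Poly_Mapping.keys z. cls (diamond_relators L G) \<xi> \<in> takeuchi L G) \<and>
          cls (mixed_relators L G)
            (frag_extend (\<lambda>(X, \<xi>). fmap (\<lambda>(Y, q). (X, Y, q)) \<xi>) z) = v}"

end

theory Submission
  imports Defs "HOL-Library.Function_Algebras"
begin

text \<open>
  Write \<open>\<delta>\<close> for the coaction of \<open>G\<close>, \<open>\<phi>\<close> for its canonical map \<open>L \<otimes>\<^sup>B G \<rightarrow> L \<diamondop>\<^sub>B G\<close> and \<open>\<mu>\<close> for the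
  canonical map of \<open>L\<close> itself. Every comodule is cut out of a cofree one: the counit shows that
  \<open>G \<rightarrow> L \<diamondop>\<^sub>B G \<rightarrow> L \<diamondop>\<^sub>B L \<diamondop>\<^sub>B G\<close>, with the maps \<open>\<delta>\<close> and \<open>\<Delta> \<diamondop> 1 - 1 \<diamondop> \<delta>\<close>, is an exact sequence of right
  \<open>B\<close>-modules whose first map is injective (\<open>cotensor_regular\<close>, \<open>eps_delta\<close>). On the two cofree terms
  the analogue of \<open>\<phi>\<close> is \<open>\<mu>\<close> on the first two tensor factors, which is bijective because \<open>\<mu>\<close> is;
  its inverse is \<open>X \<diamondop> Y \<diamondop> r \<mapsto> Y\<^sub>[\<^sub>-\<^sub>] X \<otimes> Y\<^sub>[\<^sub>+\<^sub>] \<diamondop> r\<close> (\<open>twist_Delta_minus_plus\<close>,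
  \<open>twist_minus_plus_Delta\<close>). Coassociativity makes these maps commute with those of the sequence
  (\<open>twist_coact_right\<close>, \<open>twist_lift_coprod_left\<close>, \<open>twist_lift_coact_right\<close>). Since \<open>L\<close> is flat over \<open>B\<close>
  through \<open>src\<close>, the functor \<open>L \<otimes>\<^sup>B -\<close> preserves exactness of the sequence, and the statement becomes a
  diagram chase.

  In detail, \<open>\<phi> w = 0\<close> forces \<open>(1 \<otimes> \<delta>) w = 0\<close>, hence \<open>w = 0\<close> (\<open>canon_injective\<close>). Conversely, the
  element \<open>T = p\<^sub>(\<^sub>-\<^sub>1\<^sub>)\<^sub>[\<^sub>-\<^sub>] \<otimes> p\<^sub>(\<^sub>-\<^sub>1\<^sub>)\<^sub>[\<^sub>+\<^sub>] \<otimes> p\<^sub>(\<^sub>0\<^sub>)\<close> corresponds to \<open>1 \<diamondop> \<delta> p\<close> under \<open>\<mu>\<close>, so it is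
  annihilated by the second map of the tensored sequence and has the form \<open>(1 \<otimes> \<delta>) \<tau>\<close> for some \<open>\<tau>\<close>
  (\<open>attach_minus_plus_in_image\<close>). Comparing with \<open>1 \<diamondop> p\<close> after applying \<open>1 \<diamondop> \<delta>\<close>, which is split by
  the counit, gives \<open>\<phi> \<tau> = 1 \<diamondop> p\<close> (\<open>canon_preimage\<close>). This yields surjectivity, identifies \<open>\<tau>\<close> with
  \<open>p\<^sub>[\<^sub>1\<^sub>] \<otimes> p\<^sub>[\<^sub>0\<^sub>]\<close>, and is the second formula. The first formula follows by applying \<open>1 \<otimes> \<epsilon>\<close> to
  \<open>T = (1 \<otimes> \<delta>) \<tau>\<close>; this is legitimate because, again by flatness, the lift of \<open>T\<close> to
  \<open>L \<otimes>\<^sup>B (L \<times>\<^sub>B G)\<close> is unique (\<open>counit_collapse_eq\<close>).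

  All quotients are handled through congruence of formal sums, so that a map between tensor products
  is an additive map of formal sums that sends relators to the span of relators. The input from
  flatness is \<open>flat_kernel\<close>: it deduces exactness for arbitrary right modules from exactness for the
  test modules in the definition of faithful flatness.
\<close>

section \<open>Congruence of formal sums\<close>

definition cong_span :: "'a::ab_group_add \<Rightarrow> 'a set \<Rightarrow> 'a \<Rightarrow> bool" ("(_ \<approx>\<^bsub>_\<^esub> _)" [51, 0, 51] 50) where
  "x \<approx>\<^bsub>R\<^esub> y \<longleftrightarrow> x - y \<in> add_span R"

lemma add_span_uminus: "x \<in> add_span R \<Longrightarrow> - x \<in> add_span R"
  using add_span.diff[OF add_span.zero] by fastforce

lemma add_span_add: "x \<in> add_span R \<Longrightarrow> y \<in> add_span R \<Longrightarrow> x + y \<in> add_span R"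
  using add_span.diff[OF _ add_span_uminus] by fastforce

lemma add_span_sum: "(\<And>i. i \<in> I \<Longrightarrow> f i \<in> add_span R) \<Longrightarrow> sum f I \<in> add_span R"
  by (induction I rule: infinite_finite_induct) (auto intro: add_span.zero add_span_add)

lemma cong_refl [simp]: "x \<approx>\<^bsub>R\<^esub> x"
  by (simp add: cong_span_def add_span.zero)

lemma cong_sym: "x \<approx>\<^bsub>R\<^esub> y \<Longrightarrow> y \<approx>\<^bsub>R\<^esub> x"
  unfolding cong_span_def using add_span_uminus by fastforce

lemma cong_trans [trans]: "x \<approx>\<^bsub>R\<^esub> y \<Longrightarrow> y \<approx>\<^bsub>R\<^esub> z \<Longrightarrow> x \<approx>\<^bsub>R\<^esub> z"
  unfolding cong_span_def using add_span_add by fastforce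

lemma cong_diff: "x \<approx>\<^bsub>R\<^esub> y \<Longrightarrow> x' \<approx>\<^bsub>R\<^esub> y' \<Longrightarrow> x - x' \<approx>\<^bsub>R\<^esub> y - y'"
  unfolding cong_span_def using add_span.diff[of "x - y" R "x' - y'"]
  by (simp add: algebra_simps)

lemma cong_add: "x \<approx>\<^bsub>R\<^esub> y \<Longrightarrow> x' \<approx>\<^bsub>R\<^esub> y' \<Longrightarrow> x + x' \<approx>\<^bsub>R\<^esub> y + y'"
  unfolding cong_span_def using add_span_add[of "x - y" R "x' - y'"]
  by (simp add: algebra_simps)

lemma cong_sum: "(\<And>i. i \<in> I \<Longrightarrow> f i \<approx>\<^bsub>R\<^esub> g i) \<Longrightarrow> sum f I \<approx>\<^bsub>R\<^esub> sum g I"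
  unfolding cong_span_def sum_subtractf[symmetric] by (rule add_span_sum)

lemma cong_zero_iff: "x \<approx>\<^bsub>R\<^esub> 0 \<longleftrightarrow> x \<in> add_span R"
  by (simp add: cong_span_def)

lemma span_cong: "x \<approx>\<^bsub>R\<^esub> y \<Longrightarrow> x \<in> add_span R \<longleftrightarrow> y \<in> add_span R"
  by (metis cong_sym cong_trans cong_zero_iff)

lemma cls_eq_iff: "cls R x = cls R y \<longleftrightarrow> x \<approx>\<^bsub>R\<^esub> y"
proof
  assume "cls R x = cls R y"
  moreover have "x \<in> cls R x"
    by (simp add: cls_def add_span.zero)
  ultimately show "x \<approx>\<^bsub>R\<^esub> y"
    by (auto simp: cls_def cong_span_def)
next
  assume "x \<approx>\<^bsub>R\<^esub> y"
  then show "cls R x = cls R y"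
    unfolding cls_def using cong_trans cong_sym unfolding cong_span_def by blast
qed

lemma rep_cls: "rep (cls R x) \<approx>\<^bsub>R\<^esub> x"
proof -
  have "x \<in> cls R x"
    by (simp add: cls_def add_span.zero)
  then have "rep (cls R x) \<in> cls R x"
    unfolding rep_def by (rule someI)
  then show ?thesis
    by (simp add: cls_def cong_span_def)
qed

lemma cls_rep: "c \<in> quot R \<Longrightarrow> cls R (rep c) = c"
  unfolding quot_def using rep_cls cls_eq_iff by blast

text \<open>Such a map descends to the quotients by \<open>R\<close> and \<open>R'\<close> and stands for the induced homomorphism.\<close>

definition tensor_hom :: "'a::ab_group_add set \<Rightarrow> 'c::ab_group_add set \<Rightarrow> ('a \<Rightarrow> 'c) \<Rightarrow> bool" where
  "tensor_hom R R' f \<longleftrightarrow> (\<forall>x y. f (x - y) = f x - f y) \<and> (\<forall>r\<in>R. f r \<in> add_span R')"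

lemma tensor_hom_span:
  assumes "tensor_hom R R' f" and "x \<in> add_span R"
  shows "f x \<in> add_span R'"
  using assms(2)
proof induction
  case zero
  have "f 0 = 0"
    using assms(1) unfolding tensor_hom_def by (metis diff_self)
  then show ?case
    by (simp add: add_span.zero)
qed (use assms(1) in \<open>auto simp: tensor_hom_def intro: add_span.diff\<close>)

lemma tensor_hom_cong: "tensor_hom R R' f \<Longrightarrow> x \<approx>\<^bsub>R\<^esub> y \<Longrightarrow> f x \<approx>\<^bsub>R'\<^esub> f y"
  unfolding cong_span_def using tensor_hom_span[of R R' f "x - y"] by (simp add: tensor_hom_def)

lemma tensor_hom_induced: "tensor_hom R R' f \<Longrightarrow> induced R' f (cls R x) = cls R' (f x)"
proof -
  assume f: "tensor_hom R R' f"
  have "cls R' (f y) = cls R' (f x)" if "y \<in> cls R x" for y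
    using that tensor_hom_cong[OF f] by (simp add: cls_eq_iff) (simp add: cls_def cong_span_def)
  moreover have "x \<in> cls R x"
    by (simp add: cls_def add_span.zero)
  ultimately show ?thesis
    unfolding induced_def by blast
qed

lemma tensor_hom_comp: "tensor_hom R R' f \<Longrightarrow> tensor_hom R' R'' g \<Longrightarrow> tensor_hom R R'' (\<lambda>x. g (f x))"
  using tensor_hom_span[of R' R'' g] by (auto simp: tensor_hom_def)

lemma tensor_hom_frag_extend:
  "(\<And>r. r \<in> R \<Longrightarrow> frag_extend h r \<in> add_span R') \<Longrightarrow> tensor_hom R R' (frag_extend h)"
  by (simp add: tensor_hom_def frag_extend_diff)

lemma frag_extend_cong:
  assumes "\<And>a. a \<in> Poly_Mapping.keys x \<Longrightarrow> f a \<approx>\<^bsub>R\<^esub> g a"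
  shows "frag_extend f x \<approx>\<^bsub>R\<^esub> frag_extend g x"
proof -
  have "frag_extend f y \<approx>\<^bsub>R\<^esub> frag_extend g y"
    if "Poly_Mapping.keys y \<subseteq> Poly_Mapping.keys x" for y
    using that by (rule frag_induction) (auto simp: assms frag_extend_diff cong_diff)
  then show ?thesis
    by blast
qed

lemma frag_extend_frag_extend:
  "frag_extend g (frag_extend f x) = frag_extend (\<lambda>a. frag_extend g (f a)) x"
  by (rule frag_induction[of x UNIV]) (auto simp: frag_extend_diff)

lemma frag_extend_additive:
  "frag_extend (\<lambda>a. f a - g a) x = frag_extend f x - frag_extend g x"
  by (rule frag_induction[of x UNIV]) (auto simp: frag_extend_diff)

lemma frag_extend_plus: "frag_extend (\<lambda>a. f a + g a) x = frag_extend f x + frag_extend g x"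
  by (rule frag_induction[of x UNIV]) (auto simp: frag_extend_diff)

lemma frag_extend_swap:
  "frag_extend (\<lambda>a. frag_extend (f a) y) x = frag_extend (\<lambda>b. frag_extend (\<lambda>a. f a b) x) y"
  by (rule frag_induction[of x UNIV]) (auto simp: frag_extend_diff frag_extend_additive frag_extend_eq_0)

lemma frag_extend_mem_span: "(\<And>a. f a \<in> add_span R) \<Longrightarrow> frag_extend f x \<in> add_span R"
  using frag_extend_cong[of x f R "\<lambda>_. 0"] by (simp add: cong_zero_iff frag_extend_eq_0)

lemma fmap_diff: "fmap f (x - y) = fmap f x - fmap f y"
  and fmap_add: "fmap f (x + y) = fmap f x + fmap f y"
  and fmap_zero [simp]: "fmap f 0 = 0"
  and fmap_frag_of [simp]: "fmap f (frag_of a) = frag_of (f a)"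
  by (simp_all add: fmap_def frag_extend_diff frag_extend_add)

lemma frag_extend_ident: "frag_extend frag_of x = x"
  by (metis frag_expansion)

lemma tensor_hom_id: "tensor_hom R R (\<lambda>x. x)"
  by (simp add: tensor_hom_def add_span.gen)

lemma fmap_id: "fmap id = (\<lambda>x. x)"
  by (simp add: fmap_def fun_eq_iff frag_extend_ident)

lemmas frag_simps = frag_extend_diff frag_extend_add frag_extend_frag_extend fmap_def
  case_prod_unfold frag_extend_ident

section \<open>Flatness of modules given by generators and relations\<close>

text \<open>The relations of \<open>M \<otimes> N\<close> over \<^typ>\<open>'b\<close>, where the right module \<open>N\<close> is only presented: its elements
  are those of \<open>A\<close>, and two of them are equal when they are congruent modulo \<open>R\<close>. Working with such
  presentations avoids choosing representatives in modules that are themselves tensor products.\<close>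

definition balanced_relators ::
  "('b \<Rightarrow> 'm \<Rightarrow> 'm) \<Rightarrow> 'n set \<Rightarrow> 'n set \<Rightarrow> ('n \<Rightarrow> 'b \<Rightarrow> 'n)
   \<Rightarrow> ('m::ab_group_add \<times> 'n::ab_group_add \<Rightarrow>\<^sub>0 int) set" where
  "balanced_relators lac A R rac =
     {frag_of (m + m', n) - frag_of (m, n) - frag_of (m', n) | m m' n. n \<in> A}
   \<union> {frag_of (m, n + n') - frag_of (m, n) - frag_of (m, n') | m n n'. n \<in> A \<and> n' \<in> A}
   \<union> {frag_of (lac b m, n) - frag_of (m, rac n b) | b m n. n \<in> A}
   \<union> {frag_of (m, n) | m n. n \<in> A \<and> n \<in> add_span R}"

text \<open>The axioms of a right module modulo \<open>R\<close>. The ambient set \<open>A\<close> matters for submodules: for the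
  same \<open>R\<close> and a smaller \<open>A\<close>, \<open>balanced_relators\<close> describes the tensor product with a submodule, whose
  map to the tensor product with the whole module is injective by flatness.\<close>

locale presented_module =
  fixes A R :: "'n::ab_group_add set" and rac :: "'n \<Rightarrow> 'b::{ring,monoid_mult} \<Rightarrow> 'n"
  assumes zero_mem: "0 \<in> A"
    and diff_mem: "n \<in> A \<Longrightarrow> n' \<in> A \<Longrightarrow> n - n' \<in> A"
    and rac_mem: "n \<in> A \<Longrightarrow> rac n b \<in> A"
    and rac_span: "n \<in> A \<Longrightarrow> n \<in> add_span R \<Longrightarrow> rac n b \<in> add_span R"
    and rac_add_left: "n \<in> A \<Longrightarrow> n' \<in> A \<Longrightarrow> rac (n + n') b \<approx>\<^bsub>R\<^esub> rac n b + rac n' b"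
    and rac_add_right: "n \<in> A \<Longrightarrow> rac n (b + b') \<approx>\<^bsub>R\<^esub> rac n b + rac n b'"
    and rac_mult: "n \<in> A \<Longrightarrow> rac n (b * b') \<approx>\<^bsub>R\<^esub> rac (rac n b) b'"
    and rac_one: "n \<in> A \<Longrightarrow> rac n 1 \<approx>\<^bsub>R\<^esub> n"
begin

lemma add_mem: "n \<in> A \<Longrightarrow> n' \<in> A \<Longrightarrow> n + n' \<in> A"
  using diff_mem[OF _ diff_mem[OF zero_mem]] by fastforce

lemma sum_mem: "(\<And>i. i \<in> I \<Longrightarrow> f i \<in> A) \<Longrightarrow> sum f I \<in> A"
  by (induction I rule: infinite_finite_induct) (auto intro: zero_mem add_mem)

lemma rac_cong:
  assumes "n \<in> A" "n' \<in> A" "n \<approx>\<^bsub>R\<^esub> n'"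
  shows "rac n b \<approx>\<^bsub>R\<^esub> rac n' b"
proof -
  have "rac (n - n' + n') b \<approx>\<^bsub>R\<^esub> rac (n - n') b + rac n' b"
    using assms diff_mem by (intro rac_add_left) auto
  also have "\<dots> \<approx>\<^bsub>R\<^esub> 0 + rac n' b"
    using assms rac_span[OF diff_mem] by (intro cong_add) (auto simp: cong_zero_iff cong_span_def)
  finally show ?thesis
    by simp
qed

lemma rac_zero_left: "rac 0 b \<in> add_span R"
  using zero_mem rac_span add_span.zero by blast

lemma rac_zero_right: "n \<in> A \<Longrightarrow> rac n 0 \<in> add_span R"
  using rac_add_right[of n 0 0] cong_zero_iff by (simp add: cong_span_def) (metis add_span_uminus minus_minus)

lemma rac_sum_left:
  assumes "\<And>i. i \<in> I \<Longrightarrow> f i \<in> A"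
  shows "rac (sum f I) b \<approx>\<^bsub>R\<^esub> (\<Sum>i\<in>I. rac (f i) b)"
  using assms
proof (induction I rule: infinite_finite_induct)
  case (insert x I)
  have "rac (f x + sum f I) b \<approx>\<^bsub>R\<^esub> rac (f x) b + rac (sum f I) b"
    using insert.prems by (intro rac_add_left sum_mem) auto
  also have "\<dots> \<approx>\<^bsub>R\<^esub> rac (f x) b + (\<Sum>i\<in>I. rac (f i) b)"
    using insert by (intro cong_add) auto
  finally show ?case
    using insert by simp
qed (auto simp: cong_zero_iff rac_zero_left)

definition lin_comb :: "(nat \<Rightarrow> 'n) \<Rightarrow> nat \<Rightarrow> (nat \<Rightarrow> 'b) \<Rightarrow> 'n" where
  "lin_comb s k c = (\<Sum>i<k. rac (s i) (c i))"

context
  fixes s :: "nat \<Rightarrow> 'n" and k :: nat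
  assumes s: "\<And>i. i < k \<Longrightarrow> s i \<in> A"
begin

lemma lin_comb_mem: "lin_comb s k c \<in> A"
  unfolding lin_comb_def using s by (intro sum_mem rac_mem) auto

lemma lin_comb_add: "lin_comb s k (c + c') \<approx>\<^bsub>R\<^esub> lin_comb s k c + lin_comb s k c'"
  unfolding lin_comb_def sum.distrib[symmetric] plus_fun_def using s by (intro cong_sum rac_add_right) auto

lemma lin_comb_smult: "lin_comb s k (\<lambda>i. c i * b) \<approx>\<^bsub>R\<^esub> rac (lin_comb s k c) b"
proof -
  have "lin_comb s k (\<lambda>i. c i * b) \<approx>\<^bsub>R\<^esub> (\<Sum>i<k. rac (rac (s i) (c i)) b)"
    unfolding lin_comb_def using s by (intro cong_sum rac_mult) auto
  also have "\<dots> \<approx>\<^bsub>R\<^esub> rac (lin_comb s k c) b"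
    unfolding lin_comb_def using s by (intro cong_sym[OF rac_sum_left] rac_mem) auto
  finally show ?thesis .
qed

lemma lin_comb_zero: "lin_comb s k 0 \<in> add_span R"
  unfolding lin_comb_def using s by (intro add_span_sum) (auto intro: rac_zero_right)

lemma lin_comb_diff: "lin_comb s k (c - c') \<approx>\<^bsub>R\<^esub> lin_comb s k c - lin_comb s k c'"
proof -
  have "lin_comb s k (c - c' + c') - lin_comb s k c' \<approx>\<^bsub>R\<^esub> lin_comb s k (c - c') + lin_comb s k c' - lin_comb s k c'"
    by (intro cong_diff lin_comb_add cong_refl)
  then show ?thesis
    by (simp add: cong_sym)
qed

lemma lin_comb_unit:
  assumes "j < k"
  shows "lin_comb s k (\<lambda>i. if i = j then 1 else 0) \<approx>\<^bsub>R\<^esub> s j"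
proof -
  have "lin_comb s k (\<lambda>i. if i = j then 1 else 0) \<approx>\<^bsub>R\<^esub> (\<Sum>i<k. if i = j then s j else 0)"
    unfolding lin_comb_def using s by (intro cong_sum) (auto simp: cong_zero_iff rac_zero_right rac_one)
  then show ?thesis
    using assms by simp
qed

end
end

definition coset_of :: "(nat \<Rightarrow> 'b::ring) set \<Rightarrow> (nat \<Rightarrow> 'b) \<Rightarrow> (nat \<Rightarrow> 'b) set" where
  "coset_of K c = {c'. c' - c \<in> K}"

text \<open>The module \<open>V/K\<close> of sequences. These are the test modules to which flatness is applied: a module with
  generators \<open>s\<^sub>0, \<dots>, s\<^sub>k\<^sub>-\<^sub>1\<close> is the quotient of the sequences by the relations between the \<open>s\<^sub>i\<close>. The
  ring structure in the record type is filled with arbitrary values.\<close>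

definition subquotient ::
  "(nat \<Rightarrow> 'b::ring) set \<Rightarrow> (nat \<Rightarrow> 'b) set \<Rightarrow> ('b, (nat \<Rightarrow> 'b) set) module" where
  "subquotient V K = \<lparr>carrier = coset_of K ` V, mult = \<lambda>X Y. X, one = K, zero = coset_of K 0,
     add = \<lambda>X Y. \<Union>x\<in>X. \<Union>y\<in>Y. coset_of K (x + y),
     smult = \<lambda>b X. \<Union>x\<in>X. coset_of K (\<lambda>i. x i * b)\<rparr>"

definition submod :: "(nat \<Rightarrow> 'b::ring) set \<Rightarrow> bool" where
  "submod K \<longleftrightarrow> 0 \<in> K \<and> (\<forall>x\<in>K. \<forall>y\<in>K. x - y \<in> K) \<and> (\<forall>x\<in>K. \<forall>b. (\<lambda>i. x i * b) \<in> K)"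

lemma submod_uminus: "submod K \<Longrightarrow> x \<in> K \<Longrightarrow> - x \<in> K"
  unfolding submod_def by (metis diff_0)

lemma submod_add: "submod K \<Longrightarrow> x \<in> K \<Longrightarrow> y \<in> K \<Longrightarrow> x + y \<in> K"
  using submod_uminus[of K y] unfolding submod_def by (metis diff_minus_eq_add)

lemma submod_Int: "submod V \<Longrightarrow> submod K \<Longrightarrow> submod (V \<inter> K)"
  unfolding submod_def by auto

lemma submod_zero: "submod {0}"
  unfolding submod_def by (auto simp: fun_eq_iff)

lemma submod_UNIV: "submod UNIV"
  unfolding submod_def by auto

lemma coset_of_eq_iff:
  assumes "submod K"
  shows "coset_of K c = coset_of K c' \<longleftrightarrow> c - c' \<in> K"
proof
  assume "coset_of K c = coset_of K c'"
  moreover have "c \<in> coset_of K c"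
    using assms by (simp add: coset_of_def submod_def)
  ultimately show "c - c' \<in> K"
    by (auto simp: coset_of_def)
next
  assume *: "c - c' \<in> K"
  have "x - c \<in> K \<longleftrightarrow> x - c' \<in> K" for x
  proof -
    have "x - c' = (x - c) + (c - c')" "x - c = (x - c') - (c - c')"
      by simp_all
    then show ?thesis
      using submod_add[OF assms _ *] assms * unfolding submod_def by metis
  qed
  then show "coset_of K c = coset_of K c'"
    by (auto simp: coset_of_def)
qed

lemma coset_of_self: "submod K \<Longrightarrow> c \<in> coset_of K c"
  by (simp add: coset_of_def submod_def)

lemma subquotient_add:
  assumes "submod K"
  shows "coset_of K c \<oplus>\<^bsub>subquotient V K\<^esub> coset_of K c' = coset_of K (c + c')"
proof -
  have "coset_of K (x + y) = coset_of K (c + c')" if "x \<in> coset_of K c" "y \<in> coset_of K c'" for x y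
  proof -
    have "(x + y) - (c + c') = (x - c) + (y - c')"
      by simp
    then show ?thesis
      using submod_add[OF assms, of "x - c" "y - c'"] that
      unfolding coset_of_eq_iff[OF assms] by (simp only: coset_of_def mem_Collect_eq)
  qed
  then have "(\<Union>x\<in>coset_of K c. \<Union>y\<in>coset_of K c'. coset_of K (x + y)) = coset_of K (c + c')"
    using coset_of_self[OF assms] by blast
  then show ?thesis
    by (simp add: subquotient_def)
qed

lemma subquotient_smult:
  assumes "submod K"
  shows "b \<odot>\<^bsub>subquotient V K\<^esub> coset_of K c = coset_of K (\<lambda>i. c i * b)"
proof -
  have "coset_of K (\<lambda>i. x i * b) = coset_of K (\<lambda>i. c i * b)" if "x \<in> coset_of K c" for x
  proof -
    have "(\<lambda>i. (x - c) i * b) \<in> K"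
      using that assms unfolding submod_def coset_of_def by blast
    also have "(\<lambda>i. (x - c) i * b) = (\<lambda>i. x i * b) - (\<lambda>i. c i * b)"
      by (auto simp: fun_eq_iff algebra_simps)
    finally show ?thesis
      unfolding coset_of_eq_iff[OF assms] .
  qed
  then have "(\<Union>x\<in>coset_of K c. coset_of K (\<lambda>i. x i * b)) = coset_of K (\<lambda>i. c i * b)"
    using coset_of_self[OF assms] by blast
  then show ?thesis
    by (simp add: subquotient_def)
qed

lemma subquotient_carrier: "carrier (subquotient V K) = coset_of K ` V"
  by (simp add: subquotient_def)

lemma subquotient_zero: "\<zero>\<^bsub>subquotient V K\<^esub> = coset_of K 0"
  by (simp add: subquotient_def)

lemma subquotient_right_module:
  assumes V: "submod V" and K: "submod K"
  shows "right_module (\<lambda>b c. b * c) (subquotient V K :: ('b::{ring,monoid_mult}, _) module)"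
proof -
  note [simp] = subquotient_add[OF K] subquotient_smult[OF K] subquotient_carrier subquotient_zero
  have smultV: "(\<lambda>i. c i * b) \<in> V" if "c \<in> V" for c b
    using that V unfolding submod_def by blast
  have "abelian_group (subquotient V K)"
  proof (rule abelian_groupI)
    fix X assume "X \<in> carrier (subquotient V K)"
    then obtain c where "c \<in> V" "X = coset_of K c"
      by auto
    then show "\<exists>Y\<in>carrier (subquotient V K). Y \<oplus>\<^bsub>subquotient V K\<^esub> X = \<zero>\<^bsub>subquotient V K\<^esub>"
      using submod_uminus[OF V] by (intro bexI[of _ "coset_of K (- c)"]) auto
  qed (use V in \<open>auto simp: submod_add algebra_simps submod_def\<close>)
  then show ?thesis
    by (intro right_module.intro right_module_axioms.intro)
      (auto simp: smultV fun_eq_iff algebra_simps plus_fun_def intro!: arg_cong[of _ _ "coset_of K"] imageI)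
qed

lemma balanced_add_left: "n \<in> A \<Longrightarrow> frag_of (m + m', n) \<approx>\<^bsub>balanced_relators lac A R rac\<^esub> frag_of (m, n) + frag_of (m', n)"
  unfolding cong_span_def balanced_relators_def by (rule add_span.gen) (auto simp: diff_diff_eq)

lemma balanced_add_right: "n \<in> A \<Longrightarrow> n' \<in> A \<Longrightarrow>
    frag_of (m, n + n') \<approx>\<^bsub>balanced_relators lac A R rac\<^esub> frag_of (m, n) + frag_of (m, n')"
  unfolding cong_span_def balanced_relators_def diff_diff_eq[symmetric] by (rule add_span.gen) blast

lemma balanced_act: "n \<in> A \<Longrightarrow> frag_of (lac b m, n) \<approx>\<^bsub>balanced_relators lac A R rac\<^esub> frag_of (m, rac n b)"
  unfolding cong_span_def balanced_relators_def by (rule add_span.gen) auto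

lemma balanced_null: "n \<in> A \<Longrightarrow> n \<in> add_span R \<Longrightarrow> frag_of (m, n) \<in> add_span (balanced_relators lac A R rac)"
  unfolding balanced_relators_def by (rule add_span.gen) auto

lemma (in presented_module) balanced_cong:
  assumes "n \<in> A" "n' \<in> A" "n \<approx>\<^bsub>R\<^esub> n'"
  shows "frag_of (m, n) \<approx>\<^bsub>balanced_relators lac A R rac\<^esub> frag_of (m, n')"
proof -
  have "frag_of (m, (n - n') + n') \<approx>\<^bsub>balanced_relators lac A R rac\<^esub> frag_of (m, n - n') + frag_of (m, n')"
    using assms diff_mem by (intro balanced_add_right) auto
  also have "\<dots> \<approx>\<^bsub>balanced_relators lac A R rac\<^esub> 0 + frag_of (m, n')"
    using assms diff_mem by (intro cong_add cong_refl) (auto simp: cong_zero_iff cong_span_def intro!: balanced_null)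
  finally show ?thesis
    by simp
qed

locale presented_module_total = presented_module UNIV R rac
  for R :: "'n::ab_group_add set" and rac :: "'n \<Rightarrow> 'b::{ring,monoid_mult} \<Rightarrow> 'n"
begin

text \<open>The coset that represents \<open>n\<close> when the submodule generated by \<open>s\<^sub>0, \<dots>, s\<^sub>k\<^sub>-\<^sub>1\<close> is written as a quotient
  of the module of sequences; \<open>relations s k\<close> is the submodule that is divided out.\<close>

definition fiber :: "(nat \<Rightarrow> 'n) \<Rightarrow> nat \<Rightarrow> 'n \<Rightarrow> (nat \<Rightarrow> 'b) set" where
  "fiber s k n = {c. lin_comb s k c \<approx>\<^bsub>R\<^esub> n}"

definition relations :: "(nat \<Rightarrow> 'n) \<Rightarrow> nat \<Rightarrow> (nat \<Rightarrow> 'b) set" where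
  "relations s k = {c. lin_comb s k c \<in> add_span R}"

lemma submod_relations: "submod (relations s k)"
  unfolding submod_def relations_def
proof (intro conjI ballI allI CollectI)
  show "lin_comb s k 0 \<in> add_span R"
    by (rule lin_comb_zero) simp
  fix x assume x: "x \<in> {c. lin_comb s k c \<in> add_span R}"
  { fix y assume "y \<in> {c. lin_comb s k c \<in> add_span R}"
    then have "lin_comb s k x - lin_comb s k y \<in> add_span R"
      using x by (simp add: add_span.diff)
    then show "lin_comb s k (x - y) \<in> add_span R"
      using span_cong[OF lin_comb_diff[of k s x y]] by simp }
  fix b
  have "rac (lin_comb s k x) b \<in> add_span R"
    using x by (intro rac_span) auto
  then show "lin_comb s k (\<lambda>i. x i * b) \<in> add_span R"
    using span_cong[OF lin_comb_smult[of k s x b]] by simp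
qed

lemma fiber_eq_coset:
  assumes "lin_comb s k c \<approx>\<^bsub>R\<^esub> n"
  shows "fiber s k n = coset_of (relations s k) c"
proof -
  have "lin_comb s k x \<approx>\<^bsub>R\<^esub> n \<longleftrightarrow> lin_comb s k (x - c) \<in> add_span R" for x
  proof -
    have "lin_comb s k x \<approx>\<^bsub>R\<^esub> n \<longleftrightarrow> lin_comb s k x \<approx>\<^bsub>R\<^esub> lin_comb s k c"
      using assms cong_trans cong_sym by metis
    also have "\<dots> \<longleftrightarrow> lin_comb s k (x - c) \<in> add_span R"
      using span_cong[OF lin_comb_diff[of k s x c]] unfolding cong_span_def by simp
    finally show ?thesis .
  qed
  then show ?thesis
    unfolding fiber_def coset_of_def relations_def by auto
qed

text \<open>A relation in a tensor product involves only finitely many elements of the right module, hence already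
  holds over every submodule that is generated by a finite family containing them.\<close>

lemma relation_finitely_generated:
  assumes "z \<in> add_span (balanced_relators lac UNIV R rac)"
  shows "\<exists>S. finite S \<and> (\<forall>s k. S \<subseteq> s ` {..<k} \<longrightarrow>
    fmap (\<lambda>(m, n). (fiber s k n, m)) z \<in>
      add_span (rtensor_relators (subquotient UNIV (relations s k)) lac))"
  using assms
proof induction
  case zero
  show ?case
    by (intro exI[of _ "{}"]) (auto simp: fmap_def add_span.zero)
next
  case (diff x y)
  then obtain S S' where S: "finite S" "\<forall>s k. S \<subseteq> s ` {..<k} \<longrightarrow>
    fmap (\<lambda>(m, n). (fiber s k n, m)) x \<in> add_span (rtensor_relators (subquotient UNIV (relations s k)) lac)"
    "finite S'" "\<forall>s k. S' \<subseteq> s ` {..<k} \<longrightarrow>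
    fmap (\<lambda>(m, n). (fiber s k n, m)) y \<in> add_span (rtensor_relators (subquotient UNIV (relations s k)) lac)"
    by blast
  then show ?case
    by (intro exI[of _ "S \<union> S'"]) (auto simp: fmap_def frag_extend_diff intro!: add_span.diff)
next
  case (gen x)
  have gen_mem: "\<exists>c. lin_comb s k c \<approx>\<^bsub>R\<^esub> n" if "n \<in> s ` {..<k}" for s :: "nat \<Rightarrow> 'n" and k n
    using that lin_comb_unit by blast
  \<comment> \<open>The elements of the module that occur in the relator must be among the generators; sums and multiples of them then lie in the submodule.\<close>
  from gen consider
      (left) m m' n where "x = frag_of (m + m', n) - frag_of (m, n) - frag_of (m', n)"
    | (right) m n n' where "x = frag_of (m, n + n') - frag_of (m, n) - frag_of (m, n')"
    | (act) b m n where "x = frag_of (lac b m, n) - frag_of (m, rac n b)"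
    | (null) m n where "x = frag_of (m, n)" "n \<in> add_span R"
    unfolding balanced_relators_def by auto
  then show ?case
  proof cases
    case left
    show ?thesis
    proof (intro exI[of _ "{n}"] conjI allI impI)
      fix s :: "nat \<Rightarrow> 'n" and k assume "{n} \<subseteq> s ` {..<k}"
      then obtain c where c: "lin_comb s k c \<approx>\<^bsub>R\<^esub> n"
        using gen_mem by (meson insert_subset)
      show "fmap (\<lambda>(m, n). (fiber s k n, m)) x \<in> add_span (rtensor_relators (subquotient UNIV (relations s k)) lac)"
        unfolding left fiber_eq_coset[OF c]
        by (rule add_span.gen)
          (auto simp: fmap_def frag_extend_diff fiber_eq_coset[OF c] rtensor_relators_def
            biadditive_relators_def subquotient_carrier)
    qed simp
  next
    case right
    show ?thesis
    proof (intro exI[of _ "{n, n'}"] conjI allI impI)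
      fix s :: "nat \<Rightarrow> 'n" and k assume "{n, n'} \<subseteq> s ` {..<k}"
      then obtain c c' where c: "lin_comb s k c \<approx>\<^bsub>R\<^esub> n" "lin_comb s k c' \<approx>\<^bsub>R\<^esub> n'"
        using gen_mem by (metis insert_subset)
      have "lin_comb s k (c + c') \<approx>\<^bsub>R\<^esub> n + n'"
        using cong_trans[OF lin_comb_add cong_add[OF c]] by simp
      note c = c this
      have "fmap (\<lambda>(m, n). (fiber s k n, m)) x =
        frag_of (coset_of (relations s k) c \<oplus>\<^bsub>subquotient UNIV (relations s k)\<^esub> coset_of (relations s k) c', m)
        - frag_of (coset_of (relations s k) c, m) - frag_of (coset_of (relations s k) c', m)"
        unfolding right by (simp add: subquotient_add[OF submod_relations] fmap_def frag_extend_diff c[THEN fiber_eq_coset])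
      then show "fmap (\<lambda>(m, n). (fiber s k n, m)) x \<in> add_span (rtensor_relators (subquotient UNIV (relations s k)) lac)"
        unfolding rtensor_relators_def biadditive_relators_def subquotient_carrier
        by (intro add_span.gen) blast
    qed simp
  next
    case act
    show ?thesis
    proof (intro exI[of _ "{n}"] conjI allI impI)
      fix s :: "nat \<Rightarrow> 'n" and k assume "{n} \<subseteq> s ` {..<k}"
      then obtain c where c: "lin_comb s k c \<approx>\<^bsub>R\<^esub> n"
        using gen_mem by (meson insert_subset)
      then have "lin_comb s k (\<lambda>i. c i * b) \<approx>\<^bsub>R\<^esub> rac n b"
        using cong_trans[OF lin_comb_smult rac_cong] by simp
      note c = c this
      have "fmap (\<lambda>(m, n). (fiber s k n, m)) x =
        - (frag_of (b \<odot>\<^bsub>subquotient UNIV (relations s k)\<^esub> coset_of (relations s k) c, m)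
         - frag_of (coset_of (relations s k) c, lac b m))"
        unfolding act by (simp add: subquotient_smult[OF submod_relations] fmap_def frag_extend_diff c[THEN fiber_eq_coset])
      then show "fmap (\<lambda>(m, n). (fiber s k n, m)) x \<in> add_span (rtensor_relators (subquotient UNIV (relations s k)) lac)"
        unfolding rtensor_relators_def balancing_relators_def subquotient_carrier
        by (simp only:) (intro add_span_uminus add_span.gen, blast)
    qed simp
  next
    case null
    show ?thesis
    proof (intro exI[of _ "{}"] conjI allI impI)
      fix s k
      have "lin_comb s k 0 \<approx>\<^bsub>R\<^esub> n"
        using null lin_comb_zero[of k s] by (simp add: cong_span_def add_span.diff)
      note c = fiber_eq_coset[OF this]
      have "fmap (\<lambda>(m, n). (fiber s k n, m)) x =
        - (frag_of (coset_of (relations s k) 0 \<oplus>\<^bsub>subquotient UNIV (relations s k)\<^esub> coset_of (relations s k) 0, m)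
        - frag_of (coset_of (relations s k) 0, m) - frag_of (coset_of (relations s k) 0, m))"
        unfolding null by (simp add: subquotient_add[OF submod_relations] fmap_def frag_extend_diff c)
      then show "fmap (\<lambda>(m, n). (fiber s k n, m)) x \<in> add_span (rtensor_relators (subquotient UNIV (relations s k)) lac)"
        unfolding rtensor_relators_def biadditive_relators_def subquotient_carrier
        by (simp only:) (intro add_span_uminus add_span.gen, blast)
    qed simp
  qed
qed

end

lemma coset_of_zero: "coset_of {0} c = {c}"
  by (auto simp: coset_of_def)

text \<open>Tensoring with a flat module preserves the kernel of \<open>d\<close>, for right modules of any size. Only finitely
  many elements occur in \<open>z\<close> and in the relations that annihilate its image, so that \<open>d\<close> may be
  restricted to a map from a module of sequences to a finitely generated module, where the test
  modules apply. With \<open>d\<close> injective this says that \<open>1 \<otimes> d\<close> is injective.\<close>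

lemma flat_kernel:
  fixes lac :: "'b::{ring,monoid_mult} \<Rightarrow> 'm::ab_group_add \<Rightarrow> 'm"
    and rac :: "'n::ab_group_add \<Rightarrow> 'b \<Rightarrow> 'n" and rac' :: "'n'::ab_group_add \<Rightarrow> 'b \<Rightarrow> 'n'"
  assumes flat: "faithfully_flat (\<lambda>b c. b * c) lac"
    and M: "presented_module A R rac" and N: "presented_module UNIV R' rac'"
    and d_add: "\<And>n n'. n \<in> A \<Longrightarrow> n' \<in> A \<Longrightarrow> d (n + n') \<approx>\<^bsub>R'\<^esub> d n + d n'"
    and d_act: "\<And>n b. n \<in> A \<Longrightarrow> d (rac n b) \<approx>\<^bsub>R'\<^esub> rac' (d n) b"
    and z: "Poly_Mapping.keys z \<subseteq> UNIV \<times> A"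
    and dz: "fmap (\<lambda>(m, n). (m, d n)) z \<in> add_span (balanced_relators lac UNIV R' rac')"
  obtains z' where "Poly_Mapping.keys z' \<subseteq> UNIV \<times> {n \<in> A. d n \<in> add_span R'}"
    and "z \<approx>\<^bsub>balanced_relators lac A R rac\<^esub> z'"
proof -
  interpret M: presented_module A R rac by (fact M)
  interpret N: presented_module_total R' rac' by (intro presented_module_total.intro N)
  obtain S where S: "finite S" "\<And>s k. S \<subseteq> s ` {..<k} \<Longrightarrow>
    fmap (\<lambda>(m, n). (N.fiber s k n, m)) (fmap (\<lambda>(m, n). (m, d n)) z) \<in>
      add_span (rtensor_relators (subquotient UNIV (N.relations s k)) lac)"
    using N.relation_finitely_generated[OF dz] by blast
  obtain e k where e: "bij_betw e {..<k::nat} (Poly_Mapping.keys z)"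
    using ex_bij_betw_nat_finite[OF finite_keys[of z]] by (auto simp: atLeast0LessThan)
  obtain f l where f: "S = f ` {..<l::nat}"
    using finite_imp_nat_seg_image_inj_on[OF S(1)] by (auto simp: lessThan_def)
  \<comment> \<open>The first \<open>k\<close> generators are the images of the elements in \<open>z\<close>; the other \<open>l\<close> ones are needed to see that the image of \<open>z\<close> vanishes.\<close>
  define n where "n i = snd (e i)" for i
  define idx where "idx = inv_into {..<k} e"
  define s where "s i = (if i < k then d (n i) else f (i - k))" for i
  define Q where "Q = N.relations s (k + l)"
  \<comment> \<open>Combinations of the first \<open>k\<close> generators only: these come from combinations in the source of \<open>d\<close>.\<close>
  define V where "V = {c :: nat \<Rightarrow> 'b. \<forall>i\<ge>k. c i = 0}"
  have n_mem: "n i \<in> A" if "i < k" for i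
    using z that e unfolding n_def by (force simp: bij_betw_def)
  have idx: "idx a < k" "e (idx a) = a" if "a \<in> Poly_Mapping.keys z" for a
    using that e unfolding idx_def bij_betw_def
    by (metis inv_into_into lessThan_iff) (metis that bij_betw_inv_into_right e)
  have "S \<subseteq> s ` {..<k+l}"
  proof
    fix x assume "x \<in> S"
    then obtain j where "j < l" "x = f j"
      using f by auto
    then show "x \<in> s ` {..<k+l}"
      by (intro image_eqI[of _ _ "k + j"]) (auto simp: s_def)
  qed
  then have fib: "fmap (\<lambda>(m, n). (N.fiber s (k+l) n, m)) (fmap (\<lambda>(m, n). (m, d n)) z) \<in>
      add_span (rtensor_relators (subquotient UNIV Q) lac)"
    unfolding Q_def by (rule S(2))
  have Q: "submod Q"
    unfolding Q_def by (rule N.submod_relations)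
  have V: "submod V"
    by (auto simp: V_def submod_def)
  define N1 where "N1 = subquotient (V \<inter> Q) {0 :: nat \<Rightarrow> 'b}"
  define N2 where "N2 = subquotient V {0 :: nat \<Rightarrow> 'b}"
  define N3 where "N3 = subquotient UNIV Q"
  define g where "g X = (\<Union>x\<in>X. coset_of Q x)" for X
  have g: "g {c} = coset_of Q c" for c
    by (simp add: g_def)
  note ops = subquotient_add subquotient_smult subquotient_carrier subquotient_zero
  have mods: "right_module (\<lambda>b c. b * c) N1" "right_module (\<lambda>b c. b * c) N2" "right_module (\<lambda>b c. b * c) N3"
    unfolding N1_def N2_def N3_def
    by (intro subquotient_right_module submod_Int V Q submod_zero submod_UNIV)+
  have hom_id: "id \<in> rmod_hom N1 N2"
    unfolding rmod_hom_def N1_def N2_def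
    by (auto simp: subquotient_carrier) (auto simp: subquotient_def)
  have N2_carrier: "carrier N2 = (\<lambda>c. {c}) ` V"
    by (auto simp: N2_def subquotient_carrier coset_of_zero)
  have N2_add: "{c} \<oplus>\<^bsub>N2\<^esub> {c'} = {c + c'}" for c c'
    using subquotient_add[OF submod_zero, where c = c and V = V and c' = c'] by (simp add: N2_def coset_of_zero)
  have N2_smult: "b \<odot>\<^bsub>N2\<^esub> {c} = {\<lambda>i. c i * b}" for c b
    using subquotient_smult[OF submod_zero, where b = b and V = V and c = c] by (simp add: N2_def coset_of_zero)
  have hom_g: "g \<in> rmod_hom N2 N3"
    unfolding rmod_hom_def N2_carrier
    by (auto simp add: N2_add N2_smult g N3_def subquotient_add[OF Q] subquotient_smult[OF Q] subquotient_carrier)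
  have "g {c} = \<zero>\<^bsub>N3\<^esub> \<longleftrightarrow> c \<in> Q" for c
    using coset_of_eq_iff[OF Q, of c 0] by (simp add: g N3_def subquotient_zero)
  then have exact: "id ` carrier N1 = {X \<in> carrier N2. g X = \<zero>\<^bsub>N3\<^esub>}"
    unfolding N2_carrier by (auto simp: N1_def subquotient_carrier coset_of_zero)
  have texact: "rtensor_map N2 lac id ` rtensor N1 lac =
      {v \<in> rtensor N2 lac. rtensor_map N3 lac g v = cls (rtensor_relators N3 lac) 0}"
    using flat[unfolded faithfully_flat_def, rule_format, of N1 N2 N3 id g] mods hom_id hom_g exact
    by simp
  have rel_map: "tensor_hom (rtensor_relators N lac) (rtensor_relators N' lac) (fmap (\<lambda>(X, m). (h X, m)))"
    if h: "h \<in> rmod_hom N N'" for N N' h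
    unfolding fmap_def
  proof (rule tensor_hom_frag_extend)
    fix r assume "r \<in> rtensor_relators N lac"
    then have "frag_extend (\<lambda>a. frag_of (case a of (X, m) \<Rightarrow> (h X, m))) r \<in> rtensor_relators N' lac"
      using h unfolding rtensor_relators_def biadditive_relators_def balancing_relators_def rmod_hom_def
      by (auto simp: frag_extend_diff Pi_iff) metis+
    then show "frag_extend (\<lambda>a. frag_of (case a of (X, m) \<Rightarrow> (h X, m))) r \<in> add_span (rtensor_relators N' lac)"
      by (rule add_span.gen)
  qed
  define unit where "unit j = (\<lambda>i. if i = j then 1 else 0 :: 'b)" for j :: nat
  have unit_V: "unit j \<in> V" if "j < k" for j
    using that by (auto simp: V_def unit_def)
  \<comment> \<open>The formal sum \<open>z\<close> with every element replaced by the corresponding free generator.\<close>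
  define w where "w = frag_extend (\<lambda>a. frag_of ({unit (idx a)}, fst a)) z"
  have w_keys: "Poly_Mapping.keys w \<subseteq> carrier N2 \<times> UNIV"
    unfolding w_def using keys_frag_extend idx(1) unit_V
    by (force simp: keys_frag_of N2_def subquotient_carrier coset_of_zero)
  have "fmap (\<lambda>(X, m). (g X, m)) w =
      fmap (\<lambda>(m, n). (N.fiber s (k+l) n, m)) (fmap (\<lambda>(m, n). (m, d n)) z)"
    unfolding w_def frag_simps
  proof (intro frag_extend_eq, simp)
    fix a assume a: "a \<in> Poly_Mapping.keys z"
    have "d (snd a) = s (idx a)"
      using idx[OF a] by (simp add: s_def n_def)
    then have "N.lin_comb s (k+l) (unit (idx a)) \<approx>\<^bsub>R'\<^esub> d (snd a)"
      using N.lin_comb_unit[of "k+l" s "idx a"] idx[OF a] by (simp add: unit_def)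
    then show "frag_of (g {unit (idx a)}, fst a) = frag_of (N.fiber s (k+l) (d (snd a)), fst a)"
      using N.fiber_eq_coset by (simp add: g Q_def)
  qed
  then have "rtensor_map N3 lac g (cls (rtensor_relators N2 lac) w) = cls (rtensor_relators N3 lac) 0"
    unfolding rtensor_map_def tensor_hom_induced[OF rel_map[OF hom_g]]
    using fib by (simp add: cls_eq_iff cong_zero_iff N3_def)
  then have "cls (rtensor_relators N2 lac) w \<in> rtensor_map N2 lac id ` rtensor N1 lac"
    unfolding texact using w_keys by (auto simp: rtensor_def)
  then obtain x where x: "Poly_Mapping.keys x \<subseteq> carrier N1 \<times> UNIV"
      and "cls (rtensor_relators N2 lac) w = cls (rtensor_relators N2 lac) (fmap (\<lambda>(X, m). (id X, m)) x)"
    unfolding rtensor_def rtensor_map_def using tensor_hom_induced[OF rel_map[OF hom_id]] by auto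
  then have wx: "w \<approx>\<^bsub>rtensor_relators N2 lac\<^esub> x"
    by (simp add: cls_eq_iff frag_simps)
  \<comment> \<open>Substituting the elements in \<open>z\<close> for the free generators returns to the original module.\<close>
  define h where "h X = M.lin_comb n k (the_elem X)" for X
  have h: "h {c} = M.lin_comb n k c" for c
    by (simp add: h_def)
  let ?T = "balanced_relators lac A R rac"
  define \<psi> where "\<psi> = frag_extend (\<lambda>(X, m). frag_of (m :: 'm, h X))"
  note M_lin = M.lin_comb_mem[of k n, OF n_mem] M.lin_comb_add[of k n, OF n_mem] M.lin_comb_smult[of k n, OF n_mem]
  have "tensor_hom (rtensor_relators N2 lac) ?T \<psi>"
    unfolding \<psi>_def
  proof (rule tensor_hom_frag_extend)
    fix r assume "r \<in> rtensor_relators N2 lac"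
    then consider
        (left) c c' m where "r = frag_of ({c} \<oplus>\<^bsub>N2\<^esub> {c'}, m) - frag_of ({c}, m) - frag_of ({c'}, m)"
      | (right) c m m' where "r = frag_of ({c}, m + m') - frag_of ({c}, m) - frag_of ({c}, m')"
      | (act) b c m where "r = frag_of (b \<odot>\<^bsub>N2\<^esub> {c}, m) - frag_of ({c}, lac b m)"
      unfolding rtensor_relators_def biadditive_relators_def balancing_relators_def
      unfolding N2_carrier by blast
    then show "frag_extend (\<lambda>(X, m). frag_of (m, h X)) r \<in> add_span ?T"
    proof cases
      case left
      have "frag_of (m, M.lin_comb n k (c + c')) \<approx>\<^bsub>?T\<^esub> frag_of (m, M.lin_comb n k c + M.lin_comb n k c')"
        using M_lin M.add_mem by (intro M.balanced_cong) auto
      also have "\<dots> \<approx>\<^bsub>?T\<^esub> frag_of (m, M.lin_comb n k c) + frag_of (m, M.lin_comb n k c')"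
        using M_lin by (intro balanced_add_right) auto
      finally show ?thesis
        by (simp add: left N2_add frag_extend_diff frag_extend_add h cong_span_def diff_diff_eq)
    next
      case right
      then show ?thesis
        using balanced_add_left[of "M.lin_comb n k c" A m m' lac R rac] M_lin
        by (simp add: frag_extend_diff frag_extend_add h cong_span_def diff_diff_eq)
    next
      case act
      have "frag_of (m, M.lin_comb n k (\<lambda>i. c i * b)) \<approx>\<^bsub>?T\<^esub> frag_of (m, rac (M.lin_comb n k c) b)"
        using M_lin M.rac_mem by (intro M.balanced_cong) auto
      also have "\<dots> \<approx>\<^bsub>?T\<^esub> frag_of (lac b m, M.lin_comb n k c)"
        using M_lin by (intro cong_sym[OF balanced_act]) auto
      finally show ?thesis
        by (simp add: act N2_smult frag_extend_diff frag_extend_add h cong_span_def)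
    qed
  qed
  note \<psi>_hom = this
  have "z \<approx>\<^bsub>?T\<^esub> \<psi> w"
  proof -
    have "frag_extend frag_of z \<approx>\<^bsub>?T\<^esub> \<psi> w"
      unfolding w_def \<psi>_def frag_extend_frag_extend
    proof (rule frag_extend_cong, simp add: h)
      fix a assume a: "a \<in> Poly_Mapping.keys z"
      have "M.lin_comb n k (unit (idx a)) \<approx>\<^bsub>R\<^esub> snd a"
        using M.lin_comb_unit[of k n "idx a"] n_mem idx[OF a] by (simp add: unit_def n_def)
      then have "frag_of (fst a, M.lin_comb n k (unit (idx a))) \<approx>\<^bsub>?T\<^esub> frag_of (fst a, snd a)"
        using M_lin z a by (intro M.balanced_cong) auto
      then show "frag_of a \<approx>\<^bsub>?T\<^esub> frag_of (fst a, M.lin_comb n k (unit (idx a)))"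
        by (simp add: cong_sym)
    qed
    then show ?thesis
      by (simp add: frag_extend_ident)
  qed
  also have "\<psi> w \<approx>\<^bsub>?T\<^esub> \<psi> x"
    by (rule tensor_hom_cong[OF \<psi>_hom wx])
  finally have "z \<approx>\<^bsub>?T\<^esub> \<psi> x" .
  moreover have d_ker: "d (M.lin_comb n k c) \<in> add_span R'" if "c \<in> V" "c \<in> Q" for c
  proof -
    have d0: "d 0 \<in> add_span R'"
      using d_add[OF M.zero_mem M.zero_mem] add_span_uminus by (force simp: cong_span_def)
    have d_sum: "d (\<Sum>i\<in>I. rac (n i) (c i)) \<approx>\<^bsub>R'\<^esub> (\<Sum>i\<in>I. rac' (d (n i)) (c i))" if "I \<subseteq> {..<k}" for I
      using finite_subset[OF that finite_lessThan] that
    proof (induction I rule: finite_induct)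
      case (insert i I)
      have "d (rac (n i) (c i) + (\<Sum>i\<in>I. rac (n i) (c i)))
          \<approx>\<^bsub>R'\<^esub> d (rac (n i) (c i)) + d (\<Sum>i\<in>I. rac (n i) (c i))"
        using insert.prems n_mem by (intro d_add M.sum_mem M.rac_mem) auto
      also have "\<dots> \<approx>\<^bsub>R'\<^esub> rac' (d (n i)) (c i) + (\<Sum>i\<in>I. rac' (d (n i)) (c i))"
        using insert n_mem by (intro cong_add d_act) auto
      finally show ?case
        using insert by simp
    qed (simp add: d0 cong_zero_iff)
    have "d (M.lin_comb n k c) \<approx>\<^bsub>R'\<^esub> (\<Sum>i<k. rac' (s i) (c i))"
      using d_sum[of "{..<k}"] by (simp add: M.lin_comb_def s_def)
    also have "(\<Sum>i<k. rac' (s i) (c i)) = (\<Sum>i<k+l. if i < k then rac' (s i) (c i) else 0)"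
      by (rule sum.mono_neutral_cong_left) auto
    also have "\<dots> \<approx>\<^bsub>R'\<^esub> N.lin_comb s (k + l) c"
      unfolding N.lin_comb_def
      using that(1) N.rac_zero_right by (intro cong_sum) (auto simp: V_def cong_zero_iff intro!: cong_sym[of _ _ 0])
    finally show ?thesis
      using that(2) span_cong by (auto simp: Q_def N.relations_def)
  qed
  have "Poly_Mapping.keys (\<psi> x) \<subseteq> UNIV \<times> {n \<in> A. d n \<in> add_span R'}"
  proof -
    have "Poly_Mapping.keys (\<psi> x) \<subseteq> (\<Union>a\<in>Poly_Mapping.keys x. {(snd a, h (fst a))})"
      using keys_frag_extend[of "\<lambda>(X, m). frag_of (m, h X)" x]
      by (simp add: \<psi>_def case_prod_unfold keys_frag_of)
    moreover have "h X \<in> A \<and> d (h X) \<in> add_span R'" if Xm: "(X, m) \<in> Poly_Mapping.keys x" for X m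
    proof -
      obtain c where "X = {c}" "c \<in> V" "c \<in> Q"
        using subsetD[OF x Xm] by (auto simp: N1_def subquotient_carrier coset_of_zero)
      then show ?thesis
        using d_ker M_lin by (simp add: h)
    qed
    ultimately show ?thesis
      by force
  qed
  ultimately show ?thesis
    using that by blast
qed

lemma add_span_empty: "x \<in> add_span {} \<longleftrightarrow> x = 0"
proof
  show "x = 0" if "x \<in> add_span {}"
    using that by induction auto
qed (simp add: add_span.zero)

section \<open>Threefold tensor products\<close>

lemma triple_left_hom: "tensor_hom S (triple_relators S R) (fmap (\<lambda>(X, Y). (X, Y, q)))"
  by (auto simp: tensor_hom_def fmap_def frag_extend_diff triple_relators_def intro!: add_span.gen)

lemma triple_right_hom: "tensor_hom R (triple_relators S R) (fmap (\<lambda>(Y, q). (X, Y, q)))"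
  by (auto simp: tensor_hom_def fmap_def frag_extend_diff triple_relators_def intro!: add_span.gen)

lemmas triple_left = tensor_hom_span[OF triple_left_hom]
lemmas triple_right = tensor_hom_span[OF triple_right_hom]

lemma triple_left_cong:
  "x \<approx>\<^bsub>S\<^esub> y \<Longrightarrow> fmap (\<lambda>(X, Y). (X, Y, q)) x \<approx>\<^bsub>triple_relators S R\<^esub> fmap (\<lambda>(X, Y). (X, Y, q)) y"
  by (rule tensor_hom_cong[OF triple_left_hom])

lemma triple_right_cong:
  "x \<approx>\<^bsub>R\<^esub> y \<Longrightarrow> fmap (\<lambda>(Y, q). (X, Y, q)) x \<approx>\<^bsub>triple_relators S R\<^esub> fmap (\<lambda>(Y, q). (X, Y, q)) y"
  by (rule tensor_hom_cong[OF triple_right_hom])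

text \<open>For fixed last factor, and for fixed first factor, the map has to respect the relations of the other two.\<close>

lemma tensor_hom_triple:
  assumes "\<And>q. tensor_hom S R' (frag_extend (\<lambda>(X, Y). h (X, Y, q)))"
    and "\<And>X. tensor_hom R R' (frag_extend (\<lambda>(Y, q). h (X, Y, q)))"
  shows "tensor_hom (triple_relators S R) R' (frag_extend h)"
proof (rule tensor_hom_frag_extend)
  fix r assume "r \<in> triple_relators S R"
  then show "frag_extend h r \<in> add_span R'"
    using assms unfolding triple_relators_def tensor_hom_def
    by (auto simp: frag_simps)
qed

lemma tensor_hom_triple_fmap:
  assumes "tensor_hom S S (fmap (\<lambda>(X, Y). (f X, g Y)))" and "tensor_hom R R (fmap (\<lambda>(Y, q). (g Y, h q)))"
  shows "tensor_hom (triple_relators S R) (triple_relators S R) (fmap (\<lambda>(X, Y, q). (f X, g Y, h q)))"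
  unfolding fmap_def
proof (rule tensor_hom_triple)
  fix q
  show "tensor_hom S (triple_relators S R)
      (frag_extend (\<lambda>(X, Y). frag_of (case (X, Y, q) of (X, Y, q) \<Rightarrow> (f X, g Y, h q))))"
    using tensor_hom_comp[OF assms(1) triple_left_hom[of S R "h q"]] by (simp add: frag_simps)
next
  fix X
  show "tensor_hom R (triple_relators S R)
      (frag_extend (\<lambda>(Y, q). frag_of (case (X, Y, q) of (X, Y, q) \<Rightarrow> (f X, g Y, h q))))"
    using tensor_hom_comp[OF assms(2) triple_right_hom[of R S "f X"]] by (simp add: frag_simps)
qed

lemma (in vector_space) eval_sum_superset:
  assumes "finite S" "Poly_Mapping.keys x \<subseteq> S"
  shows "eval_sum scale f x = (\<Sum>a\<in>S. scale (of_int (Poly_Mapping.lookup x a)) (f a))"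
  unfolding eval_sum_def using assms
  by (intro sum.mono_neutral_left) (auto simp: in_keys_iff)

lemma (in vector_space) eval_sum_diff: "eval_sum scale f (x - y) = eval_sum scale f x - eval_sum scale f y"
proof -
  let ?S = "Poly_Mapping.keys x \<union> Poly_Mapping.keys y"
  have "Poly_Mapping.keys (x - y) \<subseteq> ?S"
    by (auto simp: in_keys_iff lookup_minus)
  then show ?thesis
    by (simp add: eval_sum_superset[of ?S] lookup_minus scale_left_diff_distrib sum_subtractf)
qed

lemma (in vector_space) eval_sum_frag_of [simp]: "eval_sum scale f (frag_of a) = f a"
  by (simp add: eval_sum_def)

section \<open>Left bialgebroids and their regular comodule\<close>

locale bialgebroid_bimodule = left_bialgebroid L + bimodule "bscale L" G
  for L :: "('k::field, 'b::{ring,monoid_mult}, 'l::{ring,monoid_mult}) bialgebroid"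
    and G :: "('k, 'b, 'p::ab_group_add, 'z) bimod_scheme"

context left_bialgebroid
begin

lemma src_add: "src L (b + c) = src L b + src L c"
  using src_linear by (simp add: Vector_Spaces.linear_iff)

text \<open>Scalars act through the image of the base, so the relations over the ground field are instances of
  the relations over \<open>B\<close>.\<close>

lemma scale_src: "lscale L c X = src L (bscale L c 1) * X"
  and scale_tgt: "lscale L c X = tgt L (bscale L c 1) * X"
proof -
  interpret B: unital_algebra "bscale L" by (rule base_algebra)
  interpret T: unital_algebra "lscale L" by (rule total_algebra)
  have "src L (bscale L c 1) = lscale L c 1" "tgt L (bscale L c 1) = lscale L c 1"
    using src_linear tgt_linear src_one tgt_one
    by (metis Vector_Spaces.linear_iff)+
  then show "lscale L c X = src L (bscale L c 1) * X" "lscale L c X = tgt L (bscale L c 1) * X"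
    by (simp_all flip: T.scale_mult_left)
qed

lemma src_tgt_left_commute: "src L b * (tgt L c * X) = tgt L c * (src L b * X)"
  by (metis mult.assoc src_tgt_commute)

lemma bialgebroid_bimodule_regular: "bialgebroid_bimodule L (regular L)"
proof -
  interpret B: unital_algebra "bscale L" by (rule base_algebra)
  interpret T: unital_algebra "lscale L" by (rule total_algebra)
  have s: "src L (bscale L c b) = lscale L c (src L b)" for c b
    using src_linear by (simp add: Vector_Spaces.linear_iff)
  show ?thesis
    by (intro bialgebroid_bimodule.intro bimodule.intro bimodule_axioms.intro left_bialgebroid_axioms)
      (auto simp: regular_def T.vector_space_axioms src_add src_mult src_one s algebra_simps
        simp flip: T.scale_mult_left T.scale_mult_right)
qed

end

context bialgebroid_bimodule
begin

abbreviation "dia \<equiv> diamond_relators L G"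
abbreviation "ups \<equiv> uptensor_relators L G"

lemma lact_scale_one: "mscale G c p = lact G (bscale L c 1) p"
  and ract_scale_one: "mscale G c p = ract G p (bscale L c 1)"
  by (simp_all add: lact_scale ract_scale lact_one ract_one)

lemma dia_cases:
  assumes "r \<in> dia"
  obtains (left) Y Y' q where "r = frag_of (Y + Y', q) - frag_of (Y, q) - frag_of (Y', q)"
    | (right) Y q q' where "r = frag_of (Y, q + q') - frag_of (Y, q) - frag_of (Y, q')"
    | (bal) b Y q where "r = frag_of (tgt L b * Y, q) - frag_of (Y, lact G b q)"
  using assms unfolding diamond_relators_def field_relators_def biadditive_relators_def balancing_relators_def
  by (auto simp: scale_tgt lact_scale_one)

lemma ups_cases:
  assumes "r \<in> ups"
  obtains (left) X X' p where "r = frag_of (X + X', p) - frag_of (X, p) - frag_of (X', p)"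
    | (right) X p p' where "r = frag_of (X, p + p') - frag_of (X, p) - frag_of (X, p')"
    | (bal) b X p where "r = frag_of (src L b * X, p) - frag_of (X, ract G p b)"
  using assms unfolding uptensor_relators_def field_relators_def biadditive_relators_def balancing_relators_def
  by (auto simp: scale_src ract_scale_one)

lemma dia_add_left: "frag_of (Y + Y', q) \<approx>\<^bsub>dia\<^esub> frag_of (Y, q) + frag_of (Y', q)"
  and dia_add_right: "frag_of (Y, q + q') \<approx>\<^bsub>dia\<^esub> frag_of (Y, q) + frag_of (Y, q')"
  and dia_bal: "frag_of (tgt L b * Y, q) \<approx>\<^bsub>dia\<^esub> frag_of (Y, lact G b q)"
  unfolding cong_span_def diff_diff_eq[symmetric] diamond_relators_def field_relators_def biadditive_relators_def balancing_relators_def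
  by (rule add_span.gen, blast)+

lemma ups_add_left: "frag_of (X + X', p) \<approx>\<^bsub>ups\<^esub> frag_of (X, p) + frag_of (X', p)"
  and ups_add_right: "frag_of (X, p + p') \<approx>\<^bsub>ups\<^esub> frag_of (X, p) + frag_of (X, p')"
  and ups_bal: "frag_of (src L b * X, p) \<approx>\<^bsub>ups\<^esub> frag_of (X, ract G p b)"
  unfolding cong_span_def diff_diff_eq[symmetric] uptensor_relators_def field_relators_def biadditive_relators_def balancing_relators_def
  by (rule add_span.gen, blast)+

lemma tensor_hom_dia:
  assumes "\<And>Y Y' q. h (Y + Y', q) \<approx>\<^bsub>R\<^esub> h (Y, q) + h (Y', q)"
    and "\<And>Y q q'. h (Y, q + q') \<approx>\<^bsub>R\<^esub> h (Y, q) + h (Y, q')"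
    and "\<And>b Y q. h (tgt L b * Y, q) \<approx>\<^bsub>R\<^esub> h (Y, lact G b q)"
  shows "tensor_hom dia R (frag_extend h)"
proof (rule tensor_hom_frag_extend)
  fix r assume "r \<in> dia"
  then show "frag_extend h r \<in> add_span R"
    by (cases rule: dia_cases) (use assms in \<open>auto simp: frag_extend_diff diff_diff_eq cong_span_def frag_extend_add\<close>)
qed

lemma tensor_hom_ups:
  assumes "\<And>Y Y' q. h (Y + Y', q) \<approx>\<^bsub>R\<^esub> h (Y, q) + h (Y', q)"
    and "\<And>Y q q'. h (Y, q + q') \<approx>\<^bsub>R\<^esub> h (Y, q) + h (Y, q')"
    and "\<And>b Y q. h (src L b * Y, q) \<approx>\<^bsub>R\<^esub> h (Y, ract G q b)"
  shows "tensor_hom ups R (frag_extend h)"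
proof (rule tensor_hom_frag_extend)
  fix r assume "r \<in> ups"
  then show "frag_extend h r \<in> add_span R"
    by (cases rule: ups_cases) (use assms in \<open>auto simp: frag_extend_diff diff_diff_eq cong_span_def frag_extend_add\<close>)
qed

lemma dia_mult_right: "tensor_hom dia dia (fmap (\<lambda>(Y, q). (Y * X, q)))"
  unfolding fmap_def
  by (rule tensor_hom_dia) (auto simp: distrib_right mult.assoc intro: dia_add_left dia_add_right dia_bal)

lemma dia_mult_src: "tensor_hom dia dia (fmap (\<lambda>(Y, q). (src L b * Y, q)))"
  unfolding fmap_def
  by (rule tensor_hom_dia)
    (auto simp: distrib_left src_tgt_left_commute intro: dia_add_left dia_add_right dia_bal)

lemma dia_ract: "tensor_hom dia dia (fmap (\<lambda>(Y, q). (Y, ract G q b)))"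
  unfolding fmap_def
  by (rule tensor_hom_dia) (auto simp: ract_add_left lact_ract intro: dia_add_left dia_add_right dia_bal)

lemma ups_mult_right: "tensor_hom ups ups (fmap (\<lambda>(Y, q). (Y * X, q)))"
  unfolding fmap_def
  by (rule tensor_hom_ups) (auto simp: distrib_right mult.assoc intro: ups_add_left ups_add_right ups_bal)

text \<open>The formal sums that represent elements of the Takeuchi product \<open>L \<times>\<^sub>B G\<close>.\<close>

definition takeuchi_sums :: "('l \<times> 'p \<Rightarrow>\<^sub>0 int) set" where
  "takeuchi_sums = {\<xi>. \<forall>a. fmap (\<lambda>(Y, q). (Y * tgt L a, q)) \<xi> \<approx>\<^bsub>dia\<^esub> fmap (\<lambda>(Y, q). (Y, ract G q a)) \<xi>}"

lemma takeuchi_iff: "cls dia \<xi> \<in> takeuchi L G \<longleftrightarrow> \<xi> \<in> takeuchi_sums"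
  unfolding takeuchi_def takeuchi_sums_def quot_def
  by (simp add: tensor_hom_induced[OF dia_mult_right] tensor_hom_induced[OF dia_ract] cls_eq_iff rangeI)

end

sublocale left_bialgebroid \<subseteq> reg: bialgebroid_bimodule L "regular L"
  by (rule bialgebroid_bimodule_regular)

lemma regular_simps [simp]:
  "mscale (regular L) = lscale L" "lact (regular L) b X = src L b * X"
  "ract (regular L) X b = X * src L b" "coact (regular L) = coprod L"
  by (simp_all add: regular_def)

context left_bialgebroid
begin

abbreviation "Delta X \<equiv> rep (coprod L X)"

lemma coprod_eq_cls: "coprod L X = cls reg.dia (Delta X)"
  using coprod_takeuchi cls_rep by (fastforce simp: takeuchi_def)

lemma Delta_takeuchi_sums: "Delta X \<in> reg.takeuchi_sums"
  using coprod_takeuchi coprod_eq_cls reg.takeuchi_iff by metis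

lemma Delta_add: "Delta (X + Y) \<approx>\<^bsub>reg.dia\<^esub> Delta X + Delta Y"
  using coprod_add[of X Y] rep_cls by metis

lemma dia_mult_both: "tensor_hom reg.dia reg.dia (fmap (\<lambda>(Y, Z). (src L b * Y, tgt L c * Z)))"
  unfolding fmap_def
proof (rule reg.tensor_hom_dia, simp_all add: distrib_left reg.dia_add_left reg.dia_add_right)
  fix b' Y q
  show "frag_of (src L b * (tgt L b' * Y), tgt L c * q) \<approx>\<^bsub>reg.dia\<^esub>
      frag_of (src L b * Y, tgt L c * (src L b' * q))"
    using reg.dia_bal[of b' "src L b * Y" "tgt L c * q"] by (simp add: src_tgt_left_commute)
qed

lemma Delta_bimodule:
  "Delta (src L b * tgt L c * X) \<approx>\<^bsub>reg.dia\<^esub> fmap (\<lambda>(Y, Z). (src L b * Y, tgt L c * Z)) (Delta X)"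
proof -
  have "cls reg.dia (Delta (src L b * tgt L c * X)) =
      induced reg.dia (fmap (\<lambda>(Y, Z). (src L b * Y, tgt L c * Z))) (cls reg.dia (Delta X))"
    unfolding coprod_eq_cls[symmetric] by (rule coprod_bimodule)
  then show ?thesis
    by (simp add: tensor_hom_induced[OF dia_mult_both] cls_eq_iff)
qed

lemma Delta_src: "Delta (src L b * X) \<approx>\<^bsub>reg.dia\<^esub> fmap (\<lambda>(Y, Z). (src L b * Y, Z)) (Delta X)"
  using Delta_bimodule[of b 1 X] by (simp add: tgt_one)

lemma Delta_tgt: "Delta (tgt L c * X) \<approx>\<^bsub>reg.dia\<^esub> fmap (\<lambda>(Y, Z). (Y, tgt L c * Z)) (Delta X)"
  using Delta_bimodule[of 1 c X] by (simp add: src_one)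

text \<open>The product of two coproducts is formed on representatives. It respects the relations in the right
  factor because the left factor satisfies the Takeuchi condition; so \<open>\<Delta>(b)\<close> may be replaced by \<open>b \<otimes> 1\<close>.\<close>

lemma Delta_mult_src: "Delta (X * src L b) \<approx>\<^bsub>reg.dia\<^esub> fmap (\<lambda>(Y, Z). (Y * src L b, Z)) (Delta X)"
proof -
  have swap: "formal_mult (Delta X) = frag_extend (\<lambda>(c, d). fmap (\<lambda>(a, b). (a * c, b * d)) (Delta X))"
    unfolding formal_mult_def fmap_def case_prod_unfold
    by (intro ext) (rule frag_extend_swap)
  have hom: "tensor_hom reg.dia reg.dia (formal_mult (Delta X))"
    unfolding swap
  proof (rule reg.tensor_hom_dia; unfold prod.case)
    fix Y Y' Z Z' b
    show "fmap (\<lambda>(a, b). (a * (Y + Y'), b * Z)) (Delta X) \<approx>\<^bsub>reg.dia\<^esub>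
        fmap (\<lambda>(a, b). (a * Y, b * Z)) (Delta X) + fmap (\<lambda>(a, b). (a * Y', b * Z)) (Delta X)"
      unfolding fmap_def frag_extend_plus[symmetric]
      by (rule frag_extend_cong) (auto simp: distrib_left reg.dia_add_left)
    show "fmap (\<lambda>(a, b). (a * Y, b * (Z + Z'))) (Delta X) \<approx>\<^bsub>reg.dia\<^esub>
        fmap (\<lambda>(a, b). (a * Y, b * Z)) (Delta X) + fmap (\<lambda>(a, b). (a * Y, b * Z')) (Delta X)"
      unfolding fmap_def frag_extend_plus[symmetric]
      by (rule frag_extend_cong) (auto simp: distrib_left reg.dia_add_right)
    have hom: "tensor_hom reg.dia reg.dia (fmap (\<lambda>(U, V). (U * Y, V * Z)))"
      unfolding fmap_def
      by (rule reg.tensor_hom_dia) (use reg.dia_bal in \<open>auto simp: distrib_right mult.assoc intro: reg.dia_add_left reg.dia_add_right\<close>)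
    have "fmap (\<lambda>(U, V). (U * Y, V * Z)) (fmap (\<lambda>(U, V). (U * tgt L b, V)) (Delta X)) \<approx>\<^bsub>reg.dia\<^esub>
        fmap (\<lambda>(U, V). (U * Y, V * Z)) (fmap (\<lambda>(U, V). (U, V * src L b)) (Delta X))"
      using Delta_takeuchi_sums[of X] unfolding reg.takeuchi_sums_def by (intro tensor_hom_cong[OF hom]) simp
    then show "fmap (\<lambda>(a, b'). (a * (tgt L b * Y), b' * Z)) (Delta X) \<approx>\<^bsub>reg.dia\<^esub>
        fmap (\<lambda>(a, b'). (a * Y, b' * lact (regular L) b Z)) (Delta X)"
      by (simp add: frag_simps mult.assoc)
  qed
  have one: "Delta (src L b) \<approx>\<^bsub>reg.dia\<^esub> frag_of (src L b, 1)"
  proof -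
    have "Delta (src L b) \<approx>\<^bsub>reg.dia\<^esub> fmap (\<lambda>(Y, Z). (src L b * Y, Z)) (Delta 1)"
      using Delta_src[of b 1] by simp
    also have "\<dots> \<approx>\<^bsub>reg.dia\<^esub> fmap (\<lambda>(Y, Z). (src L b * Y, Z)) (frag_of (1, 1))"
      using rep_cls[of reg.dia "frag_of (1, 1)"]
      by (intro tensor_hom_cong[OF reg.dia_mult_src]) (simp add: coprod_one)
    finally show ?thesis
      by (simp add: fmap_def)
  qed
  have "Delta (X * src L b) \<approx>\<^bsub>reg.dia\<^esub> formal_mult (Delta X) (Delta (src L b))"
    using coprod_mult[of X "src L b"] rep_cls by metis
  also have "\<dots> \<approx>\<^bsub>reg.dia\<^esub> formal_mult (Delta X) (frag_of (src L b, 1))"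
    by (rule tensor_hom_cong[OF hom one])
  finally show ?thesis
    by (simp add: formal_mult_def fmap_def case_prod_unfold)
qed

text \<open>With this, facts about comodules and their canonical maps apply to \<open>L\<close> itself.\<close>

lemma left_comodule_regular: "left_comodule L (regular L)"
proof (intro left_comodule.intro left_comodule_axioms.intro reg.bimodule_axioms, simp_all)
  show "coprod L p \<in> takeuchi L (regular L)" for p
    by (rule coprod_takeuchi)
  show "coprod L (p + p') = cls (diamond_relators L (regular L)) (Delta p + Delta p')" for p p'
    by (rule coprod_add)
  show "induced (diamond3_relators L (regular L)) (coprod_left L) (coprod L p) =
      induced (diamond3_relators L (regular L)) (coact_right (regular L)) (coprod L p)" for p
    by (rule coprod_coassoc)
  show "eval_sum (lscale L) (\<lambda>(Y, q). src L (counit L Y) * q) (Delta p) = p" for p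
    by (rule counital_left)
  fix b p b'
  have "Delta (src L b * (p * src L b')) \<approx>\<^bsub>reg.dia\<^esub> fmap (\<lambda>(Y, Z). (src L b * Y, Z)) (Delta (p * src L b'))"
    by (rule Delta_src)
  also have "\<dots> \<approx>\<^bsub>reg.dia\<^esub> fmap (\<lambda>(Y, Z). (src L b * Y, Z)) (fmap (\<lambda>(Y, Z). (Y * src L b', Z)) (Delta p))"
    by (rule tensor_hom_cong[OF reg.dia_mult_src Delta_mult_src])
  finally have *: "Delta (src L b * (p * src L b')) \<approx>\<^bsub>reg.dia\<^esub> fmap (\<lambda>(Y, q). (src L b * Y * src L b', q)) (Delta p)"
    by (simp add: frag_simps mult.assoc)
  have "tensor_hom reg.dia reg.dia (fmap (\<lambda>(Y, q). (src L b * Y * src L b', q)))"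
    unfolding fmap_def
    by (rule reg.tensor_hom_dia)
      (auto simp: distrib_left distrib_right mult.assoc src_tgt_left_commute
        intro: reg.dia_add_left reg.dia_add_right reg.dia_bal[simplified])
  from tensor_hom_induced[OF this, of "Delta p"]
  show "coprod L (src L b * (p * src L b')) =
      induced (diamond_relators L (regular L)) (fmap (\<lambda>(Y, q). (src L b * Y * src L b', q))) (coprod L p)"
    unfolding coprod_eq_cls[symmetric] using * coprod_eq_cls by (metis cls_eq_iff)
qed

end

section \<open>Maps out of threefold tensor products\<close>

context left_bialgebroid
begin

text \<open>What is needed to apply \<open>h\<close> to the first factor of a tensor product whose relations move \<open>B\<close>-bar from
  that factor to the next one.\<close>

definition target_linear :: "('l \<times> 'l \<Rightarrow>\<^sub>0 int) set \<Rightarrow> ('l \<Rightarrow> 'l \<times> 'l \<Rightarrow>\<^sub>0 int) \<Rightarrow> bool" where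
  "target_linear S h \<longleftrightarrow> (\<forall>Y Y'. h (Y + Y') \<approx>\<^bsub>S\<^esub> h Y + h Y') \<and>
     (\<forall>c Y. h (tgt L c * Y) \<approx>\<^bsub>S\<^esub> fmap (\<lambda>(X, Z). (X, tgt L c * Z)) (h Y))"

definition attach :: "('l \<Rightarrow> 'l \<times> 'l \<Rightarrow>\<^sub>0 int) \<Rightarrow> ('l \<times> 'a \<Rightarrow>\<^sub>0 int) \<Rightarrow> ('l \<times> 'l \<times> 'a \<Rightarrow>\<^sub>0 int)" where
  "attach h = frag_extend (\<lambda>(Y, a). fmap (\<lambda>(X, Z). (X, Z, a)) (h Y))"

lemma target_linear_Delta: "target_linear reg.dia Delta"
  unfolding target_linear_def using Delta_add Delta_tgt by simp

lemma coprod_left_eq: "coprod_left L = attach Delta"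
  by (simp add: coprod_left_def attach_def)

text \<open>The factors of \<open>R\<close> are related through \<open>B\<close>-bar acting on the left one, so that target-linear maps can
  be applied to it. Both \<open>L \<diamondop>\<^sub>B G\<close> and \<open>L \<diamondop>\<^sub>B L \<diamondop>\<^sub>B G\<close> are of this kind, and stating the property
  abstractly allows threefold and fourfold tensor products to be treated at once.\<close>

definition extendable :: "('l \<times> 'a \<Rightarrow>\<^sub>0 int) set \<Rightarrow> bool" where
  "extendable R \<longleftrightarrow> (\<forall>S h. target_linear S h \<longrightarrow> tensor_hom R (triple_relators S R) (attach h))"

text \<open>The map \<open>X \<otimes> Y \<otimes> a \<mapsto> k\<^sub>1(Y) X \<otimes> k\<^sub>2(Y) \<otimes> a\<close>. For the coproduct it is \<open>\<mu> \<otimes> 1\<close>; for \<open>k(Y) = Y\<^sub>[\<^sub>-\<^sub>] \<otimes> Y\<^sub>[\<^sub>+\<^sub>]\<close>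
  it is the inverse of \<open>\<mu> \<otimes> 1\<close>.\<close>

definition twist :: "('l \<Rightarrow> 'l \<times> 'l \<Rightarrow>\<^sub>0 int) \<Rightarrow> ('l \<times> 'l \<times> 'a \<Rightarrow>\<^sub>0 int) \<Rightarrow> ('l \<times> 'l \<times> 'a \<Rightarrow>\<^sub>0 int)" where
  "twist k = frag_extend (\<lambda>(X, Y, a). fmap (\<lambda>(U, V). (U * X, V, a)) (k Y))"

definition twist_pair :: "('l \<Rightarrow> 'l \<times> 'l \<Rightarrow>\<^sub>0 int) \<Rightarrow> ('l \<times> 'l \<Rightarrow>\<^sub>0 int) \<Rightarrow> ('l \<times> 'l \<Rightarrow>\<^sub>0 int)" where
  "twist_pair k = frag_extend (\<lambda>(X, Y). fmap (\<lambda>(U, V). (U * X, V)) (k Y))"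

text \<open>Relations between the first two factors are respected by assumption. For the other relations \<open>X\<close> is
  fixed, and \<open>k\<close> followed by right multiplication with \<open>X\<close> on the first leg is again target-linear.\<close>

lemma twist_hom:
  fixes R :: "('l \<times> 'a \<Rightarrow>\<^sub>0 int) set"
  assumes k: "tensor_hom S S' (twist_pair k)" "target_linear S' k"
    and S': "\<And>X. tensor_hom S' S' (fmap (\<lambda>(U, V). (U * X, V)))"
    and R: "extendable R"
  shows "tensor_hom (triple_relators S R) (triple_relators S' R) (twist k)"
  unfolding twist_def
proof (rule tensor_hom_triple)
  fix a :: 'a
  have "frag_extend (\<lambda>(X, Y). case (X, Y, a) of (X, Y, a) \<Rightarrow> fmap (\<lambda>(U, V). (U * X, V, a)) (k Y)) =
      (\<lambda>x. fmap (\<lambda>(X, Y). (X, Y, a)) (twist_pair k x))"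
    by (simp add: twist_pair_def frag_simps fun_eq_iff)
  then show "tensor_hom S (triple_relators S' R)
      (frag_extend (\<lambda>(X, Y). case (X, Y, a) of (X, Y, a) \<Rightarrow> fmap (\<lambda>(U, V). (U * X, V, a)) (k Y)))"
    by (simp only:) (rule tensor_hom_comp[OF k(1) triple_left_hom])
next
  fix X
  let ?h = "\<lambda>Y. fmap (\<lambda>(U, V). (U * X, V)) (k Y)"
  have "target_linear S' ?h"
    unfolding target_linear_def
  proof (intro conjI allI)
    fix Y Y' c
    show "?h (Y + Y') \<approx>\<^bsub>S'\<^esub> ?h Y + ?h Y'"
      unfolding fmap_add[symmetric] using k(2) by (intro tensor_hom_cong[OF S']) (simp add: target_linear_def)
    have "?h (tgt L c * Y) \<approx>\<^bsub>S'\<^esub> fmap (\<lambda>(U, V). (U * X, V)) (fmap (\<lambda>(X, Z). (X, tgt L c * Z)) (k Y))"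
      using k(2) by (intro tensor_hom_cong[OF S']) (simp add: target_linear_def)
    then show "?h (tgt L c * Y) \<approx>\<^bsub>S'\<^esub> fmap (\<lambda>(X, Z). (X, tgt L c * Z)) (?h Y)"
      by (simp add: frag_simps)
  qed
  then have "tensor_hom R (triple_relators S' R) (attach ?h)"
    using R by (simp add: extendable_def)
  then show "tensor_hom R (triple_relators S' R)
      (frag_extend (\<lambda>(Y, q). case (X, Y, q) of (X, Y, a) \<Rightarrow> fmap (\<lambda>(U, V). (U * X, V, a)) (k Y)))"
    by (simp add: attach_def frag_simps)
qed

lemma twist_twist:
  assumes "\<And>X Y. twist_pair k' (twist_pair k (frag_of (X, Y))) \<approx>\<^bsub>S\<^esub> frag_of (X, Y)"
  shows "twist k' (twist k (x :: 'l \<times> 'l \<times> 'a \<Rightarrow>\<^sub>0 int)) \<approx>\<^bsub>triple_relators S R\<^esub> x"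
proof -
  have "twist k' (twist k x) \<approx>\<^bsub>triple_relators S R\<^esub> frag_extend frag_of x"
    unfolding twist_def frag_extend_frag_extend
  proof (rule frag_extend_cong)
    fix b :: "'l \<times> 'l \<times> 'a"
    obtain X Y a where b: "b = (X, Y, a)"
      by (cases b)
    have "fmap (\<lambda>(X, Y). (X, Y, a)) (twist_pair k' (twist_pair k (frag_of (X, Y)))) \<approx>\<^bsub>triple_relators S R\<^esub>
        fmap (\<lambda>(X, Y). (X, Y, a)) (frag_of (X, Y))"
      by (rule triple_left_cong[OF assms])
    then show "frag_extend (\<lambda>(X, Y, a). fmap (\<lambda>(U, V). (U * X, V, a)) (k' Y))
        (case b of (X, Y, a) \<Rightarrow> fmap (\<lambda>(U, V). (U * X, V, a)) (k Y)) \<approx>\<^bsub>triple_relators S R\<^esub> frag_of b"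
      by (simp add: b twist_pair_def frag_simps)
  qed
  then show ?thesis
    by (simp add: frag_extend_ident)
qed

end

lemma (in bialgebroid_bimodule) extendable_dia: "extendable dia"
  unfolding extendable_def attach_def
proof (intro allI impI)
  fix S h assume h: "target_linear S h"
  let ?T = "triple_relators S dia"
  show "tensor_hom dia ?T (frag_extend (\<lambda>(Y, a). fmap (\<lambda>(X, Z). (X, Z, a)) (h Y)))"
  proof (rule tensor_hom_dia; unfold prod.case)
    fix Y Y' q q' b
    show "fmap (\<lambda>(X, Z). (X, Z, q)) (h (Y + Y')) \<approx>\<^bsub>?T\<^esub>
        fmap (\<lambda>(X, Z). (X, Z, q)) (h Y) + fmap (\<lambda>(X, Z). (X, Z, q)) (h Y')"
      unfolding fmap_add[symmetric] using h by (intro triple_left_cong) (simp add: target_linear_def)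
    show "fmap (\<lambda>(X, Z). (X, Z, q + q')) (h Y) \<approx>\<^bsub>?T\<^esub>
        fmap (\<lambda>(X, Z). (X, Z, q)) (h Y) + fmap (\<lambda>(X, Z). (X, Z, q')) (h Y)"
      unfolding fmap_def frag_extend_plus[symmetric]
    proof (rule frag_extend_cong)
      fix a :: "'l \<times> 'l"
      show "frag_of (case a of (X, Z) \<Rightarrow> (X, Z, q + q')) \<approx>\<^bsub>?T\<^esub>
          frag_of (case a of (X, Z) \<Rightarrow> (X, Z, q)) + frag_of (case a of (X, Z) \<Rightarrow> (X, Z, q'))"
        using triple_right_cong[where X = "fst a" and S = S, OF dia_add_right[of "snd a" q q']] by (simp add: case_prod_unfold fmap_add)
    qed
    have "fmap (\<lambda>(X, Z). (X, Z, q)) (h (tgt L b * Y)) \<approx>\<^bsub>?T\<^esub>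
        fmap (\<lambda>(X, Z). (X, Z, q)) (fmap (\<lambda>(X, Z). (X, tgt L b * Z)) (h Y))"
      using h by (intro triple_left_cong) (simp add: target_linear_def)
    also have "\<dots> \<approx>\<^bsub>?T\<^esub> fmap (\<lambda>(X, Z). (X, Z, lact G b q)) (h Y)"
      unfolding fmap_def frag_extend_frag_extend
    proof (rule frag_extend_cong)
      fix a :: "'l \<times> 'l"
      show "frag_extend (\<lambda>a. frag_of (case a of (X, Z) \<Rightarrow> (X, Z, q))) (frag_of (case a of (X, Z) \<Rightarrow> (X, tgt L b * Z)))
          \<approx>\<^bsub>?T\<^esub> frag_of (case a of (X, Z) \<Rightarrow> (X, Z, lact G b q))"
        using triple_right_cong[where X = "fst a" and S = S, OF dia_bal[of b "snd a" q]] by (simp add: case_prod_unfold)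
    qed
    finally show "fmap (\<lambda>(X, Z). (X, Z, q)) (h (tgt L b * Y)) \<approx>\<^bsub>?T\<^esub> fmap (\<lambda>(X, Z). (X, Z, lact G b q)) (h Y)" .
  qed
qed

context bialgebroid_bimodule
begin

abbreviation "dia3 \<equiv> diamond3_relators L G"

lemma dia3_eq: "dia3 = triple_relators reg.dia dia"
  by (simp add: diamond3_relators_def)

lemma append_hom:
  "tensor_hom (triple_relators S reg.dia) (triple_relators S dia3) (fmap (\<lambda>(X, Y, Z). (X, Y, Z, q)))"
  unfolding fmap_def
proof (rule tensor_hom_triple)
  fix Z
  show "tensor_hom S (triple_relators S dia3) (frag_extend (\<lambda>(X, Y). frag_of (case (X, Y, Z) of (X, Y, Z) \<Rightarrow> (X, Y, Z, q))))"
    using triple_left_hom[of S dia3 "(Z, q)"] by (simp add: fmap_def case_prod_unfold)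
next
  fix X
  show "tensor_hom reg.dia (triple_relators S dia3) (frag_extend (\<lambda>(Y, Z). frag_of (case (X, Y, Z) of (X, Y, Z) \<Rightarrow> (X, Y, Z, q))))"
    using tensor_hom_comp[OF triple_left_hom[of reg.dia dia q] triple_right_hom[of dia3 S X, unfolded dia3_eq]]
    by (simp add: frag_simps dia3_eq)
qed

lemma extendable_dia3: "extendable dia3"
  unfolding extendable_def
proof (intro allI impI)
  fix S h assume h: "target_linear S h"
  let ?T = "triple_relators S (triple_relators reg.dia dia)"
  have "tensor_hom (triple_relators reg.dia dia) ?T (frag_extend (\<lambda>(Y, a). fmap (\<lambda>(X, Z). (X, Z, a)) (h Y)))"
  proof (rule tensor_hom_triple)
    fix q
    have "tensor_hom reg.dia (triple_relators S reg.dia) (attach h)"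
      using reg.extendable_dia h by (simp add: extendable_def)
    from tensor_hom_comp[OF this append_hom[of S q]]
    show "tensor_hom reg.dia ?T (frag_extend (\<lambda>(X, Y). case (X, Y, q) of (Y, a) \<Rightarrow> fmap (\<lambda>(X, Z). (X, Z, a)) (h Y)))"
      by (simp add: attach_def frag_simps dia3_eq)
  next
    fix Y
    show "tensor_hom dia ?T (frag_extend (\<lambda>(Z, q). case (Y, Z, q) of (Y, a) \<Rightarrow> fmap (\<lambda>(X, Z). (X, Z, a)) (h Y)))"
    proof (rule tensor_hom_frag_extend)
      fix r assume r: "r \<in> dia"
      have "frag_extend (\<lambda>(Z, q). case (Y, Z, q) of (Y, a) \<Rightarrow> fmap (\<lambda>(X, Z). (X, Z, a)) (h Y)) r =
          frag_extend (\<lambda>a. fmap (\<lambda>(Y, q). (fst a, Y, q)) (fmap (\<lambda>(Y, q). (snd a, Y, q)) r)) (h Y)"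
        unfolding frag_simps prod.case by (subst frag_extend_swap) simp
      also have "\<dots> \<in> add_span ?T"
        using r by (intro frag_extend_mem_span triple_right add_span.gen)
      finally show "frag_extend (\<lambda>(Z, q). case (Y, Z, q) of (Y, a) \<Rightarrow> fmap (\<lambda>(X, Z). (X, Z, a)) (h Y)) r \<in> add_span ?T" .
    qed
  qed
  then show "tensor_hom dia3 (triple_relators S dia3) (attach h)"
    by (simp add: dia3_eq attach_def)
qed

section \<open>The counit on tensor products with a bimodule\<close>

definition eps :: "('l \<times> 'p \<Rightarrow>\<^sub>0 int) \<Rightarrow> 'p" where
  "eps = eval_sum (mscale G) (\<lambda>(Y, q). lact G (counit L Y) q)"

lemma eps_diff: "eps (x - y) = eps x - eps y"
  and eps_frag_of [simp]: "eps (frag_of (Y, q)) = lact G (counit L Y) q"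
  by (simp_all add: eps_def eval_sum_diff)

lemma ract_zero: "ract G q 0 = 0" "ract G 0 b = 0"
  using ract_add_right[of q 0 0] ract_add_left[of 0 0 b] by auto

lemma ract_diff: "ract G (x - y) b = ract G x b - ract G y b"
  using ract_add_left[of "x - y" y b] by simp

lemma counit_src: "counit L (src L b * X) = b * counit L X"
  and counit_tgt: "counit L (tgt L b * X) = counit L X * b"
  using counit_bimodule[of b 1 X] counit_bimodule[of 1 b X] by (simp_all add: src_one tgt_one)

lemma eps_zero [simp]: "eps 0 = 0"
  using eps_diff[of 0 0] by simp

lemma eps_span:
  assumes "x \<in> add_span dia"
  shows "eps x = 0"
  using assms
proof induction
  case (gen x)
  then show ?case
    by (cases rule: dia_cases)
      (auto simp: eps_diff lact_add_left lact_add_right counit_add counit_tgt lact_mult)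
qed (auto simp: eps_diff)

lemma eps_cong: "x \<approx>\<^bsub>dia\<^esub> y \<Longrightarrow> eps x = eps y"
  unfolding cong_span_def using eps_span[of "x - y"] by (simp add: eps_diff)

lemma eps_additive_extend:
  assumes "\<And>p p'. f (p - p') \<approx>\<^bsub>R\<^esub> f p - f p'"
  shows "frag_extend (\<lambda>(Y, q). f (lact G (counit L Y) q)) \<xi> \<approx>\<^bsub>R\<^esub> f (eps \<xi>)"
proof (rule frag_induction[of \<xi> UNIV])
  have "f 0 \<approx>\<^bsub>R\<^esub> 0"
    using assms[of 0 0] by simp
  then show "frag_extend (\<lambda>(Y, q). f (lact G (counit L Y) q)) 0 \<approx>\<^bsub>R\<^esub> f (eps 0)"
    by (simp add: cong_sym)
  fix x y
  assume *: "frag_extend (\<lambda>(Y, q). f (lact G (counit L Y) q)) x \<approx>\<^bsub>R\<^esub> f (eps x)"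
    "frag_extend (\<lambda>(Y, q). f (lact G (counit L Y) q)) y \<approx>\<^bsub>R\<^esub> f (eps y)"
  show "frag_extend (\<lambda>(Y, q). f (lact G (counit L Y) q)) (x - y) \<approx>\<^bsub>R\<^esub> f (eps (x - y))"
    using cong_trans[OF cong_diff[OF *] cong_sym[OF assms]] by (simp add: frag_extend_diff eps_diff)
qed auto

text \<open>The counit satisfies \<open>\<epsilon>(Y b) = \<epsilon>(Y b\<close>-bar\<open>)\<close>, and the Takeuchi condition moves \<open>b\<close>-bar to the right
  action on \<open>G\<close>. This is why \<open>1 \<otimes> \<epsilon>\<close> makes sense on \<open>L \<otimes>\<^sup>B (L \<times>\<^sub>B G)\<close>.\<close>

lemma eps_act:
  assumes "\<xi> \<in> takeuchi_sums"
  shows "eps (fmap (\<lambda>(Y, q). (Y * src L b, q)) \<xi>) = ract G (eps \<xi>) b"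
proof -
  have "eps (fmap (\<lambda>(Y, q). (Y * src L b, q)) x) = eps (fmap (\<lambda>(Y, q). (Y * tgt L b, q)) x)" for x
  proof (rule frag_induction[of x UNIV])
    have "counit L (src L b) = b" "counit L (tgt L b) = b"
      using counit_src[of b 1] counit_tgt[of b 1] counit_one by auto
    then have "counit L (Y * src L b) = counit L (Y * tgt L b)" for Y
      using counit_mult_src[of Y "src L b"] counit_mult_tgt[of Y "src L b"] by simp
    then show "eps (fmap (\<lambda>(Y, q). (Y * src L b, q)) (frag_of a)) = eps (fmap (\<lambda>(Y, q). (Y * tgt L b, q)) (frag_of a))" for a
      by (cases a) simp
  qed (auto simp: fmap_diff eps_diff)
  also have "eps (fmap (\<lambda>(Y, q). (Y * tgt L b, q)) \<xi>) = eps (fmap (\<lambda>(Y, q). (Y, ract G q b)) \<xi>)"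
    using assms by (intro eps_cong) (simp add: takeuchi_sums_def)
  also have "eps (fmap (\<lambda>(Y, q). (Y, ract G q b)) x) = ract G (eps x) b" for x
  proof (rule frag_induction[of x UNIV])
    show "eps (fmap (\<lambda>(Y, q). (Y, ract G q b)) (frag_of a)) = ract G (eps (frag_of a)) b" for a
      by (cases a) (simp add: lact_ract)
  qed (auto simp: fmap_diff eps_diff ract_diff ract_zero)
  finally show ?thesis .
qed

end

section \<open>Comodules and the canonical map\<close>

locale bialgebroid_comodule = left_bialgebroid L + left_comodule L G
  for L :: "('k::field, 'b::{ring,monoid_mult}, 'l::{ring,monoid_mult}) bialgebroid"
    and G :: "('k, 'b, 'p::ab_group_add, 'l) comod"

sublocale bialgebroid_comodule \<subseteq> bialgebroid_bimodule L G
  by unfold_locales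

sublocale left_bialgebroid \<subseteq> reg: bialgebroid_comodule L "regular L"
  by (intro bialgebroid_comodule.intro left_comodule_regular left_bialgebroid_axioms)

context bialgebroid_comodule
begin

abbreviation "delta p \<equiv> rep (coact G p)"

lemma coact_eq_cls: "coact G p = cls dia (delta p)"
  using coact_takeuchi cls_rep by (fastforce simp: takeuchi_def)

lemma delta_takeuchi_sums: "delta p \<in> takeuchi_sums"
  using coact_takeuchi coact_eq_cls takeuchi_iff by metis

lemma delta_add: "delta (p + p') \<approx>\<^bsub>dia\<^esub> delta p + delta p'"
  using coact_add[of p p'] rep_cls by metis

lemma delta_diff: "delta (p - p') \<approx>\<^bsub>dia\<^esub> delta p - delta p'"
  using cong_diff[OF cong_sym[OF delta_add[of "p - p'" p']] cong_refl[of "delta p'"]] by simp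

lemma delta_bimodule:
  "delta (lact G b (ract G p b')) \<approx>\<^bsub>dia\<^esub> fmap (\<lambda>(Y, q). (src L b * Y * src L b', q)) (delta p)"
proof -
  have "tensor_hom dia dia (fmap (\<lambda>(Y, q). (src L b * Y * src L b', q)))"
    unfolding fmap_def
    by (rule tensor_hom_dia)
      (auto simp: distrib_left distrib_right mult.assoc src_tgt_left_commute
        intro: dia_add_left dia_add_right dia_bal)
  from tensor_hom_induced[OF this, of "delta p"] show ?thesis
    using coact_bimodule[of b p b'] coact_eq_cls by (metis cls_eq_iff)
qed

lemma delta_lact: "delta (lact G b p) \<approx>\<^bsub>dia\<^esub> fmap (\<lambda>(Y, q). (src L b * Y, q)) (delta p)"
  using delta_bimodule[of b p 1] by (simp add: ract_one src_one)

lemma delta_ract: "delta (ract G p b) \<approx>\<^bsub>dia\<^esub> fmap (\<lambda>(Y, q). (Y * src L b, q)) (delta p)"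
  using delta_bimodule[of 1 p b] by (simp add: lact_one src_one)

lemma eps_delta: "eps (delta p) = p"
  unfolding eps_def by (rule coact_counit)

lemma coprod_left_hom: "tensor_hom dia dia3 (coprod_left L)"
  using extendable_dia target_linear_Delta unfolding extendable_def coprod_left_eq dia3_eq by blast

lemma coact_right_frag_of [simp]: "coact_right G (frag_of (X, p)) = fmap (\<lambda>(Y, q). (X, Y, q)) (delta p)"
  by (simp add: coact_right_def)

lemma coact_right_add_left:
  assumes "\<And>X X' Y. frag_of (X + X', Y) \<approx>\<^bsub>S\<^esub> frag_of (X, Y) + frag_of (X', Y)"
  shows "fmap (\<lambda>(Y, q). (X + X', Y, q)) (delta p) \<approx>\<^bsub>triple_relators S dia\<^esub>
      fmap (\<lambda>(Y, q). (X, Y, q)) (delta p) + fmap (\<lambda>(Y, q). (X', Y, q)) (delta p)"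
  unfolding fmap_def frag_extend_plus[symmetric]
proof (rule frag_extend_cong)
  fix a
  show "frag_of (case a of (Y, q) \<Rightarrow> (X + X', Y, q)) \<approx>\<^bsub>triple_relators S dia\<^esub>
    frag_of (case a of (Y, q) \<Rightarrow> (X, Y, q)) + frag_of (case a of (Y, q) \<Rightarrow> (X', Y, q))"
    using triple_left_cong[where q = "snd a" and R = dia, OF assms(1)[of X X' "fst a"]] by (simp add: case_prod_unfold fmap_add)
qed

lemma coact_right_add_right:
  "fmap (\<lambda>(Y, q). (X, Y, q)) (delta (p + p')) \<approx>\<^bsub>triple_relators S dia\<^esub>
      fmap (\<lambda>(Y, q). (X, Y, q)) (delta p) + fmap (\<lambda>(Y, q). (X, Y, q)) (delta p')"
  unfolding fmap_add[symmetric] by (rule triple_right_cong[OF delta_add])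

lemma coact_right_balanced:
  assumes "\<And>X Y. frag_of (f X, Y) \<approx>\<^bsub>S\<^esub> frag_of (X, g Y)"
    and "delta p' \<approx>\<^bsub>dia\<^esub> fmap (\<lambda>(Y, q). (g Y, q)) (delta p)"
  shows "fmap (\<lambda>(Y, q). (f X, Y, q)) (delta p) \<approx>\<^bsub>triple_relators S dia\<^esub>
      fmap (\<lambda>(Y, q). (X, Y, q)) (delta p')"
proof -
  have "fmap (\<lambda>(Y, q). (f X, Y, q)) (delta p) \<approx>\<^bsub>triple_relators S dia\<^esub>
      fmap (\<lambda>(Y, q). (X, Y, q)) (fmap (\<lambda>(Y, q). (g Y, q)) (delta p))"
    unfolding fmap_def frag_extend_frag_extend
  proof (rule frag_extend_cong)
    fix a
    show "frag_of (case a of (Y, q) \<Rightarrow> (f X, Y, q)) \<approx>\<^bsub>triple_relators S dia\<^esub>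
      frag_extend (\<lambda>a. frag_of (case a of (Y, q) \<Rightarrow> (X, Y, q))) (frag_of (case a of (Y, q) \<Rightarrow> (g Y, q)))"
      using triple_left_cong[where q = "snd a" and R = dia, OF assms(1)[of X "fst a"]] by (simp add: case_prod_unfold)
  qed
  also have "\<dots> \<approx>\<^bsub>triple_relators S dia\<^esub> fmap (\<lambda>(Y, q). (X, Y, q)) (delta p')"
    by (rule triple_right_cong[OF cong_sym[OF assms(2)]])
  finally show ?thesis .
qed

lemma coact_right_dia: "tensor_hom dia dia3 (coact_right G)"
  unfolding coact_right_def dia3_eq
proof (rule tensor_hom_dia; unfold prod.case)
  show "fmap (\<lambda>(Y, q). (tgt L b * X, Y, q)) (delta p) \<approx>\<^bsub>triple_relators reg.dia dia\<^esub>
      fmap (\<lambda>(Y, q). (X, Y, q)) (delta (lact G b p))" for b X p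
    by (rule coact_right_balanced[OF _ delta_lact]) (use reg.dia_bal in simp)
qed (intro coact_right_add_left coact_right_add_right reg.dia_add_left)+

lemma coact_right_ups: "tensor_hom ups (mixed_relators L G) (coact_right G)"
  unfolding coact_right_def mixed_relators_def
proof (rule tensor_hom_ups; unfold prod.case)
  show "fmap (\<lambda>(Y, q). (src L b * X, Y, q)) (delta p) \<approx>\<^bsub>triple_relators reg.ups dia\<^esub>
      fmap (\<lambda>(Y, q). (X, Y, q)) (delta (ract G p b))" for b X p
    by (rule coact_right_balanced[OF _ delta_ract]) (use reg.ups_bal in simp)
qed (intro coact_right_add_left coact_right_add_right reg.ups_add_left)+

lemma coassociative: "coprod_left L (delta p) \<approx>\<^bsub>dia3\<^esub> coact_right G (delta p)"
  using coassoc[of p] tensor_hom_induced[OF coprod_left_hom, of "delta p"]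
    tensor_hom_induced[OF coact_right_dia, of "delta p"]
  by (simp flip: coact_eq_cls add: cls_eq_iff)

text \<open>The canonical map on formal sums.\<close>

definition canon :: "('l \<times> 'p \<Rightarrow>\<^sub>0 int) \<Rightarrow> ('l \<times> 'p \<Rightarrow>\<^sub>0 int)" where
  "canon = frag_extend (\<lambda>(X, p). fmap (\<lambda>(Y, q). (Y * X, q)) (delta p))"

lemma canon_hom: "tensor_hom ups dia canon"
  unfolding canon_def
proof (rule tensor_hom_ups; unfold prod.case)
  fix X X' p p' b
  show "fmap (\<lambda>(Y, q). (Y * (X + X'), q)) (delta p) \<approx>\<^bsub>dia\<^esub>
      fmap (\<lambda>(Y, q). (Y * X, q)) (delta p) + fmap (\<lambda>(Y, q). (Y * X', q)) (delta p)"
    unfolding fmap_def frag_extend_plus[symmetric]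
    by (rule frag_extend_cong) (auto simp: distrib_left dia_add_left)
  show "fmap (\<lambda>(Y, q). (Y * X, q)) (delta (p + p')) \<approx>\<^bsub>dia\<^esub>
      fmap (\<lambda>(Y, q). (Y * X, q)) (delta p) + fmap (\<lambda>(Y, q). (Y * X, q)) (delta p')"
    unfolding fmap_add[symmetric] by (rule tensor_hom_cong[OF dia_mult_right delta_add])
  have "fmap (\<lambda>(Y, q). (Y * X, q)) (fmap (\<lambda>(Y, q). (Y * src L b, q)) (delta p)) \<approx>\<^bsub>dia\<^esub>
      fmap (\<lambda>(Y, q). (Y * X, q)) (delta (ract G p b))"
    by (rule tensor_hom_cong[OF dia_mult_right cong_sym[OF delta_ract]])
  then show "fmap (\<lambda>(Y, q). (Y * (src L b * X), q)) (delta p) \<approx>\<^bsub>dia\<^esub>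
      fmap (\<lambda>(Y, q). (Y * X, q)) (delta (ract G p b))"
    by (simp add: frag_simps mult.assoc)
qed

lemma canonical_map_cls: "canonical_map L G (cls ups x) = cls dia (canon x)"
  using tensor_hom_induced[OF canon_hom] by (simp add: canonical_map_def canon_def)

end

section \<open>Iterated tensor products as tensor products of right modules\<close>

context left_bialgebroid
begin

text \<open>The right action of \<open>B\<close> through \<open>src\<close> on the first factor. It makes \<open>L \<diamondop>\<^sub>B G\<close> and \<open>L \<diamondop>\<^sub>B L \<diamondop>\<^sub>B G\<close> right
  modules, to which \<open>L \<otimes>\<^sup>B -\<close> is applied.\<close>

definition rmul :: "('l \<times> 'a \<Rightarrow>\<^sub>0 int) \<Rightarrow> 'b \<Rightarrow> ('l \<times> 'a \<Rightarrow>\<^sub>0 int)" where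
  "rmul \<xi> b = fmap (\<lambda>(Y, a). (Y * src L b, a)) \<xi>"

lemma rmul_diff: "rmul (\<xi> - \<xi>') b = rmul \<xi> b - rmul \<xi>' b"
  by (simp add: rmul_def fmap_diff)

definition right_stable :: "('l \<times> 'a \<Rightarrow>\<^sub>0 int) set \<Rightarrow> bool" where
  "right_stable R \<longleftrightarrow> (\<forall>Y Y' a. frag_of (Y + Y', a) \<approx>\<^bsub>R\<^esub> frag_of (Y, a) + frag_of (Y', a)) \<and>
     (\<forall>b. tensor_hom R R (\<lambda>\<xi>. rmul \<xi> b))"

lemma rmul_presented_module:
  assumes R: "right_stable R"
    and A: "0 \<in> A" "\<And>\<xi> \<xi>'. \<xi> \<in> A \<Longrightarrow> \<xi>' \<in> A \<Longrightarrow> \<xi> - \<xi>' \<in> A" "\<And>\<xi> b. \<xi> \<in> A \<Longrightarrow> rmul \<xi> b \<in> A"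
  shows "presented_module A R rmul"
proof
  fix \<xi> :: "'l \<times> 'a \<Rightarrow>\<^sub>0 int" and b b' assume "\<xi> \<in> A"
  show "rmul \<xi> (b + b') \<approx>\<^bsub>R\<^esub> rmul \<xi> b + rmul \<xi> b'"
    unfolding rmul_def fmap_def frag_extend_plus[symmetric]
    using R by (intro frag_extend_cong) (auto simp: right_stable_def src_add distrib_left)
  show "rmul \<xi> (b * b') \<approx>\<^bsub>R\<^esub> rmul (rmul \<xi> b) b'"
    by (simp add: rmul_def frag_simps src_mult mult.assoc)
  show "rmul \<xi> 1 \<approx>\<^bsub>R\<^esub> \<xi>"
    by (simp add: rmul_def src_one fmap_id)
  show "rmul \<xi> b \<in> add_span R" if "\<xi> \<in> add_span R"
    using R that tensor_hom_span unfolding right_stable_def by blast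
qed (auto simp: A, simp add: rmul_def fmap_add)

lemmas rmul_presented_module_UNIV = rmul_presented_module[OF _ UNIV_I UNIV_I UNIV_I]

abbreviation bal :: "'n::ab_group_add set \<Rightarrow> 'n set \<Rightarrow> ('n \<Rightarrow> 'b \<Rightarrow> 'n) \<Rightarrow> ('l \<times> 'n \<Rightarrow>\<^sub>0 int) set" where
  "bal \<equiv> balanced_relators (\<lambda>b X. src L b * X)"

text \<open>Together with \<open>nest\<close> this identifies \<open>L \<otimes>\<^sup>B (L \<otimes> \<dots>)\<close>, formed as the tensor product with a presented
  right module, with the threefold tensor product of formal sums of triples.\<close>

definition unnest :: "('l \<times> ('l \<times> 'a \<Rightarrow>\<^sub>0 int) \<Rightarrow>\<^sub>0 int) \<Rightarrow> ('l \<times> 'l \<times> 'a \<Rightarrow>\<^sub>0 int)" where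
  "unnest = frag_extend (\<lambda>(X, \<xi>). fmap (\<lambda>(Y, a). (X, Y, a)) \<xi>)"

definition nest :: "('l \<times> 'l \<times> 'a \<Rightarrow>\<^sub>0 int) \<Rightarrow> ('l \<times> ('l \<times> 'a \<Rightarrow>\<^sub>0 int) \<Rightarrow>\<^sub>0 int)" where
  "nest = fmap (\<lambda>(X, Y, a). (X, frag_of (Y, a)))"

lemma unnest_nest: "unnest (nest x) = x"
  by (simp add: unnest_def nest_def frag_simps)

lemma bal_zero_right: "frag_of (X, 0) \<approx>\<^bsub>bal UNIV R f\<^esub> 0"
  by (simp add: cong_zero_iff balanced_null add_span.zero)

lemma bal_diff_right: "frag_of (X, \<xi> - \<xi>') \<approx>\<^bsub>bal UNIV R f\<^esub> frag_of (X, \<xi>) - frag_of (X, \<xi>')"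
proof -
  have "frag_of (X, (\<xi> - \<xi>') + \<xi>') \<approx>\<^bsub>bal UNIV R f\<^esub> frag_of (X, \<xi> - \<xi>') + frag_of (X, \<xi>')"
    by (rule balanced_add_right) auto
  from cong_diff[OF cong_sym[OF this] cong_refl[of "frag_of (X, \<xi>')"]] show ?thesis
    by simp
qed

lemma bal_expand: "frag_extend (\<lambda>a. frag_of (X, frag_of a)) \<xi> \<approx>\<^bsub>bal UNIV R f\<^esub> frag_of (X, \<xi>)"
proof (rule frag_induction[of \<xi> UNIV])
  fix x y
  assume *: "frag_extend (\<lambda>a. frag_of (X, frag_of a)) x \<approx>\<^bsub>bal UNIV R f\<^esub> frag_of (X, x)"
    "frag_extend (\<lambda>a. frag_of (X, frag_of a)) y \<approx>\<^bsub>bal UNIV R f\<^esub> frag_of (X, y)"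
  show "frag_extend (\<lambda>a. frag_of (X, frag_of a)) (x - y) \<approx>\<^bsub>bal UNIV R f\<^esub> frag_of (X, x - y)"
    using cong_trans[OF cong_diff[OF *] cong_sym[OF bal_diff_right]] by (simp add: frag_extend_diff)
qed (auto simp: cong_sym[OF bal_zero_right])

lemma nest_hom:
  fixes R :: "('l \<times> 'a \<Rightarrow>\<^sub>0 int) set"
  assumes R: "right_stable R"
  shows "tensor_hom (triple_relators reg.ups R) (bal UNIV R rmul) nest"
  unfolding nest_def fmap_def
proof (rule tensor_hom_triple)
  interpret R: presented_module UNIV R rmul
    by (rule rmul_presented_module_UNIV[OF R])
  fix a :: 'a
  show "tensor_hom reg.ups (bal UNIV R rmul)
      (frag_extend (\<lambda>(X, Y). frag_of (case (X, Y, a) of (X, Y, a) \<Rightarrow> (X, frag_of (Y, a)))))"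
  proof (rule reg.tensor_hom_ups; unfold prod.case)
    fix X X' Y Y' b
    show "frag_of (X + X', frag_of (Y, a)) \<approx>\<^bsub>bal UNIV R rmul\<^esub>
        frag_of (X, frag_of (Y, a)) + frag_of (X', frag_of (Y, a))"
      by (rule balanced_add_left) simp
    have "frag_of (X, frag_of (Y + Y', a)) \<approx>\<^bsub>bal UNIV R rmul\<^esub> frag_of (X, frag_of (Y, a) + frag_of (Y', a))"
      using R by (intro R.balanced_cong) (auto simp: right_stable_def)
    also have "\<dots> \<approx>\<^bsub>bal UNIV R rmul\<^esub> frag_of (X, frag_of (Y, a)) + frag_of (X, frag_of (Y', a))"
      by (rule balanced_add_right) auto
    finally show "frag_of (X, frag_of (Y + Y', a)) \<approx>\<^bsub>bal UNIV R rmul\<^esub> \<dots>" .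
    show "frag_of (src L b * X, frag_of (Y, a)) \<approx>\<^bsub>bal UNIV R rmul\<^esub>
        frag_of (X, frag_of (ract (regular L) Y b, a))"
      using balanced_act[of "frag_of (Y, a)" UNIV "\<lambda>b X. src L b * X" b X R rmul] by (simp add: rmul_def)
  qed
next
  fix X
  show "tensor_hom R (bal UNIV R rmul)
      (frag_extend (\<lambda>(Y, q). frag_of (case (X, Y, q) of (X, Y, a) \<Rightarrow> (X, frag_of (Y, a)))))"
  proof (rule tensor_hom_frag_extend)
    fix r assume "r \<in> R"
    then have "frag_of (X, r) \<in> add_span (bal UNIV R rmul)"
      by (intro balanced_null add_span.gen) auto
    then show "frag_extend (\<lambda>(Y, q). frag_of (case (X, Y, q) of (X, Y, a) \<Rightarrow> (X, frag_of (Y, a)))) r \<in> add_span (bal UNIV R rmul)"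
      using span_cong[OF bal_expand[of X r R rmul]] by (simp add: case_prod_unfold)
  qed
qed

lemma unnest_hom: "tensor_hom (bal UNIV R rmul) (triple_relators reg.ups R) unnest"
  unfolding unnest_def
proof (rule tensor_hom_frag_extend)
  fix r :: "'l \<times> ('l \<times> 'a \<Rightarrow>\<^sub>0 int) \<Rightarrow>\<^sub>0 int"
  let ?h = "\<lambda>X. fmap (\<lambda>(Y, a). (X, Y, a))" and ?T = "triple_relators reg.ups R"
  assume "r \<in> bal UNIV R rmul"
  then consider
      (left) X X' \<xi> where "r = frag_of (X + X', \<xi>) - frag_of (X, \<xi>) - frag_of (X', \<xi>)"
    | (right) X \<xi> \<xi>' where "r = frag_of (X, \<xi> + \<xi>') - frag_of (X, \<xi>) - frag_of (X, \<xi>')"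
    | (act) b X \<xi> where "r = frag_of (src L b * X, \<xi>) - frag_of (X, rmul \<xi> b)"
    | (null) X \<xi> where "r = frag_of (X, \<xi>)" "\<xi> \<in> add_span R"
    unfolding balanced_relators_def by auto
  then show "frag_extend (\<lambda>(X, \<xi>). ?h X \<xi>) r \<in> add_span ?T"
  proof cases
    case left
    have "?h (X + X') \<xi> \<approx>\<^bsub>?T\<^esub> ?h X \<xi> + ?h X' \<xi>"
      unfolding fmap_def frag_extend_plus[symmetric]
    proof (rule frag_extend_cong)
      fix a :: "'l \<times> 'a"
      show "frag_of (case a of (Y, a) \<Rightarrow> (X + X', Y, a)) \<approx>\<^bsub>?T\<^esub>
          frag_of (case a of (Y, a) \<Rightarrow> (X, Y, a)) + frag_of (case a of (Y, a) \<Rightarrow> (X', Y, a))"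
        using triple_left_cong[OF reg.ups_add_left[of X X' "fst a"], of "snd a" R] by (simp add: case_prod_unfold fmap_add)
    qed
    then show ?thesis
      by (simp add: left frag_extend_diff frag_extend_add cong_span_def diff_diff_eq)
  next
    case right
    then show ?thesis
      by (simp add: frag_extend_diff fmap_add add_span.zero)
  next
    case act
    have "?h (src L b * X) \<xi> \<approx>\<^bsub>?T\<^esub> ?h X (rmul \<xi> b)"
      unfolding fmap_def rmul_def frag_extend_frag_extend
    proof (rule frag_extend_cong)
      fix a :: "'l \<times> 'a"
      show "frag_of (case a of (Y, a) \<Rightarrow> (src L b * X, Y, a)) \<approx>\<^bsub>?T\<^esub>
          frag_extend (\<lambda>a. frag_of (case a of (Y, a) \<Rightarrow> (X, Y, a))) (frag_of (case a of (Y, a) \<Rightarrow> (Y * src L b, a)))"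
        using triple_left_cong[OF reg.ups_bal[of b X "fst a"], of "snd a" R] by (simp add: case_prod_unfold)
    qed
    then show ?thesis
      by (simp add: act frag_extend_diff cong_span_def)
  next
    case null
    then show ?thesis
      using triple_right[of \<xi> R X reg.ups] by simp
  qed
qed

text \<open>The map \<open>1 \<otimes> F\<close>.\<close>

definition lift :: "(('l \<times> 'a \<Rightarrow>\<^sub>0 int) \<Rightarrow> ('l \<times> 'c \<Rightarrow>\<^sub>0 int)) \<Rightarrow> ('l \<times> 'l \<times> 'a \<Rightarrow>\<^sub>0 int) \<Rightarrow> ('l \<times> 'l \<times> 'c \<Rightarrow>\<^sub>0 int)" where
  "lift F = frag_extend (\<lambda>(X, a). fmap (\<lambda>(Y, c). (X, Y, c)) (F (frag_of a)))"

lemma lift_one: "lift (frag_extend f) (fmap (\<lambda>(Y, q). (1, Y, q)) \<xi>) = fmap (\<lambda>(Y, c). (1, Y, c)) (frag_extend f \<xi>)"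
  by (simp add: lift_def frag_simps)

lemma lift_hom:
  assumes "\<And>q. tensor_hom S (triple_relators S R') (frag_extend (\<lambda>(X, Y). fmap (\<lambda>(Z, c). (X, Z, c)) (f (Y, q))))"
    and "tensor_hom R R' (frag_extend f)"
  shows "tensor_hom (triple_relators S R) (triple_relators S R') (lift (frag_extend f))"
  unfolding lift_def
proof (rule tensor_hom_triple)
  fix X
  show "tensor_hom R (triple_relators S R') (frag_extend (\<lambda>(Y, q). case (X, Y, q) of (X, a) \<Rightarrow>
      fmap (\<lambda>(Y, c). (X, Y, c)) (frag_extend f (frag_of a))))"
    using tensor_hom_comp[OF assms(2) triple_right_hom[of R' S X]] by (simp add: frag_simps)
qed (use assms(1) in simp)

lemma nest_lift:
  fixes f :: "'l \<times> 'a \<Rightarrow> ('l \<times> 'c \<Rightarrow>\<^sub>0 int)"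
  shows "nest (lift (frag_extend f) x) \<approx>\<^bsub>bal UNIV R rmul\<^esub> frag_extend (\<lambda>(X, a). frag_of (X, f a)) x"
proof -
  have "nest (lift (frag_extend f) x) = frag_extend (\<lambda>(X, a). frag_extend (\<lambda>b. frag_of (X, frag_of b)) (f a)) x"
    by (simp add: nest_def lift_def frag_simps)
  also have "\<dots> \<approx>\<^bsub>bal UNIV R rmul\<^esub> frag_extend (\<lambda>(X, a). frag_of (X, f a)) x"
    unfolding case_prod_unfold by (intro frag_extend_cong bal_expand)
  finally show ?thesis .
qed

end

context bialgebroid_bimodule
begin

lemma right_stable_dia: "right_stable dia"
  unfolding right_stable_def rmul_def using dia_add_left dia_mult_right by simp

lemma first_mult_right_hom:
  "tensor_hom (triple_relators reg.dia R) (triple_relators reg.dia R) (fmap (\<lambda>(U, V, q). (U * X, V, q)))"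
  by (rule tensor_hom_triple_fmap[of _ "\<lambda>U. U * X" "\<lambda>V. V" _ "\<lambda>q. q"])
    (simp_all add: reg.dia_mult_right fmap_id tensor_hom_id)

lemma right_stable_dia3: "right_stable dia3"
  unfolding right_stable_def
proof (intro conjI allI)
  fix Y Y' :: 'l and a :: "'l \<times> 'p"
  show "frag_of (Y + Y', a) \<approx>\<^bsub>dia3\<^esub> frag_of (Y, a) + frag_of (Y', a)"
    using triple_left_cong[OF reg.dia_add_left[of Y Y' "fst a"], of "snd a" dia] by (simp add: dia3_eq fmap_add)
  fix b
  show "tensor_hom dia3 dia3 (\<lambda>\<xi>. rmul \<xi> b)"
    using first_mult_right_hom[of dia "src L b"] by (simp add: rmul_def dia3_eq case_prod_unfold)
qed

lemma takeuchi_sums_presented_module: "presented_module takeuchi_sums dia rmul"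
proof (rule rmul_presented_module[OF right_stable_dia])
  fix \<xi> b assume \<xi>: "\<xi> \<in> takeuchi_sums"
  show "rmul \<xi> b \<in> takeuchi_sums"
    unfolding takeuchi_sums_def
  proof (intro CollectI allI)
    fix a
    have "fmap (\<lambda>(Y, q). (Y * src L b, q)) (fmap (\<lambda>(Y, q). (Y * tgt L a, q)) \<xi>) \<approx>\<^bsub>dia\<^esub>
      fmap (\<lambda>(Y, q). (Y * src L b, q)) (fmap (\<lambda>(Y, q). (Y, ract G q a)) \<xi>)"
      using \<xi> by (intro tensor_hom_cong[OF dia_mult_right]) (simp add: takeuchi_sums_def)
    then show "fmap (\<lambda>(Y, q). (Y * tgt L a, q)) (rmul \<xi> b) \<approx>\<^bsub>dia\<^esub> fmap (\<lambda>(Y, q). (Y, ract G q a)) (rmul \<xi> b)"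
      by (simp add: rmul_def frag_simps mult.assoc src_tgt_commute)
  qed
qed (auto simp: takeuchi_sums_def fmap_diff cong_diff)

lemma ups_presented_module: "presented_module UNIV {} (ract G)"
  by unfold_locales
    (auto simp: add_span_empty ract_zero ract_add_left ract_add_right ract_mult ract_one)

text \<open>Here \<open>G\<close> is presented by its own elements without relations, so that results about presented modules
  carry over to \<open>L \<otimes>\<^sup>B G\<close>.\<close>

lemma balanced_ups: "tensor_hom (bal UNIV {} (ract G)) ups (\<lambda>x. x)"
proof -
  have "frag_of (X, 0) \<in> add_span ups" for X
    using ups_add_right[of X 0 0] add_span_uminus by (force simp: cong_span_def)
  then show ?thesis
    unfolding tensor_hom_def balanced_relators_def add_span_empty
    using ups_add_left ups_add_right ups_bal by (auto simp: cong_span_def diff_diff_eq)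
qed

lemma frag_diff_right: "frag_of (X, q - q') \<approx>\<^bsub>dia\<^esub> frag_of (X, q) - frag_of (X, q')"
  and frag_diff_left: "frag_of (X - X', q) \<approx>\<^bsub>dia\<^esub> frag_of (X, q) - frag_of (X', q)"
  and ups_diff_right: "frag_of (X, q - q') \<approx>\<^bsub>ups\<^esub> frag_of (X, q) - frag_of (X, q')"
  using cong_diff[OF cong_sym[OF dia_add_right[of X "q - q'" q']] cong_refl[of "frag_of (X, q')"]]
    cong_diff[OF cong_sym[OF dia_add_left[of "X - X'" X' q]] cong_refl[of "frag_of (X', q)"]]
    cong_diff[OF cong_sym[OF ups_add_right[of X "q - q'" q']] cong_refl[of "frag_of (X, q')"]]
  by simp_all

text \<open>This map retracts \<open>\<Delta> \<diamondop> 1\<close> and carries \<open>1 \<diamondop> \<delta>\<close> to \<open>\<delta> \<epsilon>\<close>, which makes the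
  sequence \<open>G \<rightarrow> L \<diamondop>\<^sub>B G \<rightarrow> L \<diamondop>\<^sub>B L \<diamondop>\<^sub>B G\<close> exact.\<close>

definition eps_first :: "('l \<times> 'l \<times> 'p \<Rightarrow>\<^sub>0 int) \<Rightarrow> ('l \<times> 'p \<Rightarrow>\<^sub>0 int)" where
  "eps_first = frag_extend (\<lambda>(X, Y, q). frag_of (src L (counit L X) * Y, q))"

text \<open>A retraction of \<open>1 \<diamondop> \<delta>\<close>.\<close>

definition eps_second :: "('l \<times> 'l \<times> 'p \<Rightarrow>\<^sub>0 int) \<Rightarrow> ('l \<times> 'p \<Rightarrow>\<^sub>0 int)" where
  "eps_second = frag_extend (\<lambda>(X, Y, q). frag_of (X, lact G (counit L Y) q))"

lemma eps_first_hom: "tensor_hom dia3 dia eps_first"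
  unfolding eps_first_def dia3_eq
proof (rule tensor_hom_triple)
  fix q
  show "tensor_hom reg.dia dia (frag_extend (\<lambda>(X, Y). case (X, Y, q) of (X, Y, q) \<Rightarrow> frag_of (src L (counit L X) * Y, q)))"
    by (rule reg.tensor_hom_dia)
      (auto simp: counit_add src_add distrib_left distrib_right dia_add_left counit_tgt src_mult mult.assoc)
next
  fix X
  show "tensor_hom dia dia (frag_extend (\<lambda>(Y, q). case (X, Y, q) of (X, Y, q) \<Rightarrow> frag_of (src L (counit L X) * Y, q)))"
    using dia_mult_src[of "counit L X"] by (simp add: fmap_def case_prod_unfold)
qed

lemma eps_second_hom: "tensor_hom dia3 dia eps_second"
  unfolding eps_second_def dia3_eq
proof (rule tensor_hom_triple)
  fix q
  show "tensor_hom reg.dia dia (frag_extend (\<lambda>(X, Y). case (X, Y, q) of (X, Y, q) \<Rightarrow> frag_of (X, lact G (counit L Y) q)))"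
    by (rule reg.tensor_hom_dia)
      (auto simp: counit_add lact_add_left dia_add_left dia_add_right dia_bal counit_src lact_mult)
next
  fix X
  show "tensor_hom dia dia (frag_extend (\<lambda>(Y, q). case (X, Y, q) of (X, Y, q) \<Rightarrow> frag_of (X, lact G (counit L Y) q)))"
    by (rule tensor_hom_dia)
      (auto simp: counit_add lact_add_left lact_add_right dia_add_right counit_tgt lact_mult)
qed

end

section \<open>A comodule as an equaliser\<close>

context bialgebroid_comodule
begin

lemma eps_first_coprod: "eps_first (coprod_left L \<xi>) \<approx>\<^bsub>dia\<^esub> \<xi>"
proof -
  have "eps_first (coprod_left L \<xi>) \<approx>\<^bsub>dia\<^esub> frag_extend frag_of \<xi>"
    unfolding eps_first_def coprod_left_def frag_extend_frag_extend
  proof (rule frag_extend_cong)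
    fix a :: "'l \<times> 'p"
    have "frag_extend (\<lambda>(U, V). frag_of (src L (counit L U) * V, snd a)) (Delta (fst a)) \<approx>\<^bsub>dia\<^esub>
        frag_of (reg.eps (Delta (fst a)), snd a)"
      using reg.eps_additive_extend[of "\<lambda>V. frag_of (V, snd a)" dia] frag_diff_left by simp
    then show "frag_extend (\<lambda>(X, Y, q). frag_of (src L (counit L X) * Y, q))
        (case a of (Y, q) \<Rightarrow> fmap (\<lambda>(X, Z). (X, Z, q)) (Delta Y)) \<approx>\<^bsub>dia\<^esub> frag_of a"
      using reg.eps_delta[of "fst a"] by (simp add: frag_simps)
  qed
  then show ?thesis
    by (simp add: frag_extend_ident)
qed

lemma eps_first_coact: "eps_first (coact_right G \<xi>) \<approx>\<^bsub>dia\<^esub> delta (eps \<xi>)"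
proof -
  have "eps_first (coact_right G \<xi>) \<approx>\<^bsub>dia\<^esub> frag_extend (\<lambda>(Y, q). delta (lact G (counit L Y) q)) \<xi>"
    unfolding eps_first_def coact_right_def frag_extend_frag_extend
  proof (rule frag_extend_cong)
    fix a :: "'l \<times> 'p"
    show "frag_extend (\<lambda>(X, Y, q). frag_of (src L (counit L X) * Y, q))
        (case a of (X, p) \<Rightarrow> fmap (\<lambda>(Y, q). (X, Y, q)) (delta p)) \<approx>\<^bsub>dia\<^esub>
        (case a of (Y, q) \<Rightarrow> delta (lact G (counit L Y) q))"
      using cong_sym[OF delta_lact[of "counit L (fst a)" "snd a"]] by (simp add: frag_simps)
  qed
  also have "\<dots> \<approx>\<^bsub>dia\<^esub> delta (eps \<xi>)"
    by (rule eps_additive_extend[OF delta_diff])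
  finally show ?thesis .
qed

text \<open>Applying the counit to the first leg of \<open>(\<Delta> \<diamondop> 1) \<xi> = (1 \<diamondop> \<delta>) \<xi>\<close> gives \<open>\<xi> = \<delta>(\<epsilon> \<xi>)\<close>.\<close>

lemma cotensor_regular:
  assumes "coprod_left L \<xi> - coact_right G \<xi> \<in> add_span dia3"
  shows "\<xi> \<approx>\<^bsub>dia\<^esub> delta (eps \<xi>)"
proof -
  have "eps_first (coprod_left L \<xi>) \<approx>\<^bsub>dia\<^esub> eps_first (coact_right G \<xi>)"
    using assms by (intro tensor_hom_cong[OF eps_first_hom]) (simp add: cong_span_def)
  then show ?thesis
    using cong_trans[OF cong_sym[OF eps_first_coprod] cong_trans[OF _ eps_first_coact]] by blast
qed

lemma eps_second_coact: "eps_second (coact_right G x) \<approx>\<^bsub>dia\<^esub> x"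
proof -
  have "eps_second (coact_right G x) \<approx>\<^bsub>dia\<^esub> frag_extend frag_of x"
    unfolding eps_second_def coact_right_def frag_extend_frag_extend
  proof (rule frag_extend_cong)
    fix a :: "'l \<times> 'p"
    have "frag_extend (\<lambda>(Y, q). frag_of (fst a, lact G (counit L Y) q)) (delta (snd a)) \<approx>\<^bsub>dia\<^esub>
        frag_of (fst a, eps (delta (snd a)))"
      by (rule eps_additive_extend[OF frag_diff_right])
    then show "frag_extend (\<lambda>(X, Y, q). frag_of (X, lact G (counit L Y) q))
        (case a of (X, p) \<Rightarrow> fmap (\<lambda>(Y, q). (X, Y, q)) (delta p)) \<approx>\<^bsub>dia\<^esub> frag_of a"
      by (simp add: frag_simps eps_delta)
  qed
  then show ?thesis
    by (simp add: frag_extend_ident)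
qed

lemma coact_right_cancel: "coact_right G x \<approx>\<^bsub>dia3\<^esub> coact_right G y \<Longrightarrow> x \<approx>\<^bsub>dia\<^esub> y"
  using cong_trans[OF cong_sym[OF eps_second_coact]
      cong_trans[OF tensor_hom_cong[OF eps_second_hom] eps_second_coact]] .

lemma canon_mult_right: "canon (fmap (\<lambda>(U, p). (U * X, p)) x) = fmap (\<lambda>(Y, q). (Y * X, q)) (canon x)"
  by (simp add: canon_def frag_simps mult.assoc)

lemma canon_diff: "canon (x - y) = canon x - canon y"
  by (simp add: canon_def frag_extend_diff)

text \<open>Coassociativity in the form \<open>(\<mu> \<otimes> 1)(1 \<otimes> \<delta>) = (1 \<diamondop> \<delta>) \<phi>\<close>: both sides send \<open>X \<otimes> p\<close> to
  \<open>p\<^sub>(\<^sub>-\<^sub>2\<^sub>) X \<otimes> p\<^sub>(\<^sub>-\<^sub>1\<^sub>) \<otimes> p\<^sub>(\<^sub>0\<^sub>)\<close>.\<close>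

lemma twist_coact_right: "twist Delta (coact_right G w) \<approx>\<^bsub>dia3\<^esub> coact_right G (canon w)"
  unfolding twist_def coact_right_def canon_def frag_extend_frag_extend
proof (rule frag_extend_cong)
  fix a :: "'l \<times> 'p"
  have "fmap (\<lambda>(U, V, q). (U * fst a, V, q)) (coprod_left L (delta (snd a))) \<approx>\<^bsub>dia3\<^esub>
      fmap (\<lambda>(U, V, q). (U * fst a, V, q)) (coact_right G (delta (snd a)))"
    using first_mult_right_hom coassociative unfolding dia3_eq by (rule tensor_hom_cong)
  then show "frag_extend (\<lambda>(X, Y, a). fmap (\<lambda>(U, V). (U * X, V, a)) (Delta Y))
      (case a of (X, p) \<Rightarrow> fmap (\<lambda>(Y, q). (X, Y, q)) (delta p)) \<approx>\<^bsub>dia3\<^esub>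
      frag_extend (\<lambda>(X, p). fmap (\<lambda>(Y, q). (X, Y, q)) (delta p))
      (case a of (X, p) \<Rightarrow> fmap (\<lambda>(Y, q). (Y * X, q)) (delta p))"
    by (simp add: coprod_left_def coact_right_def frag_simps)
qed

end

section \<open>The inverse canonical map of an anti-left Hopf algebroid\<close>

locale anti_left_hopf_bialgebroid = left_bialgebroid L
  for L :: "('k::field, 'b::{ring,monoid_mult}, 'l::{ring,monoid_mult}) bialgebroid" +
  assumes hopf: "anti_left_hopf L"
    and flat: "faithfully_flat (\<lambda>b c. b * c) (\<lambda>b X. src L b * X)"
begin

text \<open>A formal sum for \<open>Y\<^sub>[\<^sub>-\<^sub>] \<otimes> Y\<^sub>[\<^sub>+\<^sub>]\<close>. Its properties are read off from their images under \<open>\<mu>\<close>, which is injective.\<close>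

abbreviation "minus_plus Y \<equiv> rep (translation L (regular L) Y)"

lemma canonical_bij:
  "bij_betw (canonical_map L (regular L)) (quot reg.ups) (quot reg.dia)"
  using hopf by (simp add: anti_left_hopf_def)

lemma twist_pair_Delta: "twist_pair Delta = reg.canon"
  by (simp add: twist_pair_def reg.canon_def)

lemma canon_cancel: "reg.canon x \<approx>\<^bsub>reg.dia\<^esub> reg.canon y \<Longrightarrow> x \<approx>\<^bsub>reg.ups\<^esub> y"
  using canonical_bij unfolding bij_betw_def inj_on_def quot_def
  by (auto simp: reg.canonical_map_cls cls_eq_iff)

lemma canon_minus_plus: "reg.canon (minus_plus Y) \<approx>\<^bsub>reg.dia\<^esub> frag_of (1, Y)"
proof -
  have mem: "cls reg.dia (frag_of (1, Y)) \<in> canonical_map L (regular L) ` quot reg.ups"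
    using canonical_bij by (auto simp: bij_betw_def quot_def)
  have "cls reg.ups (minus_plus Y) = translation L (regular L) Y"
    unfolding translation_def by (rule cls_rep[OF inv_into_into[OF mem]])
  then have "canonical_map L (regular L) (cls reg.ups (minus_plus Y)) = cls reg.dia (frag_of (1, Y))"
    unfolding translation_def using f_inv_into_f[OF mem] by simp
  then show ?thesis
    by (simp add: reg.canonical_map_cls cls_eq_iff)
qed

lemma minus_plus_add: "minus_plus (Y + Y') \<approx>\<^bsub>reg.ups\<^esub> minus_plus Y + minus_plus Y'"
proof (rule canon_cancel)
  have "reg.canon (minus_plus (Y + Y')) \<approx>\<^bsub>reg.dia\<^esub> frag_of (1, Y + Y')"
    by (rule canon_minus_plus)
  also have "\<dots> \<approx>\<^bsub>reg.dia\<^esub> frag_of (1, Y) + frag_of (1, Y')"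
    by (rule reg.dia_add_right)
  also have "\<dots> \<approx>\<^bsub>reg.dia\<^esub> reg.canon (minus_plus Y) + reg.canon (minus_plus Y')"
    by (intro cong_add cong_sym[OF canon_minus_plus])
  finally show "reg.canon (minus_plus (Y + Y')) \<approx>\<^bsub>reg.dia\<^esub> reg.canon (minus_plus Y + minus_plus Y')"
    by (simp add: reg.canon_def frag_extend_add)
qed

lemma reg_dia_mult_tgt: "tensor_hom reg.dia reg.dia (fmap (\<lambda>(Y, Z). (Y, tgt L c * Z)))"
  using dia_mult_both[of 1 c] by (simp add: src_one)

lemma canon_tgt: "reg.canon (fmap (\<lambda>(X, Z). (X, tgt L c * Z)) x) \<approx>\<^bsub>reg.dia\<^esub>
    fmap (\<lambda>(X, Z). (X, tgt L c * Z)) (reg.canon x)"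
  unfolding reg.canon_def fmap_def frag_extend_frag_extend
proof (rule frag_extend_cong)
  fix a :: "'l \<times> 'l"
  have "fmap (\<lambda>(Y, q). (Y * fst a, q)) (Delta (tgt L c * snd a)) \<approx>\<^bsub>reg.dia\<^esub>
      fmap (\<lambda>(Y, q). (Y * fst a, q)) (fmap (\<lambda>(Y, Z). (Y, tgt L c * Z)) (Delta (snd a)))"
    by (rule tensor_hom_cong[OF reg.dia_mult_right Delta_tgt])
  then show "frag_extend (\<lambda>(X, p). frag_extend (\<lambda>a. frag_of (case a of (Y, q) \<Rightarrow> (Y * X, q))) (rep (coact (regular L) p)))
      (frag_of (case a of (X, Z) \<Rightarrow> (X, tgt L c * Z))) \<approx>\<^bsub>reg.dia\<^esub>
      frag_extend (\<lambda>a. frag_of (case a of (X, Z) \<Rightarrow> (X, tgt L c * Z)))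
      (case a of (X, p) \<Rightarrow> frag_extend (\<lambda>a. frag_of (case a of (Y, q) \<Rightarrow> (Y * X, q))) (rep (coact (regular L) p)))"
    by (simp add: frag_simps)
qed

lemma canon_src: "reg.canon (fmap (\<lambda>(X, Z). (X, src L c * Z)) x) \<approx>\<^bsub>reg.dia\<^esub>
    fmap (\<lambda>(X, Z). (src L c * X, Z)) (reg.canon x)"
  unfolding reg.canon_def fmap_def frag_extend_frag_extend
proof (rule frag_extend_cong)
  fix a :: "'l \<times> 'l"
  have "fmap (\<lambda>(Y, q). (Y * fst a, q)) (Delta (src L c * snd a)) \<approx>\<^bsub>reg.dia\<^esub>
      fmap (\<lambda>(Y, q). (Y * fst a, q)) (fmap (\<lambda>(Y, Z). (src L c * Y, Z)) (Delta (snd a)))"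
    by (rule tensor_hom_cong[OF reg.dia_mult_right Delta_src])
  then show "frag_extend (\<lambda>(X, p). frag_extend (\<lambda>a. frag_of (case a of (Y, q) \<Rightarrow> (Y * X, q))) (rep (coact (regular L) p)))
      (frag_of (case a of (X, Z) \<Rightarrow> (X, src L c * Z))) \<approx>\<^bsub>reg.dia\<^esub>
      frag_extend (\<lambda>a. frag_of (case a of (X, Z) \<Rightarrow> (src L c * X, Z)))
      (case a of (X, p) \<Rightarrow> frag_extend (\<lambda>a. frag_of (case a of (Y, q) \<Rightarrow> (Y * X, q))) (rep (coact (regular L) p)))"
    by (simp add: frag_simps mult.assoc)
qed

lemma minus_plus_tgt: "minus_plus (tgt L c * Y) \<approx>\<^bsub>reg.ups\<^esub> fmap (\<lambda>(X, Z). (X, tgt L c * Z)) (minus_plus Y)"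
proof (rule canon_cancel)
  have "reg.canon (fmap (\<lambda>(X, Z). (X, tgt L c * Z)) (minus_plus Y)) \<approx>\<^bsub>reg.dia\<^esub>
      fmap (\<lambda>(X, Z). (X, tgt L c * Z)) (reg.canon (minus_plus Y))"
    by (rule canon_tgt)
  also have "\<dots> \<approx>\<^bsub>reg.dia\<^esub> fmap (\<lambda>(X, Z). (X, tgt L c * Z)) (frag_of (1, Y))"
    by (rule tensor_hom_cong[OF reg_dia_mult_tgt canon_minus_plus])
  also have "\<dots> \<approx>\<^bsub>reg.dia\<^esub> reg.canon (minus_plus (tgt L c * Y))"
    using canon_minus_plus by (simp add: cong_sym)
  finally show "reg.canon (minus_plus (tgt L c * Y)) \<approx>\<^bsub>reg.dia\<^esub> reg.canon (fmap (\<lambda>(X, Z). (X, tgt L c * Z)) (minus_plus Y))"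
    by (rule cong_sym)
qed

lemma minus_plus_src: "minus_plus (src L c * Y) \<approx>\<^bsub>reg.ups\<^esub> fmap (\<lambda>(X, Z). (X * tgt L c, Z)) (minus_plus Y)"
proof (rule canon_cancel)
  have "fmap (\<lambda>(Y, q). (Y * tgt L c, q)) (reg.canon (minus_plus Y)) \<approx>\<^bsub>reg.dia\<^esub>
      fmap (\<lambda>(Y, q). (Y * tgt L c, q)) (frag_of (1, Y))"
    by (rule tensor_hom_cong[OF reg.dia_mult_right canon_minus_plus])
  also have "\<dots> \<approx>\<^bsub>reg.dia\<^esub> frag_of (1, src L c * Y)"
    using reg.dia_bal[of c 1 Y] by simp
  also have "\<dots> \<approx>\<^bsub>reg.dia\<^esub> reg.canon (minus_plus (src L c * Y))"
    by (rule cong_sym[OF canon_minus_plus])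
  finally show "reg.canon (minus_plus (src L c * Y)) \<approx>\<^bsub>reg.dia\<^esub> reg.canon (fmap (\<lambda>(X, Z). (X * tgt L c, Z)) (minus_plus Y))"
    unfolding reg.canon_mult_right by (rule cong_sym)
qed

lemma minus_plus_takeuchi:
  "fmap (\<lambda>(X, Z). (X * src L c, Z)) (minus_plus Y) \<approx>\<^bsub>reg.ups\<^esub> fmap (\<lambda>(X, Z). (X, src L c * Z)) (minus_plus Y)"
proof (rule canon_cancel)
  have "reg.canon (fmap (\<lambda>(X, Z). (X, src L c * Z)) (minus_plus Y)) \<approx>\<^bsub>reg.dia\<^esub>
      fmap (\<lambda>(X, Z). (src L c * X, Z)) (reg.canon (minus_plus Y))"
    by (rule canon_src)
  also have "\<dots> \<approx>\<^bsub>reg.dia\<^esub> fmap (\<lambda>(X, Z). (src L c * X, Z)) (frag_of (1, Y))"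
    by (rule tensor_hom_cong[OF reg.dia_mult_src canon_minus_plus])
  also have "\<dots> \<approx>\<^bsub>reg.dia\<^esub> fmap (\<lambda>(X, Z). (X * src L c, Z)) (reg.canon (minus_plus Y))"
    using tensor_hom_cong[OF reg.dia_mult_right[of "src L c"] cong_sym[OF canon_minus_plus]] by simp
  finally show "reg.canon (fmap (\<lambda>(X, Z). (X * src L c, Z)) (minus_plus Y)) \<approx>\<^bsub>reg.dia\<^esub>
      reg.canon (fmap (\<lambda>(X, Z). (X, src L c * Z)) (minus_plus Y))"
    unfolding reg.canon_mult_right by (rule cong_sym)
qed

lemma target_linear_minus_plus: "target_linear reg.ups minus_plus"
  unfolding target_linear_def using minus_plus_add minus_plus_tgt by blast

lemma twist_pair_minus_plus_hom: "tensor_hom reg.dia reg.ups (twist_pair minus_plus)"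
  unfolding twist_pair_def
proof (rule reg.tensor_hom_dia; unfold prod.case)
  fix X X' Y Y' b
  show "fmap (\<lambda>(U, V). (U * (X + X'), V)) (minus_plus Y) \<approx>\<^bsub>reg.ups\<^esub>
      fmap (\<lambda>(U, V). (U * X, V)) (minus_plus Y) + fmap (\<lambda>(U, V). (U * X', V)) (minus_plus Y)"
    unfolding fmap_def frag_extend_plus[symmetric]
    by (rule frag_extend_cong) (auto simp: distrib_left reg.ups_add_left)
  show "fmap (\<lambda>(U, V). (U * X, V)) (minus_plus (Y + Y')) \<approx>\<^bsub>reg.ups\<^esub>
      fmap (\<lambda>(U, V). (U * X, V)) (minus_plus Y) + fmap (\<lambda>(U, V). (U * X, V)) (minus_plus Y')"
    unfolding fmap_add[symmetric] by (rule tensor_hom_cong[OF reg.ups_mult_right minus_plus_add])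
  have "fmap (\<lambda>(U, V). (U * X, V)) (fmap (\<lambda>(U, V). (U * tgt L b, V)) (minus_plus Y)) \<approx>\<^bsub>reg.ups\<^esub>
      fmap (\<lambda>(U, V). (U * X, V)) (minus_plus (src L b * Y))"
    by (rule tensor_hom_cong[OF reg.ups_mult_right cong_sym[OF minus_plus_src]])
  then show "fmap (\<lambda>(U, V). (U * (tgt L b * X), V)) (minus_plus Y) \<approx>\<^bsub>reg.ups\<^esub>
      fmap (\<lambda>(U, V). (U * X, V)) (minus_plus (lact (regular L) b Y))"
    by (simp add: frag_simps mult.assoc)
qed

lemma twist_pair_Delta_minus_plus: "reg.canon (twist_pair minus_plus y) \<approx>\<^bsub>reg.dia\<^esub> y"
proof -
  have "reg.canon (twist_pair minus_plus y) \<approx>\<^bsub>reg.dia\<^esub> frag_extend frag_of y"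
    unfolding twist_pair_def unfolding reg.canon_def frag_extend_frag_extend
  proof (rule frag_extend_cong)
    fix a :: "'l \<times> 'l"
    have "fmap (\<lambda>(U, V). (U * fst a, V)) (reg.canon (minus_plus (snd a))) \<approx>\<^bsub>reg.dia\<^esub>
        fmap (\<lambda>(U, V). (U * fst a, V)) (frag_of (1, snd a))"
      by (rule tensor_hom_cong[OF reg.dia_mult_right canon_minus_plus])
    then show "frag_extend (\<lambda>(X, p). fmap (\<lambda>(Y, q). (Y * X, q)) (rep (coact (regular L) p)))
        (case a of (X, Y) \<Rightarrow> fmap (\<lambda>(U, V). (U * X, V)) (minus_plus Y)) \<approx>\<^bsub>reg.dia\<^esub> frag_of a"
      by (simp add: reg.canon_def frag_simps mult.assoc)
  qed
  then show ?thesis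
    by (simp add: frag_extend_ident)
qed

lemma twist_pair_minus_plus_Delta: "twist_pair minus_plus (reg.canon x) \<approx>\<^bsub>reg.ups\<^esub> x"
  by (rule canon_cancel[OF twist_pair_Delta_minus_plus])

lemma twist_Delta_hom:
  "extendable R \<Longrightarrow> tensor_hom (triple_relators reg.ups R) (triple_relators reg.dia R) (twist Delta)"
  by (rule twist_hom[OF _ target_linear_Delta reg.dia_mult_right])
    (simp_all add: twist_pair_Delta reg.canon_hom)

lemma twist_minus_plus_hom:
  "extendable R \<Longrightarrow> tensor_hom (triple_relators reg.dia R) (triple_relators reg.ups R) (twist minus_plus)"
  by (rule twist_hom[OF twist_pair_minus_plus_hom target_linear_minus_plus reg.ups_mult_right])

lemma twist_minus_plus_Delta: "twist minus_plus (twist Delta x) \<approx>\<^bsub>triple_relators reg.ups R\<^esub> x"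
  by (rule twist_twist) (simp add: twist_pair_Delta twist_pair_minus_plus_Delta)

lemma twist_Delta_minus_plus: "twist Delta (twist minus_plus x) \<approx>\<^bsub>triple_relators reg.dia R\<^esub> x"
  by (rule twist_twist) (simp add: twist_pair_Delta twist_pair_Delta_minus_plus)

lemma twist_Delta_cancel:
  assumes "extendable R" and "twist Delta x \<approx>\<^bsub>triple_relators reg.dia R\<^esub> twist Delta y"
  shows "x \<approx>\<^bsub>triple_relators reg.ups R\<^esub> y"
proof -
  have "x \<approx>\<^bsub>triple_relators reg.ups R\<^esub> twist minus_plus (twist Delta x)"
    by (rule cong_sym[OF twist_minus_plus_Delta])
  also have "\<dots> \<approx>\<^bsub>triple_relators reg.ups R\<^esub> twist minus_plus (twist Delta y)"
    by (rule tensor_hom_cong[OF twist_minus_plus_hom[OF assms(1)] assms(2)])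
  also have "\<dots> \<approx>\<^bsub>triple_relators reg.ups R\<^esub> y"
    by (rule twist_minus_plus_Delta)
  finally show ?thesis .
qed

text \<open>By \<open>twist_Delta_minus_plus\<close>, therefore, \<open>p\<^sub>(\<^sub>-\<^sub>1\<^sub>)\<^sub>[\<^sub>-\<^sub>] \<otimes> p\<^sub>(\<^sub>-\<^sub>1\<^sub>)\<^sub>[\<^sub>+\<^sub>] \<otimes> p\<^sub>(\<^sub>0\<^sub>)\<close> is the element that \<open>\<mu> \<otimes> 1\<close> sends to \<open>1 \<diamondop> \<delta> p\<close>.\<close>

lemma twist_minus_plus_one: "twist minus_plus (fmap (\<lambda>(Y, q). (1, Y, q)) \<xi>) = attach minus_plus \<xi>"
  by (simp add: twist_def attach_def frag_simps)

end

section \<open>Skew regularity of comodules\<close>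

locale hopf_comodule = anti_left_hopf_bialgebroid L + bialgebroid_comodule L G
  for L :: "('k::field, 'b::{ring,monoid_mult}, 'l::{ring,monoid_mult}) bialgebroid"
    and G :: "('k, 'b, 'p::ab_group_add, 'l) comod"
begin

abbreviation "mixed \<equiv> mixed_relators L G"

lemma mixed_eq: "mixed = triple_relators reg.ups dia"
  by (simp add: mixed_relators_def)

lemma nest_coact_right:
  "nest (coact_right G w) \<approx>\<^bsub>bal UNIV R rmul\<^esub> fmap (\<lambda>(X, p). (X, delta p)) w"
  unfolding nest_def coact_right_def fmap_def frag_extend_frag_extend
proof (rule frag_extend_cong)
  fix a :: "'l \<times> 'p"
  show "frag_extend (\<lambda>a. frag_of (case a of (X, Y, a) \<Rightarrow> (X, frag_of (Y, a))))
      (case a of (X, p) \<Rightarrow> frag_extend (\<lambda>a. frag_of (case a of (Y, q) \<Rightarrow> (X, Y, q))) (delta p))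
      \<approx>\<^bsub>bal UNIV R rmul\<^esub> frag_of (case a of (X, p) \<Rightarrow> (X, delta p))"
    using bal_expand[of "fst a" "delta (snd a)"] by (simp add: frag_simps)
qed

text \<open>Flatness turns the injectivity of \<open>\<delta>\<close>, which the counit splits, into that of \<open>1 \<otimes> \<delta>\<close>.\<close>

lemma coact_right_injective:
  assumes "coact_right G w \<in> add_span mixed"
  shows "w \<in> add_span ups"
proof -
  have "nest (coact_right G w) \<in> add_span (bal UNIV dia rmul)"
    using assms tensor_hom_span[OF nest_hom[OF right_stable_dia]] by (simp add: mixed_eq)
  then have dw: "fmap (\<lambda>(X, p). (X, delta p)) w \<in> add_span (bal UNIV dia rmul)"
    using span_cong[OF nest_coact_right] by blast
  obtain z' where z': "Poly_Mapping.keys z' \<subseteq> UNIV \<times> {p \<in> UNIV. delta p \<in> add_span dia}"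
    "w \<approx>\<^bsub>bal UNIV {} (ract G)\<^esub> z'"
    by (rule flat_kernel[OF flat ups_presented_module rmul_presented_module_UNIV[OF right_stable_dia] _ _ _ dw])
      (auto simp: delta_add rmul_def delta_ract)
  have "z' \<approx>\<^bsub>bal UNIV {} (ract G)\<^esub> 0"
  proof -
    have "frag_extend frag_of z' \<approx>\<^bsub>bal UNIV {} (ract G)\<^esub> frag_extend (\<lambda>_. 0) z'"
    proof (rule frag_extend_cong)
      fix a assume "a \<in> Poly_Mapping.keys z'"
      then have "delta (snd a) \<in> add_span dia"
        using z'(1) by auto
      then have "snd a = 0"
        using eps_span eps_delta by metis
      then show "frag_of a \<approx>\<^bsub>bal UNIV {} (ract G)\<^esub> 0"
        using bal_zero_right by (cases a) auto
    qed
    then show ?thesis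
      by (simp add: frag_extend_ident frag_extend_eq_0)
  qed
  then have "w \<in> add_span (bal UNIV {} (ract G))"
    using z'(2) cong_trans cong_zero_iff by blast
  then show ?thesis
    by (rule tensor_hom_span[OF balanced_ups])
qed

text \<open>If \<open>\<phi> w = 0\<close> then \<open>(\<mu> \<otimes> 1)(1 \<otimes> \<delta>) w = (1 \<diamondop> \<delta>) \<phi> w = 0\<close>, and the two maps on the left are injective.\<close>

lemma canon_injective:
  assumes "canon w \<in> add_span dia"
  shows "w \<in> add_span ups"
proof -
  have "coact_right G (canon w) \<in> add_span dia3"
    by (rule tensor_hom_span[OF coact_right_dia assms])
  then have "twist Delta (coact_right G w) \<approx>\<^bsub>triple_relators reg.dia dia\<^esub> twist Delta 0"
    using span_cong[OF twist_coact_right] by (simp add: dia3_eq cong_zero_iff twist_def)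
  then have "coact_right G w \<approx>\<^bsub>mixed\<^esub> 0"
    unfolding mixed_eq by (rule twist_Delta_cancel[OF extendable_dia])
  then show ?thesis
    by (intro coact_right_injective) (simp add: cong_zero_iff)
qed

lemma attach_minus_plus_hom: "tensor_hom dia mixed (attach minus_plus)"
  using extendable_dia target_linear_minus_plus unfolding extendable_def mixed_eq by blast

lemma coact_translation_eq: "coact_translation L G p = cls mixed (attach minus_plus (delta p))"
  using tensor_hom_induced[OF attach_minus_plus_hom, of "delta p"]
  by (simp add: coact_translation_def attach_def flip: coact_eq_cls)

lemma twist_Delta_attach_minus_plus: "twist Delta (attach minus_plus \<xi>) \<approx>\<^bsub>triple_relators reg.dia R\<^esub> fmap (\<lambda>(Y, q). (1, Y, q)) \<xi>"
  unfolding twist_minus_plus_one[symmetric] by (rule twist_Delta_minus_plus)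

lemma coprod_left_extend: "coprod_left L = frag_extend (\<lambda>(Y, q). fmap (\<lambda>(X, Z). (X, Z, q)) (Delta Y))"
  by (simp add: coprod_left_def)

lemma coact_right_extend: "coact_right G = frag_extend (\<lambda>(X, p). fmap (\<lambda>(Y, q). (X, Y, q)) (delta p))"
  by (simp add: coact_right_def)

lemma lift_coprod_left_hom:
  "tensor_hom (triple_relators reg.dia dia) (triple_relators reg.dia dia3) (lift (coprod_left L))"
  unfolding coprod_left_extend
proof (rule lift_hom)
  fix q
  show "tensor_hom reg.dia (triple_relators reg.dia dia3) (frag_extend (\<lambda>(X, Y). fmap (\<lambda>(Z, c). (X, Z, c))
      (case (Y, q) of (Y, q) \<Rightarrow> fmap (\<lambda>(X, Z). (X, Z, q)) (Delta Y))))"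
    using tensor_hom_comp[OF reg.coact_right_dia[unfolded reg.dia3_eq] append_hom[of reg.dia q]]
    by (simp add: coact_right_def frag_simps)
qed (use coprod_left_hom[unfolded coprod_left_extend] in simp)

lemma lift_coact_right_hom:
  "tensor_hom (triple_relators reg.dia dia) (triple_relators reg.dia dia3) (lift (coact_right G))"
  unfolding coact_right_extend
proof (rule lift_hom)
  fix q
  show "tensor_hom reg.dia (triple_relators reg.dia dia3) (frag_extend (\<lambda>(X, Y). fmap (\<lambda>(Z, c). (X, Z, c))
      (case (Y, q) of (X, p) \<Rightarrow> fmap (\<lambda>(Y, q). (X, Y, q)) (delta p))))"
  proof (rule tensor_hom_frag_extend)
    fix r assume r: "r \<in> reg.dia"
    have "frag_extend (\<lambda>(X, Y). fmap (\<lambda>(Z, c). (X, Z, c)) (case (Y, q) of (X, p) \<Rightarrow> fmap (\<lambda>(Y, q). (X, Y, q)) (delta p))) r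
        = frag_extend (\<lambda>a. fmap (\<lambda>(X, Y). (X, Y, a)) r) (delta q)"
      by (simp only: frag_simps prod.case fst_conv snd_conv frag_extend_of prod.collapse)
        (rule frag_extend_swap)
    also have "\<dots> \<in> add_span (triple_relators reg.dia dia3)"
      using r by (intro frag_extend_mem_span triple_left add_span.gen)
    finally show "frag_extend (\<lambda>(X, Y). fmap (\<lambda>(Z, c). (X, Z, c))
        (case (Y, q) of (X, p) \<Rightarrow> fmap (\<lambda>(Y, q). (X, Y, q)) (delta p))) r \<in> add_span (triple_relators reg.dia dia3)" .
  qed
qed (use coact_right_dia[unfolded coact_right_extend] in simp)

text \<open>Both sides send \<open>X \<otimes> Y \<otimes> q\<close> to \<open>Y\<^sub>(\<^sub>1\<^sub>) X \<otimes> Y\<^sub>(\<^sub>2\<^sub>) \<otimes> Y\<^sub>(\<^sub>3\<^sub>) \<otimes> q\<close>.\<close>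

lemma twist_lift_coprod_left:
  "twist Delta (lift (coprod_left L) x) \<approx>\<^bsub>triple_relators reg.dia dia3\<^esub> lift (coprod_left L) (twist Delta x)"
  unfolding twist_def lift_def frag_extend_frag_extend
proof (rule frag_extend_cong)
  fix a :: "'l \<times> 'l \<times> 'p"
  obtain X Y q where a: "a = (X, Y, q)"
    by (cases a)
  have "fmap (\<lambda>(X, Y, Z). (X, Y, Z, q)) (coprod_left L (Delta Y)) \<approx>\<^bsub>triple_relators reg.dia dia3\<^esub>
      fmap (\<lambda>(X, Y, Z). (X, Y, Z, q)) (coact_right (regular L) (Delta Y))"
    using tensor_hom_cong[OF append_hom reg.coassociative[of Y, unfolded reg.dia3_eq]] by simp
  from tensor_hom_cong[OF first_mult_right_hom[of dia3 X] this]
  show "frag_extend (\<lambda>(X, Y, a). fmap (\<lambda>(U, V). (U * X, V, a)) (Delta Y))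
      (case a of (X, a) \<Rightarrow> fmap (\<lambda>(Y, c). (X, Y, c)) (coprod_left L (frag_of a))) \<approx>\<^bsub>triple_relators reg.dia dia3\<^esub>
      frag_extend (\<lambda>(X, a). fmap (\<lambda>(Y, c). (X, Y, c)) (coprod_left L (frag_of a)))
      (case a of (X, Y, a) \<Rightarrow> fmap (\<lambda>(U, V). (U * X, V, a)) (Delta Y))"
    by (simp add: a coprod_left_def coact_right_def frag_simps)
qed

lemma twist_lift_coact_right: "twist Delta (lift (coact_right G) x) = lift (coact_right G) (twist Delta x)"
  unfolding twist_def lift_def frag_extend_frag_extend
proof (rule frag_extend_eq)
  fix a :: "'l \<times> 'l \<times> 'p"
  show "frag_extend (\<lambda>(X, Y, a). fmap (\<lambda>(U, V). (U * X, V, a)) (Delta Y))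
      (case a of (X, a) \<Rightarrow> fmap (\<lambda>(Y, c). (X, Y, c)) (coact_right G (frag_of a))) =
      frag_extend (\<lambda>(X, a). fmap (\<lambda>(Y, c). (X, Y, c)) (coact_right G (frag_of a)))
      (case a of (X, Y, a) \<Rightarrow> fmap (\<lambda>(U, V). (U * X, V, a)) (Delta Y))"
    by (simp add: coact_right_def frag_simps) (rule frag_extend_swap)
qed

text \<open>Under the injective map \<open>\<mu> \<otimes> 1 \<otimes> 1\<close> the two sides become \<open>1 \<diamondop> (\<Delta> \<diamondop> 1) \<delta> p\<close> and \<open>1 \<diamondop> (1 \<diamondop> \<delta>) \<delta> p\<close>, which agree
  by coassociativity.\<close>

lemma lift_attach_minus_plus:
  "lift (coprod_left L) (attach minus_plus (delta p)) \<approx>\<^bsub>triple_relators reg.ups dia3\<^esub> lift (coact_right G) (attach minus_plus (delta p))"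
proof (rule twist_Delta_cancel[OF extendable_dia3])
  let ?V = "triple_relators reg.dia dia3" and ?T = "attach minus_plus (delta p)"
  have "twist Delta (lift (coprod_left L) ?T) \<approx>\<^bsub>?V\<^esub> lift (coprod_left L) (twist Delta ?T)"
    by (rule twist_lift_coprod_left)
  also have "\<dots> \<approx>\<^bsub>?V\<^esub> lift (coprod_left L) (fmap (\<lambda>(Y, q). (1, Y, q)) (delta p))"
    by (rule tensor_hom_cong[OF lift_coprod_left_hom twist_Delta_attach_minus_plus])
  also have "\<dots> = fmap (\<lambda>(Y, q). (1, Y, q)) (coprod_left L (delta p))"
    unfolding coprod_left_extend by (rule lift_one)
  also have "\<dots> \<approx>\<^bsub>?V\<^esub> fmap (\<lambda>(Y, q). (1, Y, q)) (coact_right G (delta p))"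
    by (rule triple_right_cong[OF coassociative])
  also have "\<dots> = lift (coact_right G) (fmap (\<lambda>(Y, q). (1, Y, q)) (delta p))"
    unfolding coact_right_extend by (rule lift_one[symmetric])
  also have "\<dots> \<approx>\<^bsub>?V\<^esub> lift (coact_right G) (twist Delta ?T)"
    by (rule tensor_hom_cong[OF lift_coact_right_hom cong_sym[OF twist_Delta_attach_minus_plus]])
  finally show "twist Delta (lift (coprod_left L) ?T) \<approx>\<^bsub>?V\<^esub> twist Delta (lift (coact_right G) ?T)"
    by (simp add: twist_lift_coact_right)
qed

lemma coprod_left_rmul: "coprod_left L (rmul \<xi> b) \<approx>\<^bsub>dia3\<^esub> rmul (coprod_left L \<xi>) b"
  unfolding coprod_left_def rmul_def fmap_def frag_extend_frag_extend
proof (rule frag_extend_cong)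
  fix a :: "'l \<times> 'p"
  have "fmap (\<lambda>(X, Y). (X, Y, snd a)) (Delta (fst a * src L b)) \<approx>\<^bsub>dia3\<^esub>
      fmap (\<lambda>(X, Y). (X, Y, snd a)) (fmap (\<lambda>(Y, Z). (Y * src L b, Z)) (Delta (fst a)))"
    unfolding dia3_eq by (rule triple_left_cong[OF Delta_mult_src])
  then show "frag_extend (\<lambda>(Y, q). frag_extend (\<lambda>a. frag_of (case a of (X, Z) \<Rightarrow> (X, Z, q))) (Delta Y))
      (frag_of (case a of (Y, a) \<Rightarrow> (Y * src L b, a))) \<approx>\<^bsub>dia3\<^esub>
      frag_extend (\<lambda>a. frag_of (case a of (Y, a) \<Rightarrow> (Y * src L b, a)))
      (case a of (Y, q) \<Rightarrow> frag_extend (\<lambda>a. frag_of (case a of (X, Z) \<Rightarrow> (X, Z, q))) (Delta Y))"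
    by (simp add: frag_simps)
qed

lemma coact_right_rmul: "coact_right G (rmul \<xi> b) = rmul (coact_right G \<xi>) b"
  by (simp add: coact_right_def rmul_def frag_simps)

text \<open>By \<open>lift_attach_minus_plus\<close> the element lies in the kernel of \<open>1 \<otimes> d\<close> for \<open>d = \<Delta> \<diamondop> 1 - 1 \<diamondop> \<delta>\<close>. By flatness
  it is a sum of terms \<open>X \<otimes> \<xi>\<close> with \<open>d \<xi> = 0\<close>, and such \<open>\<xi>\<close> are of the form \<open>\<delta> q\<close>.\<close>

lemma attach_minus_plus_in_image: "\<exists>\<tau>. coact_right G \<tau> \<approx>\<^bsub>mixed\<^esub> attach minus_plus (delta p)"
proof -
  let ?T = "attach minus_plus (delta p)"
  define d where "d \<xi> = coprod_left L \<xi> - coact_right G \<xi>" for \<xi>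
  let ?cl = "\<lambda>(Y, q). fmap (\<lambda>(X, Z). (X, Z, q)) (Delta Y)"
  let ?cr = "\<lambda>(X, p). fmap (\<lambda>(Y, q). (X, Y, q)) (delta p)"
  let ?B = "bal UNIV dia3 rmul"
  have "fmap (\<lambda>(X, \<xi>). (X, d \<xi>)) (nest ?T) = frag_extend (\<lambda>(X, a). frag_of (X, ?cl a - ?cr a)) ?T"
    by (simp add: d_def nest_def frag_simps coprod_left_def coact_right_def)
  also have "\<dots> \<approx>\<^bsub>?B\<^esub> frag_extend (\<lambda>(X, a). frag_of (X, ?cl a) - frag_of (X, ?cr a)) ?T"
    unfolding case_prod_unfold by (rule frag_extend_cong) (rule bal_diff_right)
  also have "\<dots> = frag_extend (\<lambda>(X, a). frag_of (X, ?cl a)) ?T - frag_extend (\<lambda>(X, a). frag_of (X, ?cr a)) ?T"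
    by (simp add: case_prod_unfold frag_extend_additive)
  also have "\<dots> \<approx>\<^bsub>?B\<^esub> nest (lift (coprod_left L) ?T) - nest (lift (coact_right G) ?T)"
    unfolding coprod_left_extend coact_right_extend by (intro cong_diff cong_sym[OF nest_lift])
  also have "\<dots> \<approx>\<^bsub>?B\<^esub> 0"
    using tensor_hom_cong[OF nest_hom[OF right_stable_dia3] lift_attach_minus_plus[of p]] by (simp add: cong_span_def)
  finally have dz: "fmap (\<lambda>(X, \<xi>). (X, d \<xi>)) (nest ?T) \<in> add_span ?B"
    by (simp add: cong_zero_iff)
  have d_add: "d (\<xi> + \<xi>') \<approx>\<^bsub>dia3\<^esub> d \<xi> + d \<xi>'" for \<xi> \<xi>'
    by (simp add: d_def coprod_left_def coact_right_def frag_extend_add algebra_simps)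
  have d_act: "d (rmul \<xi> b) \<approx>\<^bsub>dia3\<^esub> rmul (d \<xi>) b" for \<xi> b
    using cong_diff[OF coprod_left_rmul[of \<xi> b] cong_refl[of "coact_right G (rmul \<xi> b)"]]
    by (simp add: d_def rmul_diff coact_right_rmul)
  obtain z' where z': "Poly_Mapping.keys z' \<subseteq> UNIV \<times> {\<xi> \<in> UNIV. d \<xi> \<in> add_span dia3}"
    "nest ?T \<approx>\<^bsub>bal UNIV dia rmul\<^esub> z'"
    by (rule flat_kernel[OF flat rmul_presented_module_UNIV[OF right_stable_dia]
        rmul_presented_module_UNIV[OF right_stable_dia3] d_add d_act _ dz]) auto
  let ?\<tau> = "fmap (\<lambda>(X, \<xi>). (X, eps \<xi>)) z'"
  have "coact_right G ?\<tau> \<approx>\<^bsub>mixed\<^esub> unnest z'"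
    unfolding coact_right_def unnest_def fmap_def frag_extend_frag_extend
  proof (rule frag_extend_cong)
    fix a assume "a \<in> Poly_Mapping.keys z'"
    then have "snd a \<approx>\<^bsub>dia\<^esub> delta (eps (snd a))"
      using z'(1) by (intro cotensor_regular) (auto simp: d_def)
    from triple_right_cong[OF cong_sym[OF this], of "fst a" reg.ups]
    show "frag_extend (\<lambda>(X, p). frag_extend (\<lambda>a. frag_of (case a of (Y, q) \<Rightarrow> (X, Y, q))) (delta p))
        (frag_of (case a of (X, \<xi>) \<Rightarrow> (X, eps \<xi>))) \<approx>\<^bsub>mixed\<^esub>
        (case a of (X, \<xi>) \<Rightarrow> frag_extend (\<lambda>a. frag_of (case a of (Y, a) \<Rightarrow> (X, Y, a))) \<xi>)"
      by (simp add: mixed_eq frag_simps)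
  qed
  also have "\<dots> \<approx>\<^bsub>mixed\<^esub> unnest (nest ?T)"
    unfolding mixed_eq by (rule tensor_hom_cong[OF unnest_hom cong_sym[OF z'(2)]])
  finally show ?thesis
    by (auto simp: unnest_nest)
qed

text \<open>The injective map \<open>1 \<diamondop> \<delta>\<close> sends both sides to \<open>1 \<diamondop> \<delta> p\<close>.\<close>

lemma canon_preimage:
  assumes "coact_right G \<tau> \<approx>\<^bsub>mixed\<^esub> attach minus_plus (delta p)"
  shows "canon \<tau> \<approx>\<^bsub>dia\<^esub> frag_of (1, p)"
proof (rule coact_right_cancel)
  have "coact_right G (canon \<tau>) \<approx>\<^bsub>dia3\<^esub> twist Delta (coact_right G \<tau>)"
    by (rule cong_sym[OF twist_coact_right])
  also have "\<dots> \<approx>\<^bsub>dia3\<^esub> twist Delta (attach minus_plus (delta p))"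
    using tensor_hom_cong[OF twist_Delta_hom[OF extendable_dia]] assms by (simp add: mixed_eq dia3_eq)
  also have "\<dots> \<approx>\<^bsub>dia3\<^esub> coact_right G (frag_of (1, p))"
    unfolding coact_right_frag_of dia3_eq by (rule twist_Delta_attach_minus_plus)
  finally show "coact_right G (canon \<tau>) \<approx>\<^bsub>dia3\<^esub> coact_right G (frag_of (1, p))" .
qed

text \<open>The canonical map commutes with right multiplication on \<open>L\<close>, so the preimages of \<open>1 \<otimes> p\<close> suffice.\<close>

lemma canon_surjective: "\<exists>w. canon w \<approx>\<^bsub>dia\<^esub> y"
proof (rule frag_induction[of y UNIV])
  show "\<exists>w. canon w \<approx>\<^bsub>dia\<^esub> 0"
    by (rule exI[of _ 0]) (simp add: canon_def)
  fix a :: "'l \<times> 'p"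
  obtain \<tau> where "canon \<tau> \<approx>\<^bsub>dia\<^esub> frag_of (1, snd a)"
    using attach_minus_plus_in_image canon_preimage by blast
  from tensor_hom_cong[OF dia_mult_right[of "fst a"] this]
  show "\<exists>w. canon w \<approx>\<^bsub>dia\<^esub> frag_of a"
    by (auto simp flip: canon_mult_right)
next
  fix x y :: "'l \<times> 'p \<Rightarrow>\<^sub>0 int"
  assume "\<exists>w. canon w \<approx>\<^bsub>dia\<^esub> x" "\<exists>w. canon w \<approx>\<^bsub>dia\<^esub> y"
  then show "\<exists>w. canon w \<approx>\<^bsub>dia\<^esub> x - y"
    using cong_diff canon_diff by metis
qed simp

lemma canonical_map_inj: "inj_on (canonical_map L G) (quot ups)"
proof (rule inj_onI)
  fix c c' assume "c \<in> quot ups" "c' \<in> quot ups" and eq: "canonical_map L G c = canonical_map L G c'"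
  then obtain x y where xy: "c = cls ups x" "c' = cls ups y"
    by (auto simp: quot_def)
  then have "canon (x - y) \<in> add_span dia"
    using eq by (simp add: canonical_map_cls cls_eq_iff cong_span_def canon_diff)
  then show "c = c'"
    using canon_injective by (simp add: xy cls_eq_iff cong_span_def)
qed

lemma skew_regular: "skew_regular L G"
  unfolding skew_regular_def bij_betw_def
proof
  show "canonical_map L G ` quot ups = quot dia"
  proof
    show "canonical_map L G ` quot ups \<subseteq> quot dia"
      by (auto simp: quot_def canonical_map_cls)
    show "quot dia \<subseteq> canonical_map L G ` quot ups"
    proof
      fix c assume "c \<in> quot dia"
      then obtain y where "c = cls dia y"
        by (auto simp: quot_def)
      moreover obtain w where "canon w \<approx>\<^bsub>dia\<^esub> y"
        using canon_surjective by blast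
      ultimately have "c = canonical_map L G (cls ups w)"
        by (simp add: canonical_map_cls cls_eq_iff cong_sym)
      then show "c \<in> canonical_map L G ` quot ups"
        by (auto simp: quot_def)
    qed
  qed
qed (rule canonical_map_inj)

lemma translation_eq:
  assumes "coact_right G \<tau> \<approx>\<^bsub>mixed\<^esub> attach minus_plus (delta p)"
  shows "translation L G p = cls ups \<tau>"
proof -
  have "canonical_map L G (cls ups \<tau>) = cls dia (frag_of (1, p))"
    using canon_preimage[OF assms] by (simp add: canonical_map_cls cls_eq_iff)
  then show ?thesis
    using inv_into_f_f[OF canonical_map_inj, of "cls ups \<tau>"] by (simp add: translation_def quot_def)
qed

section \<open>Collapsing with the counit\<close>

lemma collapse_hom:
  "tensor_hom (bal takeuchi_sums dia rmul) ups (frag_extend (\<lambda>(X, \<xi>). fmap (\<lambda>(Y, q). (X, lact G (counit L Y) q)) \<xi>))"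
proof (rule tensor_hom_frag_extend)
  let ?c = "frag_extend (\<lambda>(X, \<xi>). fmap (\<lambda>(Y, q). (X, lact G (counit L Y) q)) \<xi>)"
  fix r assume r: "r \<in> bal takeuchi_sums dia rmul"
  have c: "?c (frag_of (X, \<xi>)) \<approx>\<^bsub>ups\<^esub> frag_of (X, eps \<xi>)" for X \<xi>
    using eps_additive_extend[of "\<lambda>p. frag_of (X, p)" ups \<xi>, OF ups_diff_right]
    by (simp add: fmap_def case_prod_unfold)
  have "frag_of (X, 0) \<in> add_span ups" for X
    using ups_add_right[of X 0 0] add_span_uminus by (force simp: cong_span_def)
  moreover from r consider
      (left) X X' \<xi> where "r = frag_of (X + X', \<xi>) - frag_of (X, \<xi>) - frag_of (X', \<xi>)"
    | (right) X \<xi> \<xi>' where "r = frag_of (X, \<xi> + \<xi>') - frag_of (X, \<xi>) - frag_of (X, \<xi>')"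
    | (act) b X \<xi> where "r = frag_of (src L b * X, \<xi>) - frag_of (X, rmul \<xi> b)" "\<xi> \<in> takeuchi_sums"
    | (null) X \<xi> where "r = frag_of (X, \<xi>)" "\<xi> \<in> add_span dia"
    unfolding balanced_relators_def by auto
  then have "frag_extend (\<lambda>(X, \<xi>). frag_of (X, eps \<xi>)) r \<in> add_span ups"
  proof cases
    case left
    then show ?thesis
      using ups_add_left by (simp add: frag_extend_diff frag_extend_add cong_span_def diff_diff_eq)
  next
    case right
    have "eps (\<xi> + \<xi>') = eps \<xi> + eps \<xi>'"
      using eps_diff[of "\<xi> + \<xi>'" \<xi>'] by simp
    then show ?thesis
      using right ups_add_right by (simp add: frag_extend_diff frag_extend_add cong_span_def diff_diff_eq)
  next
    case act
    then show ?thesis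
      using ups_bal by (simp add: frag_extend_diff cong_span_def rmul_def eps_act)
  next
    case null
    then show ?thesis
      using calculation by (simp add: eps_span)
  qed
  moreover have "?c r \<approx>\<^bsub>ups\<^esub> frag_extend (\<lambda>(X, \<xi>). frag_of (X, eps \<xi>)) r"
    by (rule frag_extend_cong) (use c in auto)
  ultimately show "?c r \<in> add_span ups"
    using span_cong by blast
qed

text \<open>The inclusion \<open>L \<otimes>\<^sup>B (L \<times>\<^sub>B G) \<rightarrow> L \<otimes>\<^sup>B (L \<diamondop>\<^sub>B G)\<close> is injective by flatness, applied to the inclusion
  \<open>L \<times>\<^sub>B G \<rightarrow> L \<diamondop>\<^sub>B G\<close> as the map \<open>d\<close>.\<close>

lemma bal_takeuchi_sums_injective:
  assumes "Poly_Mapping.keys u \<subseteq> UNIV \<times> takeuchi_sums" and "u \<in> add_span (bal UNIV dia rmul)"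
  shows "u \<in> add_span (bal takeuchi_sums dia rmul)"
proof -
  have "fmap (\<lambda>(X, \<xi>). (X, \<xi>)) u \<in> add_span (bal UNIV dia rmul)"
    using assms(2) by (simp add: fmap_id)
  then obtain z' where z': "Poly_Mapping.keys z' \<subseteq> UNIV \<times> {\<xi> \<in> takeuchi_sums. \<xi> \<in> add_span dia}"
    "u \<approx>\<^bsub>bal takeuchi_sums dia rmul\<^esub> z'"
    by (rule flat_kernel[OF flat takeuchi_sums_presented_module
        rmul_presented_module_UNIV[OF right_stable_dia] cong_refl cong_refl assms(1)]) auto
  have "frag_extend frag_of z' \<approx>\<^bsub>bal takeuchi_sums dia rmul\<^esub> frag_extend (\<lambda>_. 0) z'"
    by (rule frag_extend_cong) (use z'(1) in \<open>auto simp: cong_zero_iff intro!: balanced_null\<close>)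
  then have "z' \<approx>\<^bsub>bal takeuchi_sums dia rmul\<^esub> 0"
    by (simp add: frag_extend_ident frag_extend_eq_0)
  then show ?thesis
    using z'(2) cong_trans cong_zero_iff by blast
qed

text \<open>The element is the image of \<open>(1 \<otimes> \<delta>) \<tau>\<close>, whose right legs are in the Takeuchi product. Any other way of
  writing it with such legs gives the same element of \<open>L \<otimes>\<^sup>B (L \<times>\<^sub>B G)\<close>, and \<open>\<epsilon> \<delta> = 1\<close>.\<close>

lemma counit_collapse_eq:
  assumes \<tau>: "coact_right G \<tau> \<approx>\<^bsub>mixed\<^esub> attach minus_plus (delta p)"
  shows "counit_collapse L G (coact_translation L G p) = cls ups \<tau>"
proof -
  let ?c = "frag_extend (\<lambda>(X, \<xi>). fmap (\<lambda>(Y, q). (X, lact G (counit L Y) q)) \<xi>)"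
  let ?z = "fmap (\<lambda>(X, p). (X, delta p)) \<tau>"
  have unnest_z: "unnest ?z = coact_right G \<tau>"
    by (simp add: unnest_def coact_right_def frag_simps)
  have keys_z: "Poly_Mapping.keys ?z \<subseteq> UNIV \<times> takeuchi_sums"
    using keys_frag_extend[of "\<lambda>a. frag_of (case a of (X, p) \<Rightarrow> (X, delta p))" \<tau>] delta_takeuchi_sums
    by (fastforce simp: fmap_def keys_frag_of)
  have c_z: "?c ?z \<approx>\<^bsub>ups\<^esub> \<tau>"
  proof -
    have "?c ?z \<approx>\<^bsub>ups\<^esub> frag_extend frag_of \<tau>"
      unfolding fmap_def frag_extend_frag_extend
    proof (rule frag_extend_cong)
      fix a :: "'l \<times> 'p"
      show "frag_extend (\<lambda>(X, \<xi>). frag_extend (\<lambda>a. frag_of (case a of (Y, q) \<Rightarrow> (X, lact G (counit L Y) q))) \<xi>)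
          (frag_of (case a of (X, p) \<Rightarrow> (X, delta p))) \<approx>\<^bsub>ups\<^esub> frag_of a"
        using eps_additive_extend[of "\<lambda>p. frag_of (fst a, p)" ups "delta (snd a)", OF ups_diff_right]
        by (simp add: case_prod_unfold eps_delta)
    qed
    then show ?thesis
      by (simp add: frag_extend_ident)
  qed
  have unnest_eq: "frag_extend (\<lambda>(X, \<xi>). fmap (\<lambda>(Y, q). (X, Y, q)) \<xi>) z = unnest z" for z :: "'l \<times> ('l \<times> 'p \<Rightarrow>\<^sub>0 int) \<Rightarrow>\<^sub>0 int"
    by (simp add: unnest_def)
  have "cls ups (?c z) = cls ups \<tau>"
    if keys: "\<forall>(X, \<xi>)\<in>Poly_Mapping.keys z. cls dia \<xi> \<in> takeuchi L G"
      and z: "cls mixed (unnest z) = coact_translation L G p" for z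
  proof -
    have "unnest z \<approx>\<^bsub>mixed\<^esub> unnest ?z"
      using z cong_trans[OF _ cong_sym[OF \<tau>]] unfolding coact_translation_eq cls_eq_iff unnest_z by blast
    then have "nest (unnest z) \<approx>\<^bsub>bal UNIV dia rmul\<^esub> nest (unnest ?z)"
      unfolding mixed_eq by (rule tensor_hom_cong[OF nest_hom[OF right_stable_dia]])
    moreover have nest_unnest: "nest (unnest y) \<approx>\<^bsub>bal UNIV dia rmul\<^esub> y" for y :: "'l \<times> ('l \<times> 'p \<Rightarrow>\<^sub>0 int) \<Rightarrow>\<^sub>0 int"
    proof -
      have "nest (unnest y) \<approx>\<^bsub>bal UNIV dia rmul\<^esub> frag_extend frag_of y"
        unfolding nest_def unnest_def fmap_def frag_extend_frag_extend
      proof (rule frag_extend_cong)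
        fix a :: "'l \<times> ('l \<times> 'p \<Rightarrow>\<^sub>0 int)"
        show "frag_extend (\<lambda>a. frag_of (case a of (X, Y, a) \<Rightarrow> (X, frag_of (Y, a))))
            (case a of (X, \<xi>) \<Rightarrow> frag_extend (\<lambda>a. frag_of (case a of (Y, a) \<Rightarrow> (X, Y, a))) \<xi>) \<approx>\<^bsub>bal UNIV dia rmul\<^esub> frag_of a"
          using bal_expand[of "fst a" "snd a"] by (simp add: frag_simps)
      qed
      then show ?thesis
        by (simp add: frag_extend_ident)
    qed
    ultimately have "z \<approx>\<^bsub>bal UNIV dia rmul\<^esub> ?z"
      using cong_trans[OF cong_sym[OF nest_unnest] cong_trans[OF _ nest_unnest]] by blast
    moreover have "Poly_Mapping.keys (z - ?z) \<subseteq> UNIV \<times> takeuchi_sums"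
      using keys keys_z keys_diff[of z ?z] by (fastforce simp: takeuchi_iff)
    ultimately have "z - ?z \<in> add_span (bal takeuchi_sums dia rmul)"
      by (intro bal_takeuchi_sums_injective) (simp_all add: cong_span_def)
    then have "?c z \<approx>\<^bsub>ups\<^esub> ?c ?z"
      by (intro tensor_hom_cong[OF collapse_hom]) (simp add: cong_span_def)
    then show ?thesis
      using c_z cong_trans by (auto simp: cls_eq_iff)
  qed
  moreover have "\<forall>(X, \<xi>)\<in>Poly_Mapping.keys ?z. cls dia \<xi> \<in> takeuchi L G"
    using keys_z by (auto simp: takeuchi_iff)
  moreover have "cls mixed (unnest ?z) = coact_translation L G p"
    using \<tau> by (simp add: unnest_z coact_translation_eq cls_eq_iff)
  moreover have "cls ups (?c ?z) = cls ups \<tau>"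
    using c_z by (simp add: cls_eq_iff)
  ultimately show ?thesis
    unfolding counit_collapse_def unnest_eq by blast
qed

section \<open>The Takeuchi conditions on the translation map\<close>

lemma mixed_src_right: "tensor_hom mixed mixed (fmap (\<lambda>(X, Y, q). (X * src L a, Y, q)))"
  unfolding mixed_eq
  by (rule tensor_hom_triple_fmap[of _ "\<lambda>X. X * src L a" "\<lambda>Y. Y" _ "\<lambda>q. q"])
    (simp_all add: reg.ups_mult_right fmap_id tensor_hom_id)

lemma mixed_src_left: "tensor_hom mixed mixed (fmap (\<lambda>(X, Y, q). (X, src L a * Y, q)))"
  unfolding mixed_eq
proof (rule tensor_hom_triple_fmap[of _ "\<lambda>X. X" "\<lambda>Y. src L a * Y" _ "\<lambda>q. q"])
  have "frag_of (src L b * X, src L a * Y) \<approx>\<^bsub>reg.ups\<^esub> frag_of (X, src L a * (Y * src L b))" for b X Y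
    using reg.ups_bal[of b X "src L a * Y"] by (simp add: mult.assoc)
  then show "tensor_hom reg.ups reg.ups (fmap (\<lambda>(X, Y). (X, src L a * Y)))"
    unfolding fmap_def
    by (intro reg.tensor_hom_ups) (auto simp: distrib_left intro: reg.ups_add_left reg.ups_add_right)
qed (rule dia_mult_src)

lemma mixed_tgt_right: "tensor_hom mixed mixed (fmap (\<lambda>(X, Y, q). (X, Y * tgt L d, q)))"
  unfolding mixed_eq
proof (rule tensor_hom_triple_fmap[of _ "\<lambda>X. X" "\<lambda>Y. Y * tgt L d" _ "\<lambda>q. q"])
  have "frag_of (src L b * X, Y * tgt L d) \<approx>\<^bsub>reg.ups\<^esub> frag_of (X, Y * src L b * tgt L d)" for b X Y
    using reg.ups_bal[of b X "Y * tgt L d"] by (simp add: mult.assoc src_tgt_commute)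
  then show "tensor_hom reg.ups reg.ups (fmap (\<lambda>(X, Y). (X, Y * tgt L d)))"
    unfolding fmap_def
    by (intro reg.tensor_hom_ups) (auto simp: distrib_right intro: reg.ups_add_left reg.ups_add_right)
qed (rule dia_mult_right)

lemma mixed_ract: "tensor_hom mixed mixed (fmap (\<lambda>(X, Y, q). (X, Y, ract G q d)))"
  unfolding mixed_eq
  by (rule tensor_hom_triple_fmap[of _ "\<lambda>X. X" "\<lambda>Y. Y" _ "\<lambda>q. ract G q d"])
    (simp_all add: dia_ract fmap_id tensor_hom_id)

text \<open>The first condition is a property of \<open>Y\<^sub>[\<^sub>-\<^sub>] \<otimes> Y\<^sub>[\<^sub>+\<^sub>]\<close>. The second one is evident from the form \<open>(1 \<otimes> \<delta>) \<tau>\<close> of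
  the element, because \<open>\<delta>\<close> takes values in \<open>L \<times>\<^sub>B G\<close>.\<close>

lemma coact_translation_takeuchi: "coact_translation L G p \<in> mixed_takeuchi L G"
proof -
  obtain \<tau> where \<tau>: "coact_right G \<tau> \<approx>\<^bsub>mixed\<^esub> attach minus_plus (delta p)"
    using attach_minus_plus_in_image by blast
  have src: "fmap (\<lambda>(X, Y, q). (X * src L a, Y, q)) (attach minus_plus (delta p)) \<approx>\<^bsub>mixed\<^esub>
      fmap (\<lambda>(X, Y, q). (X, src L a * Y, q)) (attach minus_plus (delta p))" for a
    unfolding attach_def fmap_def frag_extend_frag_extend
  proof (rule frag_extend_cong)
    fix c :: "'l \<times> 'p"
    show "frag_extend (\<lambda>c. frag_of (case c of (X, Y, q) \<Rightarrow> (X * src L a, Y, q)))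
        (case c of (Y, q) \<Rightarrow> frag_extend (\<lambda>c. frag_of (case c of (X, Z) \<Rightarrow> (X, Z, q))) (minus_plus Y)) \<approx>\<^bsub>mixed\<^esub>
        frag_extend (\<lambda>c. frag_of (case c of (X, Y, q) \<Rightarrow> (X, src L a * Y, q)))
        (case c of (Y, q) \<Rightarrow> frag_extend (\<lambda>c. frag_of (case c of (X, Z) \<Rightarrow> (X, Z, q))) (minus_plus Y))"
      using triple_left_cong[OF minus_plus_takeuchi[of a "fst c"], of "snd c" dia] by (simp add: mixed_eq frag_simps)
  qed
  have "fmap (\<lambda>(X, Y, q). (X, Y * tgt L d, q)) (coact_right G \<tau>) \<approx>\<^bsub>mixed\<^esub>
      fmap (\<lambda>(X, Y, q). (X, Y, ract G q d)) (coact_right G \<tau>)" for d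
    unfolding coact_right_def fmap_def frag_extend_frag_extend
  proof (rule frag_extend_cong)
    fix c :: "'l \<times> 'p"
    have "fmap (\<lambda>(Y, q). (Y * tgt L d, q)) (delta (snd c)) \<approx>\<^bsub>dia\<^esub> fmap (\<lambda>(Y, q). (Y, ract G q d)) (delta (snd c))"
      using delta_takeuchi_sums by (simp add: takeuchi_sums_def)
    from triple_right_cong[OF this, of "fst c" reg.ups]
    show "frag_extend (\<lambda>c. frag_of (case c of (X, Y, q) \<Rightarrow> (X, Y * tgt L d, q)))
        (case c of (X, p) \<Rightarrow> frag_extend (\<lambda>c. frag_of (case c of (Y, q) \<Rightarrow> (X, Y, q))) (delta p)) \<approx>\<^bsub>mixed\<^esub>
        frag_extend (\<lambda>c. frag_of (case c of (X, Y, q) \<Rightarrow> (X, Y, ract G q d)))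
        (case c of (X, p) \<Rightarrow> frag_extend (\<lambda>c. frag_of (case c of (Y, q) \<Rightarrow> (X, Y, q))) (delta p))"
      by (simp add: mixed_eq frag_simps)
  qed
  then have "induced mixed (fmap (\<lambda>(X, Y, q). (X, Y * tgt L d, q))) (cls mixed (coact_right G \<tau>)) =
      induced mixed (fmap (\<lambda>(X, Y, q). (X, Y, ract G q d))) (cls mixed (coact_right G \<tau>))" for d
    by (simp add: tensor_hom_induced[OF mixed_tgt_right] tensor_hom_induced[OF mixed_ract] cls_eq_iff)
  moreover have "cls mixed (coact_right G \<tau>) = cls mixed (attach minus_plus (delta p))"
    using \<tau> by (simp add: cls_eq_iff)
  moreover have "induced mixed (fmap (\<lambda>(X, Y, q). (X * src L a, Y, q))) (cls mixed (attach minus_plus (delta p))) =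
      induced mixed (fmap (\<lambda>(X, Y, q). (X, src L a * Y, q))) (cls mixed (attach minus_plus (delta p)))" for a
    unfolding tensor_hom_induced[OF mixed_src_right] tensor_hom_induced[OF mixed_src_left] cls_eq_iff by (rule src)
  ultimately show ?thesis
    unfolding mixed_takeuchi_def coact_translation_eq by (simp add: quot_def)
qed

end

theorem lemma3p6:
  fixes L :: "('k::field, 'b::{ring,monoid_mult}, 'l::{ring,monoid_mult}) bialgebroid"
    and G :: "('k, 'b, 'p::ab_group_add, 'l) comod"
  assumes "left_bialgebroid L"
    and "faithfully_flat_bialgebroid L"
    and "anti_left_hopf L"
    and "left_comodule L G"
  shows "skew_regular L G \<and>
    (\<forall>p. translation L G p = counit_collapse L G (coact_translation L G p)) \<and>
    (\<forall>p. translation_coact L G p = coact_translation L G p \<and>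
         coact_translation L G p \<in> mixed_takeuchi L G)"
proof -
  interpret hopf_comodule L G
    using assms by (intro hopf_comodule.intro anti_left_hopf_bialgebroid.intro
        anti_left_hopf_bialgebroid_axioms.intro bialgebroid_comodule.intro)
      (auto simp: faithfully_flat_bialgebroid_def)
  have "translation L G p = counit_collapse L G (coact_translation L G p)"
    "translation_coact L G p = coact_translation L G p" for p
  proof -
    obtain \<tau> where \<tau>: "coact_right G \<tau> \<approx>\<^bsub>mixed\<^esub> attach minus_plus (delta p)"
      using attach_minus_plus_in_image by blast
    show "translation L G p = counit_collapse L G (coact_translation L G p)"
      by (simp add: translation_eq[OF \<tau>] counit_collapse_eq[OF \<tau>])
    show "translation_coact L G p = coact_translation L G p"
      using \<tau> by (simp add: translation_coact_def translation_eq[OF \<tau>] tensor_hom_induced[OF coact_right_ups]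
          coact_translation_eq cls_eq_iff)
  qed
  then show ?thesis
    using skew_regular coact_translation_takeuchi by blast
qed

end
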